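(* Let $d\ge2$, $\mathcal{C}>0$, $\beta>1/2$, and let $X$ be a $p_n$-GERW* in direction $\ell\in\mathbb{S}^{d-1}$ on $\mathbb{Z}^d$ with $p_n=\mathcal{C}n^{-\beta}\wedge1$. Suppose that $$\lim_{k\to\infty}k^{-1/2}\,\mathbb{E}\Big[\sup_{1\le i\le k}\|\xi_i\|\Big]=0,$$ and that there exists a continuous $d\times d$ matrix-valued function $C=((c_{i,j}))$ on $[0,\infty)$ with $C(0)=0$ and $$\sum_{i,j=1}^d(c_{i,j}(t)-c_{i,j}(s))\alpha_i\alpha_j\ge0\quad\text{for all }\alpha\in\mathbb{R}^d,\ t>s\ge0,$$ such that for every $t\ge 0$ $$\frac1n\sum_{i=1}^{\lfloor nt\rfloor}\xi_i\xi_i^T\xrightarrow[n\to\infty]{}C(t)\quad\text{in probability.}$$ For $n\ge1$ and $t\ge0$ let $$\hat B_t^n=\frac{X_{\lfloor nt\rfloor}}{n^{1/2}}+(nt-\lfloor nt\rfloor)\frac{X_{\lfloor nt\rfloor+1}-X_{\lfloor nt\rfloor}}{n^{1/2}}.$$ Then $\{\hat B^n_\cdot\}_{n\ge1}$ converges in distribution, in $C_{\mathbb{R}^d}[0,\infty)$, to a process with independent Gaussian increments and sample paths in $C_{\mathbb{R}^d}[0,\infty)$.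
   Context: Definition of the $p_n$-GERW* in direction $\ell$ on $\mathbb{Z}^d$ (for $p_n=\mathcal{C}n^{-\beta}\wedge1$, $\beta>1/2$). Let $\ell\in\mathbb{S}^{d-1}$ (unit sphere of $\mathbb{R}^d$) and let $\|\cdot\|$ be the Euclidean norm. Let $\{\xi_i\}_{i\ge1}$ and $\{\gamma_i\}_{i\ge1}$ be sequences of $\mathbb{Z}^d$-valued random vectors on a probability space $(\Omega,\mathcal{F},\mathbb{P})$, adapted to a filtration $\{\mathcal{F}_n\}_{n\ge0}$ (with $\mathcal{F}_0$ containing all null sets), such that: (i) there is $\theta<\beta-1/2$ with $\sup_{k\ge1}\mathbb{E}[\|\xi_k\|]/k^\theta<\infty$ and $\sup_{k\ge1}\mathbb{E}[\|\gamma_k\|]/k^\theta<\infty$; (ii) there is a constant $\lambda>0$ such that for all $n\ge1$, $\mathbb{E}[\xi_n\mid\mathcal{F}_{n-1}]=0$ and $\mathbb{E}[\gamma_n\cdot\ell\mid\mathcal{F}_{n-1}]\ge\lambda$. Let $\{U_i\}_{i\ge1}$ be i.i.d. uniform on $[0,1]$, independent of $(\{\xi_i\},\{\gamma_i\})$. Set $X_0=0$, $E_0=\emptyset$, and for $n\ge1$ let $E_n=\{\exists k<n:\ X_k=X_n\}$. The process $X=\{X_n\}_{n\ge0}$ is defined by $$X_n=\sum_{i=1}^n\Big(\mathbf{1}_{E_{i-1}}\xi_i+\mathbf{1}_{E_{i-1}^c\cap\{U_i>p_i\}}\xi_i+\mathbf{1}_{E_{i-1}^c\cap\{U_i\le p_i\}}\gamma_i\Big),\quad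 n\ge1.$$ $C_{\mathbb{R}^d}[0,\infty)$ is the space of continuous functions $[0,\infty)\to\mathbb{R}^d$ with the metric $\rho(f,g)=\sum_{k\ge1}2^{-k}\sup_{0\le t\le k}(\|f(t)-g(t)\|\wedge1)$. Vectors are column vectors, $a^T$ is the transpose, and $a\wedge b=\min(a,b)$. *)

theory Defs
  imports "HOL-Probability.Probability"
begin

section \<open>The walk\<close>

definition int_lattice :: "(real^'d) set" where
  "int_lattice = {x. \<forall>j. x $ j \<in> \<int>}"

definition gerw_prob :: "real \<Rightarrow> real \<Rightarrow> nat \<Rightarrow> real" where
  "gerw_prob \<C> \<beta> n = min (\<C> * real n powr (- \<beta>)) 1"

definition revisit :: "(nat \<Rightarrow> 'a \<Rightarrow> real^'d) \<Rightarrow> nat \<Rightarrow> 'a set" where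
  "revisit X n = {\<omega>. \<exists>k<n. X k \<omega> = X n \<omega>}"

text \<open>
  The sequences \<open>\<xi>\<close>, \<open>\<gamma>\<close>, \<open>U\<close> are indexed from 1; their values at index 0 are irrelevant.
  Both moment bounds use the same exponent \<open>\<theta>\<close>. They are stated with nonnegative integrals, so
  that they imply integrability of every \<open>\<xi> k\<close> and \<open>\<gamma> k\<close>. The conditional expectation of the
  vector \<open>\<xi> n\<close> is taken componentwise. Independence of the whole sequence \<open>U\<close> from the whole joint
  sequence \<open>(\<xi>, \<gamma>)\<close> is independence of the generated sub-\<open>\<sigma>\<close>-algebras (\<open>indep_var\<close> would
  require both sequences to have the same value type).
\<close>

locale GERW_star = prob_space M + filtration "space M" F
  for M :: "'a measure" and F :: "nat \<Rightarrow> 'a measure" +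
  fixes \<xi> \<gamma> :: "nat \<Rightarrow> 'a \<Rightarrow> real^'d"
    and U :: "nat \<Rightarrow> 'a \<Rightarrow> real"
    and l :: "real^'d"
    and \<C> \<beta> :: real
    and X :: "nat \<Rightarrow> 'a \<Rightarrow> real^'d"
  assumes direction: "norm l = 1"
    and subalgebra_F: "\<And>n. subalgebra M (F n)"
    and null_sets_F0: "null_sets M \<subseteq> sets (F 0)"
    and lattice_\<xi>: "\<And>n \<omega>. n \<ge> 1 \<Longrightarrow> \<omega> \<in> space M \<Longrightarrow> \<xi> n \<omega> \<in> int_lattice"
    and lattice_\<gamma>: "\<And>n \<omega>. n \<ge> 1 \<Longrightarrow> \<omega> \<in> space M \<Longrightarrow> \<gamma> n \<omega> \<in> int_lattice"
    and adapted_\<xi>: "\<And>n. n \<ge> 1 \<Longrightarrow> \<xi> n \<in> borel_measurable (F n)"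
    and adapted_\<gamma>: "\<And>n. n \<ge> 1 \<Longrightarrow> \<gamma> n \<in> borel_measurable (F n)"
    and moments: "\<exists>\<theta> < \<beta> - 1/2.
        (SUP k\<in>{1..}. (\<integral>\<^sup>+\<omega>. norm (\<xi> k \<omega>) \<partial>M) / ennreal (real k powr \<theta>)) < \<infinity> \<and>
        (SUP k\<in>{1..}. (\<integral>\<^sup>+\<omega>. norm (\<gamma> k \<omega>) \<partial>M) / ennreal (real k powr \<theta>)) < \<infinity>"
    and centered: "\<And>n j. n \<ge> 1 \<Longrightarrow>
        AE \<omega> in M. real_cond_exp M (F (n - 1)) (\<lambda>\<omega>. \<xi> n \<omega> $ j) \<omega> = 0"
    and drift: "\<exists>lam>0. \<forall>n\<ge>1.
        AE \<omega> in M. real_cond_exp M (F (n - 1)) (\<lambda>\<omega>. \<gamma> n \<omega> \<bullet> l) \<omega> \<ge> lam"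
    and U_indep: "indep_vars (\<lambda>_. borel) U {1..}"
    and U_uniform: "\<And>n. n \<ge> 1 \<Longrightarrow> distr M borel (U n) = uniform_measure lborel {0..1}"
    and U_indep_steps: "indep_set
        (sets (vimage_algebra (space M) (\<lambda>\<omega>. \<lambda>n\<in>{1..}. U n \<omega>) (Pi\<^sub>M {1..} (\<lambda>_. borel))))
        (sets (vimage_algebra (space M) (\<lambda>\<omega>. \<lambda>n\<in>{1..}. (\<xi> n \<omega>, \<gamma> n \<omega>))
          (Pi\<^sub>M {1..} (\<lambda>_. borel \<Otimes>\<^sub>M borel))))"
    and walk_0: "\<And>\<omega>. \<omega> \<in> space M \<Longrightarrow> X 0 \<omega> = 0"
    and walk: "\<And>n \<omega>. n \<ge> 1 \<Longrightarrow> \<omega> \<in> space M \<Longrightarrow> X n \<omega> = (\<Sum>i=1..n.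
        indicat_real (revisit X (i - 1)) \<omega> *\<^sub>R \<xi> i \<omega>
      + indicat_real (- revisit X (i - 1) \<inter> {\<omega>. U i \<omega> > gerw_prob \<C> \<beta> i}) \<omega> *\<^sub>R \<xi> i \<omega>
      + indicat_real (- revisit X (i - 1) \<inter> {\<omega>. U i \<omega> \<le> gerw_prob \<C> \<beta> i}) \<omega> *\<^sub>R \<gamma> i \<omega>)"

definition scaled_walk :: "(nat \<Rightarrow> 'a \<Rightarrow> real^'d) \<Rightarrow> nat \<Rightarrow> real \<Rightarrow> 'a \<Rightarrow> real^'d" where
  "scaled_walk X n t \<omega> = (let m = nat \<lfloor>real n * t\<rfloor> in
     (1 / sqrt (real n)) *\<^sub>R X m \<omega>
     + (real n * t - real m) *\<^sub>R ((1 / sqrt (real n)) *\<^sub>R (X (m + 1) \<omega> - X m \<omega>)))"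


section \<open>Convergence in probability and in distribution\<close>

definition tendsto_in_prob ::
    "'a measure \<Rightarrow> (nat \<Rightarrow> 'a \<Rightarrow> 'b::{second_countable_topology, metric_space}) \<Rightarrow> 'b \<Rightarrow> bool" where
  "tendsto_in_prob M Y c \<longleftrightarrow>
     (\<forall>\<epsilon>>0. (\<lambda>n. measure M {\<omega> \<in> space M. dist (Y n \<omega>) c > \<epsilon>}) \<longlonglongrightarrow> 0)"

definition borel_of_topology :: "'b topology \<Rightarrow> 'b measure" where
  "borel_of_topology T = sigma (topspace T) {A. openin T A}"

definition tendsto_in_distribution ::
    "'b topology \<Rightarrow> 'a measure \<Rightarrow> (nat \<Rightarrow> 'a \<Rightarrow> 'b) \<Rightarrow> 'c measure \<Rightarrow> ('c \<Rightarrow> 'b) \<Rightarrow> bool" where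
  "tendsto_in_distribution T M Y N Z \<longleftrightarrow>
     (\<forall>n. Y n \<in> M \<rightarrow>\<^sub>M borel_of_topology T) \<and> Z \<in> N \<rightarrow>\<^sub>M borel_of_topology T \<and>
     (\<forall>\<phi>. continuous_map T euclideanreal \<phi> \<and> bounded (\<phi> ` topspace T) \<longrightarrow>
        (\<lambda>n. \<integral>\<omega>. \<phi> (Y n \<omega>) \<partial>M) \<longlonglongrightarrow> (\<integral>\<omega>. \<phi> (Z \<omega>) \<partial>N))"


section \<open>The path space of continuous functions on the half-line\<close>

text \<open>
  Paths are functions on \<open>real\<close>; extensionality makes two paths equal as soon as they agree
  on \<open>{0..}\<close>.
\<close>

definition cpaths :: "(real \<Rightarrow> real^'d) set" where
  "cpaths = {f \<in> extensional {0..}. continuous_on {0..} f}"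

definition cpath_dist :: "(real \<Rightarrow> real^'d) \<Rightarrow> (real \<Rightarrow> real^'d) \<Rightarrow> real" where
  "cpath_dist f g = (\<Sum>k. (1/2)^(Suc k) * (SUP t\<in>{0..real (Suc k)}. min (norm (f t - g t)) 1))"

abbreviation cpath_topology :: "(real \<Rightarrow> real^'d) topology" where
  "cpath_topology \<equiv> Metric_space.mtopology cpaths cpath_dist"

context
  fixes S :: "(real \<Rightarrow> real^'d) \<Rightarrow> (real \<Rightarrow> real^'d) \<Rightarrow> nat \<Rightarrow> real"
  defines "S \<equiv> \<lambda>f g k. SUP t\<in>{0..real (Suc k)}. min (norm (f t - g t)) 1"
begin

lemma cpath_sup_upper:
  assumes "0 \<le> t" "t \<le> real (Suc k)"
  shows "min (norm (f t - g t)) 1 \<le> S f g k"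
  unfolding S_def using assms by (intro cSUP_upper bdd_aboveI[of _ 1]) auto

lemma cpath_sup_least:
  assumes "\<And>t. 0 \<le> t \<Longrightarrow> t \<le> real (Suc k) \<Longrightarrow> min (norm (f t - g t)) 1 \<le> B"
  shows "S f g k \<le> B"
  unfolding S_def using assms by (intro cSUP_least) auto

lemma cpath_sup_bounds: "0 \<le> S f g k" "S f g k \<le> 1"
proof -
  have "0 \<le> min (norm (f 0 - g 0)) 1" by simp
  also have "\<dots> \<le> S f g k" by (rule cpath_sup_upper) auto
  finally show "0 \<le> S f g k" .
  show "S f g k \<le> 1" by (rule cpath_sup_least) auto
qed

lemma cpath_dist_summable: "summable (\<lambda>k. (1/2::real)^(Suc k) * S f g k)"
proof (rule summable_comparison_test'[where N = 0])
  show "summable (\<lambda>k. (1/2::real)^(Suc k))"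
    by (rule summable_Suc_iff[THEN iffD2]) (simp add: summable_geometric)
  show "norm ((1/2::real)^(Suc k) * S f g k) \<le> (1/2)^(Suc k)" for k
    using cpath_sup_bounds[of f g k] by (simp add: mult_left_le)
qed

lemma cpath_dist_eq: "cpath_dist f g = (\<Sum>k. (1/2)^(Suc k) * S f g k)"
  by (simp add: cpath_dist_def S_def)

lemma Metric_space_cpaths: "Metric_space (cpaths :: (real \<Rightarrow> real^'d) set) cpath_dist"
proof
  fix f g h :: "real \<Rightarrow> real^'d"
  show "0 \<le> cpath_dist f g"
    unfolding cpath_dist_eq
    by (intro suminf_nonneg cpath_dist_summable mult_nonneg_nonneg cpath_sup_bounds) auto
  show "cpath_dist f g = cpath_dist g f"
    by (simp add: cpath_dist_def norm_minus_commute)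
  have tri: "S f h k \<le> S f g k + S g h k" for k
  proof (rule cpath_sup_least)
    fix t :: real assume t: "0 \<le> t" "t \<le> real (Suc k)"
    have "norm (f t - h t) \<le> norm (f t - g t) + norm (g t - h t)"
      by (metis add_diff_cancel diff_add_eq norm_triangle_ineq diff_add_cancel add_diff_eq)
    then have "min (norm (f t - h t)) 1 \<le> min (norm (f t - g t)) 1 + min (norm (g t - h t)) 1"
      using norm_ge_zero[of "f t - g t"] norm_ge_zero[of "g t - h t"] by linarith
    also have "\<dots> \<le> S f g k + S g h k"
      using t by (intro add_mono cpath_sup_upper)
    finally show "min (norm (f t - h t)) 1 \<le> S f g k + S g h k" .
  qed
  show "cpath_dist f h \<le> cpath_dist f g + cpath_dist g h"
    unfolding cpath_dist_eq suminf_add[OF cpath_dist_summable cpath_dist_summable]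
  proof (rule suminf_le)
    show "(1/2)^(Suc k) * S f h k \<le> (1/2)^(Suc k) * S f g k + (1/2)^(Suc k) * S g h k" for k
      unfolding distrib_left[symmetric] by (intro mult_left_mono tri) auto
  qed (intro summable_add cpath_dist_summable)+
next
  fix f g :: "real \<Rightarrow> real^'d"
  assume fg: "f \<in> cpaths" "g \<in> cpaths"
  show "cpath_dist f g = 0 \<longleftrightarrow> f = g"
  proof
    assume "cpath_dist f g = 0"
    then have "\<forall>k. (1/2::real)^(Suc k) * S f g k = 0"
      unfolding cpath_dist_eq
      by (subst (asm) suminf_eq_zero_iff[OF cpath_dist_summable])
         (auto intro!: mult_nonneg_nonneg cpath_sup_bounds)
    then have S0: "S f g k = 0" for k by simp
    show "f = g"
    proof (rule extensionalityI)
      show "f \<in> extensional {0..}" "g \<in> extensional {0..}"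
        using fg by (auto simp: cpaths_def)
      fix t :: real assume "t \<in> {0..}"
      moreover obtain k where "t \<le> real k" using real_arch_simple by blast
      ultimately have "0 \<le> t" "t \<le> real (Suc k)" by auto
      from cpath_sup_upper[OF this, of f g] have "min (norm (f t - g t)) 1 \<le> 0"
        unfolding S0 .
      then show "f t = g t" by (auto simp: min_le_iff_disj)
    qed
  qed (simp add: cpath_dist_def)
qed

end


section \<open>Processes with independent Gaussian increments\<close>

text \<open>Point masses count as (degenerate) Gaussian laws.\<close>

definition gaussian_law :: "real measure \<Rightarrow> bool" where
  "gaussian_law \<mu> \<longleftrightarrow>
     (\<exists>m. \<mu> = return borel m) \<or> (\<exists>m \<sigma>. \<sigma> > 0 \<and> \<mu> = density lborel (normal_density m \<sigma>))"

definition gaussian_vector :: "'b measure \<Rightarrow> ('b \<Rightarrow> real^'d) \<Rightarrow> bool" where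
  "gaussian_vector N Y \<longleftrightarrow>
     Y \<in> borel_measurable N \<and> (\<forall>a. gaussian_law (distr N borel (\<lambda>\<omega>. a \<bullet> Y \<omega>)))"

definition indep_gaussian_increments :: "'b measure \<Rightarrow> ('b \<Rightarrow> real \<Rightarrow> real^'d) \<Rightarrow> bool" where
  "indep_gaussian_increments N W \<longleftrightarrow>
     (\<forall>s t. 0 \<le> s \<and> s < t \<longrightarrow> gaussian_vector N (\<lambda>\<omega>. W \<omega> t - W \<omega> s)) \<and>
     (\<forall>k (\<tau> :: nat \<Rightarrow> real). 0 \<le> \<tau> 0 \<and> strict_mono_on {..k} \<tau> \<longrightarrow>
        prob_space.indep_vars N (\<lambda>_. borel) (\<lambda>i \<omega>. W \<omega> (\<tau> (Suc i)) - W \<omega> (\<tau> i)) {..<k})"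

end

theory Submission
  imports Defs
begin

text \<open>
  Compare the walk \<open>X\<close> with the sum \<open>S\<close> of the martingale differences \<open>\<xi> i\<close>. They differ only at
  steps with \<open>U i \<le> p i\<close>. Since \<open>U i\<close> is independent of the step sizes, step \<open>i\<close> contributes to the
  expected difference at most a constant times \<open>i powr (\<theta> - \<beta>)\<close> with \<open>\<theta> - \<beta> < - 1/2\<close>, so that
  \<open>max \<bar>X k - S k\<bar>\<close> over \<open>k \<le> n\<close> is of smaller order than \<open>sqrt n\<close> in mean
  (\<open>excitation_error_small\<close>). What remains is a functional central limit theorem for \<open>S\<close> whose
  increments have first moments only, while their squares sum up to a deterministic limit
  (\<open>functional_limit\<close>). It rests on two products that have mean one because \<open>\<xi>\<close> is a martingale
  difference sequence.

  The product of the factors \<open>1 + \<i> z j\<close> is close to \<open>exp (\<i> \<Sum>z j + v / 2)\<close> if the squares of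
  the \<open>z j\<close> sum up to nearly \<open>v\<close> and every \<open>z j\<close> is small. This is McLeish's proof of the martingale
  central limit theorem (\<open>martingale_central_limit\<close>). A linear combination of values of \<open>S\<close> at several
  times is again a sum of martingale differences, so all joint characteristic functions converge to
  Gaussian ones (\<open>finite_dimensional_limit\<close>). The product of the factors \<open>1 + lam \<cdot> z j\<close>, stopped when
  the partial sum is large, gives an exponential maximal inequality
  (\<open>exponential_maximal_inequality\<close>). Applied on the blocks of a fine grid it shows that the rescaled
  paths oscillate little within blocks (\<open>oscillation_tight\<close>), because the bound for one block is
  quadratic in the increment of \<open>C\<close> and these increments are uniformly small with a bounded sum.

  The limit is built from a sequence of independent standard normal variables. The function
  \<open>C (min s t)\<close> is a positive semidefinite kernel, being a limit of sums of squares, and its Cholesky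
  factor turns the sequence into a Gaussian field indexed by rational times. The oscillation bound
  passes from the rescaled walks to this field (\<open>limit_locally_uniformly_continuous\<close>), which
  therefore extends to a continuous process. Its increments are independent and Gaussian because
  their joint characteristic function factors (\<open>indep_gaussian_increments_if_transform\<close>).

  Convergence in distribution on the path space follows in three reductions. Bounded continuous
  functionals are increasing limits of Lipschitz functionals (\<open>weak_convergence_from_lipschitz\<close>).
  A Lipschitz functional of a path hardly changes if the path is replaced by its interpolation from a
  fine grid, uniformly for the rescaled walks by the oscillation bound
  (\<open>cpath_weak_convergence\<close>). A Lipschitz functional of finitely many values is approximated by
  trigonometric polynomials, whose expectations are given by characteristic functions
  (\<open>finite_dimensional_weak_convergence\<close>).
\<close>

section \<open>Martingale differences and exponential products\<close>

text \<open>
  The martingale property is stated as orthogonality to bounded functions of the past. In this form it is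
  inherited by linear combinations of the components of a vector-valued sequence.
\<close>

definition martingale_differences ::
    "'a measure \<Rightarrow> (nat \<Rightarrow> 'a measure) \<Rightarrow> (nat \<Rightarrow> 'a \<Rightarrow> real) \<Rightarrow> bool" where
  "martingale_differences M F z \<longleftrightarrow>
     (\<forall>j\<ge>1. z j \<in> borel_measurable (F j) \<and> integrable M (z j)) \<and>
     (\<forall>j\<ge>1. \<forall>g B. g \<in> borel_measurable (F (j - 1)) \<longrightarrow> (\<forall>\<omega>\<in>space M. \<bar>g \<omega>\<bar> \<le> B) \<longrightarrow>
        (\<integral>\<omega>. g \<omega> * z j \<omega> \<partial>M) = 0)"

locale discrete_filtration = prob_space M for M :: "'a measure" +
  fixes F :: "nat \<Rightarrow> 'a measure"
  assumes subalgebra: "subalgebra M (F n)"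
    and sets_mono: "m \<le> n \<Longrightarrow> sets (F m) \<subseteq> sets (F n)"
begin

lemma space_F [simp]: "space (F n) = space M"
  using subalgebra[of n] by (simp add: subalgebra_def)

lemma measurable_mono: "f \<in> borel_measurable (F m) \<Longrightarrow> m \<le> n \<Longrightarrow> f \<in> borel_measurable (F n)"
  using sets_mono[of m n] by (auto simp: measurable_def)

lemma measurable_F: "f \<in> borel_measurable (F m) \<Longrightarrow> f \<in> borel_measurable M"
  by (rule measurable_from_subalg[OF subalgebra])

lemma sets_F: "A \<in> sets (F m) \<Longrightarrow> A \<in> sets M"
  using subalgebra[of m] by (auto simp: subalgebra_def)

text \<open>
  Adding the factor for index \<open>n + 1\<close> changes the product by
  \<open>c \<cdot> P \<cdot> indicator (A (n + 1)) \<cdot> z (n + 1)\<close>, where \<open>P\<close> is the product so far. Cutting off with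
  the predictable events \<open>A j\<close> makes the weight of \<open>z (n + 1)\<close> bounded, so this change has mean zero
  although \<open>z (n + 1)\<close> is merely integrable.
\<close>

lemma expectation_prod_martingale_differences:
  fixes c :: complex
  assumes mds: "martingale_differences M F z"
    and A: "\<And>j. j \<ge> 1 \<Longrightarrow> A j \<in> sets (F (j - 1))"
    and bounded: "\<And>n \<omega>. \<omega> \<in> A (Suc n) \<Longrightarrow>
      cmod (\<Prod>j=1..n. 1 + c * of_real (indicator (A j) \<omega> * z j \<omega>)) \<le> K"
  shows "integrable M (\<lambda>\<omega>. \<Prod>j=1..n. 1 + c * of_real (indicator (A j) \<omega> * z j \<omega>)) \<and>
    (\<integral>\<omega>. (\<Prod>j=1..n. 1 + c * of_real (indicator (A j) \<omega> * z j \<omega>)) \<partial>M) = 1"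
proof (induction n)
  case 0
  show ?case by (simp add: prob_space)
next
  case (Suc n)
  define P where "P = (\<lambda>\<omega>. \<Prod>j=1..n. 1 + c * of_real (indicator (A j) \<omega> * z j \<omega>))"
  have zm: "z j \<in> borel_measurable (F j)" "integrable M (z j)" if "j \<ge> 1" for j
    using mds that by (auto simp: martingale_differences_def)
  have Pm: "P \<in> borel_measurable (F n)"
    unfolding P_def
  proof (intro borel_measurable_prod)
    fix j assume j: "j \<in> {1..n}"
    have [measurable]: "z j \<in> borel_measurable (F n)"
      using zm(1)[of j] j by (auto intro: measurable_mono)
    have [measurable]: "A j \<in> sets (F n)"
      using A[of j] sets_mono[THEN subsetD, of "j - 1" n "A j"] j by force
    show "(\<lambda>\<omega>. 1 + c * of_real (indicator (A j) \<omega> * z j \<omega>)) \<in> borel_measurable (F n)"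
      by measurable
  qed
  define g where "g = (\<lambda>\<omega>. indicator (A (Suc n)) \<omega> *\<^sub>R P \<omega>)"
  have [measurable]: "A (Suc n) \<in> sets (F n)" using A[of "Suc n"] by simp
  have [measurable]: "P \<in> borel_measurable (F n)" by (rule Pm)
  have gm[measurable]: "g \<in> borel_measurable (F n)" unfolding g_def by measurable
  have K: "cmod (g \<omega>) \<le> \<bar>K\<bar>" for \<omega>
    using bounded[of \<omega> n] by (auto simp: g_def P_def indicator_def split: if_splits)
  have gM[measurable]: "g \<in> borel_measurable M" by (rule measurable_F[OF gm])
  have zM[measurable]: "z (Suc n) \<in> borel_measurable M" using zm(2)[of "Suc n"] by simp
  have int: "integrable M (\<lambda>\<omega>. g \<omega> * of_real (z (Suc n) \<omega>))"
  proof (rule Bochner_Integration.integrable_bound)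
    show "integrable M (\<lambda>\<omega>. \<bar>K\<bar> * z (Suc n) \<omega>)" using zm(2)[of "Suc n"] by simp
    show "(\<lambda>\<omega>. g \<omega> * of_real (z (Suc n) \<omega>)) \<in> borel_measurable M"
      by measurable
    show "AE \<omega> in M. cmod (g \<omega> * of_real (z (Suc n) \<omega>)) \<le> norm (\<bar>K\<bar> * z (Suc n) \<omega>)"
      using K by (auto simp: norm_mult abs_mult intro!: mult_right_mono)
  qed
  have orth: "(\<integral>\<omega>. h \<omega> * z (Suc n) \<omega> \<partial>M) = 0"
    if "h \<in> borel_measurable (F n)" "\<And>\<omega>. \<bar>h \<omega>\<bar> \<le> \<bar>K\<bar>" for h
    using mds[unfolded martingale_differences_def, THEN conjunct2, rule_format, of "Suc n" h "\<bar>K\<bar>"] that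
    by auto
  have "(\<integral>\<omega>. g \<omega> * of_real (z (Suc n) \<omega>) \<partial>M) = 0"
  proof (rule complex_eqI)
    have "Re (\<integral>\<omega>. g \<omega> * of_real (z (Suc n) \<omega>) \<partial>M) = (\<integral>\<omega>. Re (g \<omega>) * z (Suc n) \<omega> \<partial>M)"
      by (subst integral_Re[OF int, symmetric]) simp
    also have "\<dots> = 0"
      using K by (intro orth) (auto intro: order_trans[OF abs_Re_le_cmod])
    finally show "Re (\<integral>\<omega>. g \<omega> * of_real (z (Suc n) \<omega>) \<partial>M) = Re 0" by simp
    have "Im (\<integral>\<omega>. g \<omega> * of_real (z (Suc n) \<omega>) \<partial>M) = (\<integral>\<omega>. Im (g \<omega>) * z (Suc n) \<omega> \<partial>M)"
      by (subst integral_Im[OF int, symmetric]) simp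
    also have "\<dots> = 0"
      using K by (intro orth) (auto intro: order_trans[OF abs_Im_le_cmod])
    finally show "Im (\<integral>\<omega>. g \<omega> * of_real (z (Suc n) \<omega>) \<partial>M) = Im 0" by simp
  qed
  moreover have eq: "(\<lambda>\<omega>. \<Prod>j=1..Suc n. 1 + c * of_real (indicator (A j) \<omega> * z j \<omega>))
      = (\<lambda>\<omega>. P \<omega> + c * (g \<omega> * of_real (z (Suc n) \<omega>)))"
    by (auto simp: P_def g_def scaleR_conv_of_real algebra_simps)
  moreover have "integrable M P" "(\<integral>\<omega>. P \<omega> \<partial>M) = 1"
    using Suc by (auto simp: P_def)
  ultimately show ?case
    unfolding eq using int by simp
qed

end

lemma cmod_one_plus_ii_le: "cmod (1 + \<i> * of_real x) \<le> exp (x\<^sup>2 / 2)"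
proof -
  have "(cmod (1 + \<i> * of_real x))\<^sup>2 = 1 + x\<^sup>2" by (simp add: cmod_def)
  also have "\<dots> \<le> exp (x\<^sup>2)" by (rule exp_ge_add_one_self)
  also have "\<dots> = (exp (x\<^sup>2 / 2))\<^sup>2" by (simp flip: exp_double)
  finally show ?thesis by (rule power2_le_imp_le) simp
qed

text \<open>
  The second factor makes the modulus of the product at most one and cancels the Taylor expansion of
  \<open>iexp x\<close> up to order two, so that errors add up along a product.
\<close>

lemma iexp_approx_product_factor:
  assumes "\<bar>x\<bar> \<le> 1"
  shows "cmod (iexp x - (1 + \<i> * of_real x) * of_real (exp (- (x\<^sup>2 / 2)))) \<le> 2 * \<bar>x\<bar> ^ 3"
proof -
  define y where "y = x\<^sup>2 / 2"
  define R1 where "R1 = iexp x - (1 + \<i> * of_real x - of_real (x\<^sup>2 / 2))"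
  define R2 where "R2 = exp (- y) - (1 - y)"
  have "(\<Sum>k\<le>2. (\<i> * of_real x)^k / fact k) = 1 + \<i> * of_real x - of_real (x\<^sup>2 / 2)"
    by (simp add: eval_nat_numeral mult_ac)
  then have R1: "cmod R1 \<le> \<bar>x\<bar> ^ 3 / 6"
    using iexp_approx1[of x 2] by (simp add: R1_def eval_nat_numeral)
  have y0: "0 \<le> y" by (simp add: y_def)
  have "exp (- y) \<le> 1 / (1 + y)"
    using y0 exp_ge_add_one_self[of y] by (simp add: exp_minus field_simps)
  also have "\<dots> \<le> 1 - y + y\<^sup>2"
  proof -
    have "1 \<le> (1 - y + y\<^sup>2) * (1 + y)"
      using y0 by (simp add: algebra_simps power2_eq_square)
    then show ?thesis using y0 by (simp add: divide_le_eq)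
  qed
  finally have R2: "\<bar>R2\<bar> \<le> y\<^sup>2"
    using exp_ge_add_one_self[of "-y"] by (simp add: R2_def)
  have "iexp x - (1 + \<i> * of_real x) * of_real (exp (- y))
      = R1 + \<i> * of_real (x ^ 3 / 2) - (1 + \<i> * of_real x) * of_real R2"
    by (simp add: R1_def R2_def y_def algebra_simps power3_eq_cube power2_eq_square)
  also have "cmod \<dots> \<le> cmod R1 + \<bar>x\<bar> ^ 3 / 2 + cmod (1 + \<i> * of_real x) * \<bar>R2\<bar>"
    by (intro order_trans[OF norm_triangle_ineq4] add_mono order_trans[OF norm_triangle_ineq])
       (auto simp: norm_mult norm_divide norm_power)
  also have "\<dots> \<le> \<bar>x\<bar> ^ 3 / 6 + \<bar>x\<bar> ^ 3 / 2 + 2 * (\<bar>x\<bar> ^ 3 / 4)"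
  proof (intro add_mono R1 order_refl mult_mono)
    show "cmod (1 + \<i> * of_real x) \<le> 2"
      using norm_triangle_ineq[of 1 "\<i> * of_real x"] assms by (simp add: norm_mult)
    have "y\<^sup>2 = \<bar>x\<bar> ^ 3 / 4 * \<bar>x\<bar>"
      by (simp add: y_def power2_eq_square power3_eq_cube)
    also have "\<dots> \<le> \<bar>x\<bar> ^ 3 / 4" using assms by (simp add: mult_left_le)
    finally show "\<bar>R2\<bar> \<le> \<bar>x\<bar> ^ 3 / 4" using R2 by linarith
  qed auto
  also have "\<dots> \<le> 2 * \<bar>x\<bar> ^ 3" by simp
  finally show ?thesis by (simp add: y_def)
qed

lemma exp_minus_lipschitz:
  fixes x y :: real
  assumes "0 \<le> x" "0 \<le> y"
  shows "\<bar>exp (- x) - exp (- y)\<bar> \<le> \<bar>x - y\<bar>"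
proof -
  have *: "exp (- x) - exp (- y) \<le> y - x" if "0 \<le> x" "x \<le> y" for x y :: real
  proof -
    have "exp (- x) - exp (- y) = exp (- x) * (1 - exp (- (y - x)))"
      by (simp add: algebra_simps flip: exp_add)
    also have "\<dots> \<le> 1 * (y - x)"
    proof (intro mult_mono)
      show "1 - exp (- (y - x)) \<le> y - x" using exp_ge_add_one_self[of "- (y - x)"] by linarith
    qed (use that in auto)
    finally show ?thesis by simp
  qed
  show ?thesis
    using *[of x y] *[of y x] assms
    by (cases "x \<le> y") auto
qed

context discrete_filtration
begin

text \<open>
  The product \<open>\<Prod>(1 + \<i> z j)\<close> has mean one and equals \<open>exp (\<i> S + V / 2)\<close> up to
  an error of order \<open>\<Sum>\<bar>z j\<bar>\<^sup>3\<close>, where \<open>S = \<Sum>z j\<close> and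
  \<open>V = \<Sum>(z j)\<^sup>2\<close>. If \<open>V\<close> is nearly the constant \<open>v\<close>, then taking expectations
  gives \<open>exp (- v / 2)\<close> for the characteristic function of \<open>S\<close>. Stopping the product when
  the sum of squares exceeds \<open>v + 1\<close> keeps it dominated by a multiple of \<open>1 + D\<close>.
\<close>

lemma characteristic_function_bound:
  fixes z D N v \<delta>
  defines "V \<equiv> \<lambda>\<omega>. \<Sum>j=1..N. (z j \<omega>)\<^sup>2"
  defines "K \<equiv> exp ((v + 1) / 2)"
  assumes mds: "martingale_differences M F z"
    and D: "integrable M D" "\<And>\<omega> j. \<omega> \<in> space M \<Longrightarrow> j \<in> {1..N} \<Longrightarrow> \<bar>z j \<omega>\<bar> \<le> D \<omega>"
      "\<And>\<omega>. \<omega> \<in> space M \<Longrightarrow> 0 \<le> D \<omega>"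
    and v: "0 \<le> v" and \<delta>: "0 < \<delta>" "\<delta> \<le> 1"
  shows "cmod ((\<integral>\<omega>. iexp (\<Sum>j=1..N. z j \<omega>) \<partial>M) - of_real (exp (- (v / 2))))
    \<le> \<delta> * (2 * (v + 1) + K) + (1 + K) * (prob {\<omega> \<in> space M. \<bar>V \<omega> - v\<bar> > \<delta>} + expectation D / \<delta>)
       + K * expectation D"
proof -
  \<comment> \<open>These events decrease in \<open>j\<close>: once the sum of squares is too large, all later factors are one.\<close>
  define A where "A = (\<lambda>j. {\<omega> \<in> space M. (\<Sum>l=1..j - 1. (z l \<omega>)\<^sup>2) \<le> v + 1})"
  define P where "P = (\<lambda>n \<omega>. \<Prod>j=1..n. 1 + \<i> * of_real (indicator (A j) \<omega> * z j \<omega>))"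
  have zm: "z j \<in> borel_measurable (F j)" "z j \<in> borel_measurable M" if "j \<ge> 1" for j
    using mds that by (auto simp: martingale_differences_def)
  have sums: "(\<lambda>\<omega>. \<Sum>l=1..n. (z l \<omega>)\<^sup>2) \<in> borel_measurable (F n)" for n
    using zm(1) by (intro borel_measurable_sum borel_measurable_power) (auto intro: measurable_mono)
  have A_sets: "A j \<in> sets (F (j - 1))" for j
  proof -
    have [measurable]: "(\<lambda>\<omega>. \<Sum>l=1..j - 1. (z l \<omega>)\<^sup>2) \<in> borel_measurable (F (j - 1))"
      by (rule sums)
    have "{\<omega> \<in> space (F (j - 1)). (\<Sum>l=1..j - 1. (z l \<omega>)\<^sup>2) \<le> v + 1} \<in> sets (F (j - 1))"
      by measurable
    then show ?thesis by (simp add: A_def)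
  qed
  have P_le: "cmod (P n \<omega>) \<le> exp ((\<Sum>l=1..n. (z l \<omega>)\<^sup>2) / 2)" for n \<omega>
  proof -
    have "cmod (P n \<omega>) \<le> (\<Prod>l=1..n. exp ((z l \<omega>)\<^sup>2 / 2))"
      unfolding P_def prod_norm[symmetric]
    proof (intro prod_mono conjI norm_ge_zero)
      fix l
      show "cmod (1 + \<i> * of_real (indicator (A l) \<omega> * z l \<omega>)) \<le> exp ((z l \<omega>)\<^sup>2 / 2)"
        using cmod_one_plus_ii_le[of "z l \<omega>"] by (cases "\<omega> \<in> A l") auto
    qed
    then show ?thesis by (simp add: exp_sum sum_divide_distrib)
  qed
  have P_prefix: "cmod (P n \<omega>) \<le> K" if "\<omega> \<in> A (Suc n)" for n \<omega>
  proof -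
    have "exp ((\<Sum>l=1..n. (z l \<omega>)\<^sup>2) / 2) \<le> K"
      using that by (simp add: A_def K_def)
    then show ?thesis using P_le[of n \<omega>] by linarith
  qed
  have P_mean: "integrable M (P n)" "(\<integral>\<omega>. P n \<omega> \<partial>M) = 1" for n
    using expectation_prod_martingale_differences[OF mds, of A \<i> K n] A_sets P_prefix
    by (auto simp: P_def)
  have K1: "1 \<le> K" using v by (simp add: K_def)
  \<comment> \<open>At most the last factor of the stopped product escapes the bound on the squares before it.\<close>
  have P_bound: "cmod (P n \<omega>) \<le> K * (1 + D \<omega>)" if "\<omega> \<in> space M" "n \<le> N" for n \<omega>
    using that
  proof (induction n)
    case 0
    have "1 * 1 \<le> K * (1 + D \<omega>)" using K1 D(3)[OF 0(1)] by (intro mult_mono) auto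
    then show ?case by (simp add: P_def)
  next
    case (Suc n)
    show ?case
    proof (cases "\<omega> \<in> A (Suc n)")
      case True
      have "cmod (1 + \<i> * of_real (z (Suc n) \<omega>)) \<le> 1 + \<bar>z (Suc n) \<omega>\<bar>"
        using norm_triangle_ineq[of 1 "\<i> * of_real (z (Suc n) \<omega>)"] by (simp add: norm_mult)
      also have "\<dots> \<le> 1 + D \<omega>" using D(2)[OF Suc.prems(1), of "Suc n"] Suc.prems by simp
      finally have "cmod (P n \<omega>) * cmod (1 + \<i> * of_real (z (Suc n) \<omega>)) \<le> K * (1 + D \<omega>)"
        using P_prefix[OF True] K1 by (intro mult_mono) auto
      then show ?thesis using True by (simp add: P_def norm_mult)
    next
      case False
      then show ?thesis using Suc by (simp add: P_def)
    qed
  qed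
  define S where "S = (\<lambda>\<omega>. \<Sum>j=1..N. z j \<omega>)"
  have [measurable]: "S \<in> borel_measurable M" "V \<in> borel_measurable M" "D \<in> borel_measurable M"
    unfolding S_def V_def using zm(2) D(1) by (auto intro!: borel_measurable_sum borel_measurable_power)
  define Bad where "Bad = {\<omega> \<in> space M. \<bar>V \<omega> - v\<bar> > \<delta>} \<union> {\<omega> \<in> space M. D \<omega> \<ge> \<delta>}"
  have Bad[measurable]: "Bad \<in> sets M" unfolding Bad_def by measurable
  have good: "cmod (iexp (S \<omega>) - P N \<omega> * of_real (exp (- (v / 2)))) \<le> \<delta> * (2 * (v + 1) + K)"
    if \<omega>: "\<omega> \<in> space M" "\<omega> \<notin> Bad" for \<omega>
  proof -
    have Vv: "\<bar>V \<omega> - v\<bar> \<le> \<delta>" and D\<delta>: "D \<omega> < \<delta>" using \<omega> by (auto simp: Bad_def)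
    have V1: "V \<omega> \<le> v + 1" "0 \<le> V \<omega>" using Vv \<delta> by (auto simp: V_def intro!: sum_nonneg)
    have "\<omega> \<in> A j" if "j \<in> {1..N}" for j
    proof -
      have "(\<Sum>l=1..j - 1. (z l \<omega>)\<^sup>2) \<le> V \<omega>"
        unfolding V_def using that by (intro sum_mono2) auto
      then show ?thesis using V1 \<omega> by (simp add: A_def)
    qed
    then have P_eq: "P N \<omega> = (\<Prod>j=1..N. 1 + \<i> * of_real (z j \<omega>))"
      unfolding P_def by (intro prod.cong) auto
    have z\<delta>: "\<bar>z j \<omega>\<bar> \<le> \<delta>" if "j \<in> {1..N}" for j
      using D(2)[OF \<omega>(1) that] D\<delta> by simp
    have "cmod (iexp (S \<omega>) - P N \<omega> * of_real (exp (- (V \<omega> / 2))))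
       = cmod ((\<Prod>j=1..N. iexp (z j \<omega>))
           - (\<Prod>j=1..N. (1 + \<i> * of_real (z j \<omega>)) * of_real (exp (- ((z j \<omega>)\<^sup>2 / 2)))))"
      by (simp add: P_eq S_def V_def prod.distrib sum_distrib_left sum_divide_distrib
          exp_sum sum_negf[symmetric] del: sum_negf)
    also have "\<dots> \<le> (\<Sum>j=1..N. cmod (iexp (z j \<omega>)
           - (1 + \<i> * of_real (z j \<omega>)) * of_real (exp (- ((z j \<omega>)\<^sup>2 / 2)))))"
    proof (rule norm_prod_diff)
      fix j
      show "cmod ((1 + \<i> * of_real (z j \<omega>)) * of_real (exp (- ((z j \<omega>)\<^sup>2 / 2)))) \<le> 1"
        using cmod_one_plus_ii_le[of "z j \<omega>"]
        by (simp add: norm_mult norm_divide exp_minus field_simps)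
    qed simp
    also have "\<dots> \<le> (\<Sum>j=1..N. 2 * \<delta> * (z j \<omega>)\<^sup>2)"
    proof (rule sum_mono)
      fix j assume j: "j \<in> {1..N}"
      have "2 * \<bar>z j \<omega>\<bar> ^ 3 = 2 * \<bar>z j \<omega>\<bar> * (z j \<omega>)\<^sup>2"
        by (simp add: power3_eq_cube power2_eq_square)
      also have "\<dots> \<le> 2 * \<delta> * (z j \<omega>)\<^sup>2"
        using z\<delta>[OF j] by (intro mult_right_mono) auto
      finally show "cmod (iexp (z j \<omega>)
           - (1 + \<i> * of_real (z j \<omega>)) * of_real (exp (- ((z j \<omega>)\<^sup>2 / 2)))) \<le> 2 * \<delta> * (z j \<omega>)\<^sup>2"
        using iexp_approx_product_factor[of "z j \<omega>"] z\<delta>[OF j] \<delta> by linarith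
    qed
    also have "\<dots> = 2 * \<delta> * V \<omega>" by (simp add: V_def sum_distrib_left)
    also have "\<dots> \<le> 2 * \<delta> * (v + 1)" using V1 \<delta> by (intro mult_left_mono) auto
    finally have 1: "cmod (iexp (S \<omega>) - P N \<omega> * of_real (exp (- (V \<omega> / 2)))) \<le> 2 * \<delta> * (v + 1)" .
    have "cmod (P N \<omega> * of_real (exp (- (V \<omega> / 2))) - P N \<omega> * of_real (exp (- (v / 2))))
        = cmod (P N \<omega>) * \<bar>exp (- (V \<omega> / 2)) - exp (- (v / 2))\<bar>"
      by (simp only: right_diff_distrib[symmetric] norm_mult of_real_diff[symmetric] norm_of_real)
    also have "\<dots> \<le> K * \<delta>"
    proof (intro mult_mono)
      have "exp (V \<omega> / 2) \<le> K" using V1 by (simp add: K_def)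
      then show "cmod (P N \<omega>) \<le> K" using P_le[of N \<omega>] by (simp add: V_def)
      show "\<bar>exp (- (V \<omega> / 2)) - exp (- (v / 2))\<bar> \<le> \<delta>"
        using exp_minus_lipschitz[of "V \<omega> / 2" "v / 2"] V1 v Vv by (simp add: abs_if split: if_splits)
    qed (use K1 in auto)
    finally have 2: "cmod (P N \<omega> * of_real (exp (- (V \<omega> / 2))) - P N \<omega> * of_real (exp (- (v / 2)))) \<le> K * \<delta>" .
    have "cmod (iexp (S \<omega>) - P N \<omega> * of_real (exp (- (v / 2)))) \<le> 2 * \<delta> * (v + 1) + K * \<delta>"
      by (rule norm_diff_triangle_le[OF 1 2])
    then show ?thesis by (simp add: algebra_simps)
  qed
  have bad: "cmod (iexp (S \<omega>) - P N \<omega> * of_real (exp (- (v / 2)))) \<le> 1 + K + K * D \<omega>"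
    if \<omega>: "\<omega> \<in> space M" for \<omega>
  proof -
    have "cmod (iexp (S \<omega>) - P N \<omega> * of_real (exp (- (v / 2)))) \<le> 1 + cmod (P N \<omega>) * exp (- (v / 2))"
      by (rule order_trans[OF norm_triangle_ineq4]) (simp add: norm_mult)
    also have "cmod (P N \<omega>) * exp (- (v / 2)) \<le> cmod (P N \<omega>) * 1"
      using v by (intro mult_left_mono) auto
    also have "\<dots> \<le> K * (1 + D \<omega>)" using P_bound[OF \<omega>, of N] by simp
    finally show ?thesis by (simp add: algebra_simps)
  qed
  have intS: "integrable M (\<lambda>\<omega>. iexp (S \<omega>))" by (rule integrable_iexp) auto
  have intD: "integrable M (\<lambda>\<omega>. iexp (S \<omega>) - P N \<omega> * of_real (exp (- (v / 2))))"
    using intS P_mean by simp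
  \<comment> \<open>The mean-one product brings \<open>exp (- v / 2)\<close> under the integral.\<close>
  have "(\<integral>\<omega>. iexp (S \<omega>) \<partial>M) - of_real (exp (- (v / 2)))
      = (\<integral>\<omega>. iexp (S \<omega>) - P N \<omega> * of_real (exp (- (v / 2))) \<partial>M)"
    using intS P_mean by simp
  also have "cmod \<dots> \<le> (\<integral>\<omega>. cmod (iexp (S \<omega>) - P N \<omega> * of_real (exp (- (v / 2)))) \<partial>M)"
    by (rule integral_norm_bound)
  also have "\<dots> \<le> (\<integral>\<omega>. \<delta> * (2 * (v + 1) + K) + (1 + K) * indicator Bad \<omega> + K * D \<omega> \<partial>M)"
  proof (rule integral_mono)
    show "integrable M (\<lambda>\<omega>. cmod (iexp (S \<omega>) - P N \<omega> * of_real (exp (- (v / 2)))))"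
      using intD by simp
    show "integrable M (\<lambda>\<omega>. \<delta> * (2 * (v + 1) + K) + (1 + K) * indicator Bad \<omega> + K * D \<omega>)"
      using D(1) by (auto simp: emeasure_eq_measure)
    fix \<omega> assume \<omega>: "\<omega> \<in> space M"
    have "0 \<le> K * D \<omega>" using K1 D(3)[OF \<omega>] by simp
    moreover have "0 \<le> \<delta> * (2 * (v + 1) + K)" using \<delta> v K1 by simp
    ultimately show "cmod (iexp (S \<omega>) - P N \<omega> * of_real (exp (- (v / 2))))
        \<le> \<delta> * (2 * (v + 1) + K) + (1 + K) * indicator Bad \<omega> + K * D \<omega>"
      using good[OF \<omega>] bad[OF \<omega>] by (cases "\<omega> \<in> Bad") auto
  qed
  also have "\<dots> = \<delta> * (2 * (v + 1) + K) + (1 + K) * prob Bad + K * expectation D"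
    using D(1) by (simp add: emeasure_eq_measure prob_space)
  also have "prob Bad \<le> prob {\<omega> \<in> space M. \<bar>V \<omega> - v\<bar> > \<delta>} + prob {\<omega> \<in> space M. D \<omega> \<ge> \<delta>}"
    unfolding Bad_def by (rule measure_Un_le) measurable
  also have "prob {\<omega> \<in> space M. D \<omega> \<ge> \<delta>} \<le> expectation D / \<delta>"
    using D(3) \<delta> by (intro integral_Markov_inequality_measure[OF D(1), where A = "{}"]) auto
  finally show ?thesis using K1 by (simp add: S_def)
qed

end

lemma exp_le_one_plus:
  fixes y :: real
  assumes "\<bar>y\<bar> \<le> 1/2"
  shows "exp (y - 2 * y\<^sup>2) \<le> 1 + y"
proof -
  have "y - 2 * y\<^sup>2 \<le> ln (1 + y)"
    using abs_ln_one_plus_x_minus_x_bound[OF assms] by linarith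
  then have "exp (y - 2 * y\<^sup>2) \<le> exp (ln (1 + y))" by simp
  also have "\<dots> = 1 + y" using assms by (subst exp_ln) auto
  finally show ?thesis .
qed

context discrete_filtration
begin

text \<open>
  The product \<open>\<Prod>(1 + lam \<cdot> z j)\<close>, stopped after the first index at which the partial
  sum reaches \<open>a\<close> or an increment exceeds \<open>b\<close>, has mean one. On the event in question it is at
  least \<open>exp (lam \<cdot> a - 2 \<cdot> lam\<^sup>2 \<cdot> q)\<close>, because \<open>1 + y \<ge> exp (y - 2 y\<^sup>2)\<close>. It need
  not be nonnegative, but only its last factor can be negative, and the factors before it
  multiply to at most \<open>exp (lam \<cdot> a)\<close>; to correct for a negative product, a multiple of the
  dominating function \<open>D\<close> is added before taking expectations.
\<close>

lemma exponential_maximal_inequality: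
  fixes z D N lam a b q
  defines "S \<equiv> \<lambda>k \<omega>. \<Sum>j=1..k. z j \<omega>"
  defines "V \<equiv> \<lambda>k \<omega>. \<Sum>j=1..k. (z j \<omega>)\<^sup>2"
  assumes mds: "martingale_differences M F z"
    and D: "integrable M D" "\<And>\<omega> j. \<omega> \<in> space M \<Longrightarrow> j \<in> {1..N} \<Longrightarrow> \<bar>z j \<omega>\<bar> \<le> D \<omega>"
      "\<And>\<omega>. \<omega> \<in> space M \<Longrightarrow> 0 \<le> D \<omega>"
    and lam: "0 < lam" "lam * b \<le> 1/2" and a: "0 < a"
  shows "prob {\<omega> \<in> space M. (\<exists>k\<in>{1..N}. a \<le> S k \<omega>) \<and> V N \<omega> \<le> q \<and> (\<forall>j\<in>{1..N}. \<bar>z j \<omega>\<bar> \<le> b)}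
    \<le> exp (- (lam * a) + 2 * lam\<^sup>2 * q) * (1 + lam * exp (lam * a) * expectation D)"
    (is "prob ?G \<le> _")
proof -
  define A where "A = (\<lambda>j. {\<omega> \<in> space M. (\<forall>i\<in>{1..j - 1}. \<bar>z i \<omega>\<bar> \<le> b) \<and> (\<forall>i\<in>{1..j - 1}. S i \<omega> < a)})"
  define P where "P = (\<lambda>n \<omega>. \<Prod>j=1..n. 1 + lam * (indicator (A j) \<omega> * z j \<omega>))"
  have P_complex: "(\<Prod>j=1..n. 1 + complex_of_real lam * of_real (indicator (A j) \<omega> * z j \<omega>))
      = of_real (P n \<omega>)" for n \<omega>
    by (simp add: P_def)
  have zm: "z j \<in> borel_measurable (F j)" "z j \<in> borel_measurable M" if "j \<ge> 1" for j
    using mds that by (auto simp: martingale_differences_def)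
  have Sm: "S i \<in> borel_measurable (F n)" if "i \<le> n" for i n
    unfolding S_def using zm(1) that by (intro borel_measurable_sum) (auto intro: measurable_mono)
  have A_sets: "A j \<in> sets (F (j - 1))" for j
  proof -
    have [measurable]: "S i \<in> borel_measurable (F (j - 1))" if "i \<in> {1..j - 1}" for i
      using that by (intro Sm) auto
    have [measurable]: "z i \<in> borel_measurable (F (j - 1))" if "i \<in> {1..j - 1}" for i
      using that by (intro measurable_mono[OF zm(1)]) auto
    have "{\<omega> \<in> space (F (j - 1)). (\<forall>i\<in>{1..j - 1}. \<bar>z i \<omega>\<bar> \<le> b) \<and> (\<forall>i\<in>{1..j - 1}. S i \<omega> < a)}
        \<in> sets (F (j - 1))"
      by measurable
    then show ?thesis by (simp add: A_def)
  qed
  have half: "\<bar>lam * z i \<omega>\<bar> \<le> 1/2" if "\<bar>z i \<omega>\<bar> \<le> b" for i \<omega>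
  proof -
    have "\<bar>lam * z i \<omega>\<bar> \<le> lam * b" using that lam by (simp add: abs_mult)
    then show ?thesis using lam by linarith
  qed
  have S_Suc: "S (Suc n) \<omega> = S n \<omega> + z (Suc n) \<omega>" "V (Suc n) \<omega> = V n \<omega> + (z (Suc n) \<omega>)\<^sup>2" for n \<omega>
    by (simp_all add: S_def V_def)
  have prefix: "0 \<le> P n \<omega> \<and> P n \<omega> \<le> exp (lam * S n \<omega>)" if "\<omega> \<in> A (Suc n)" for n \<omega>
    using that
  proof (induction n)
    case 0
    then show ?case by (simp add: P_def S_def)
  next
    case (Suc n)
    then have A: "\<omega> \<in> A (Suc n)" and z: "\<bar>z (Suc n) \<omega>\<bar> \<le> b" by (auto simp: A_def)
    have 1: "0 \<le> 1 + lam * z (Suc n) \<omega>" using half[OF z] by linarith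
    have "P n \<omega> * (1 + lam * z (Suc n) \<omega>) \<le> exp (lam * S n \<omega>) * exp (lam * z (Suc n) \<omega>)"
      using Suc.IH[OF A] 1 exp_ge_add_one_self[of "lam * z (Suc n) \<omega>"] by (intro mult_mono) auto
    moreover have "P (Suc n) \<omega> = P n \<omega> * (1 + lam * z (Suc n) \<omega>)" using A by (simp add: P_def)
    ultimately show ?case
      using mult_nonneg_nonneg[OF conjunct1[OF Suc.IH[OF A]] 1]
      by (simp only: S_Suc distrib_left[of lam] exp_add)
  qed
  have prefix_a: "P n \<omega> \<le> exp (lam * a)" if "\<omega> \<in> A (Suc n)" for n \<omega>
  proof -
    have "S n \<omega> < a" using that a by (cases "n = 0") (auto simp: A_def S_def)
    then have "exp (lam * S n \<omega>) \<le> exp (lam * a)" using lam by simp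
    then show ?thesis using prefix[OF that] by linarith
  qed
  have mean: "integrable M (P n)" "expectation (P n) = 1" for n
  proof -
    have "integrable M (\<lambda>\<omega>. complex_of_real (P n \<omega>)) \<and> (\<integral>\<omega>. complex_of_real (P n \<omega>) \<partial>M) = 1"
    proof (rule expectation_prod_martingale_differences[OF mds, of A "of_real lam" "exp (lam * a)" n,
          unfolded P_complex])
      fix n \<omega> assume *: "\<omega> \<in> A (Suc n)"
      show "cmod (of_real (P n \<omega>)) \<le> exp (lam * a)"
        using prefix[OF *] prefix_a[OF *] by simp
    qed (rule A_sets)
    then show "integrable M (P n)" "expectation (P n) = 1"
      by (auto simp: complex_of_real_integrable_eq integral_complex_of_real)
  qed
  have lower: "- (lam * exp (lam * a) * D \<omega>) \<le> P n \<omega>" if "\<omega> \<in> space M" "n \<le> N" for n \<omega>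
    using that
  proof (induction n)
    case 0
    have "0 \<le> lam * exp (lam * a) * D \<omega>" using lam D(3)[OF 0(1)] by simp
    then show ?case by (simp add: P_def)
  next
    case (Suc n)
    show ?case
    proof (cases "\<omega> \<in> A (Suc n)")
      case True
      have "\<bar>P n \<omega> * (lam * z (Suc n) \<omega>)\<bar> \<le> exp (lam * a) * (lam * D \<omega>)"
        unfolding abs_mult
        using prefix[OF True] prefix_a[OF True] D(2)[OF Suc.prems(1), of "Suc n"] Suc.prems lam
        by (intro mult_mono) auto
      moreover have "P (Suc n) \<omega> = P n \<omega> + P n \<omega> * (lam * z (Suc n) \<omega>)"
        using True by (simp add: P_def distrib_left)
      ultimately show ?thesis using prefix[OF True] by (simp add: abs_le_iff mult_ac)
    next
      case False
      then show ?thesis using Suc by (simp add: P_def)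
    qed
  qed
  have on_G: "(if \<exists>k\<in>{1..n}. a \<le> S k \<omega> then exp (lam * a - 2 * lam\<^sup>2 * V n \<omega>)
      else exp (lam * S n \<omega> - 2 * lam\<^sup>2 * V n \<omega>)) \<le> P n \<omega>"
    if "\<omega> \<in> space M" "\<forall>j\<in>{1..N}. \<bar>z j \<omega>\<bar> \<le> b" "n \<le> N" for n \<omega>
    using that
  proof (induction n)
    case 0
    then show ?case by (simp add: P_def S_def V_def)
  next
    case (Suc n)
    show ?case
    proof (cases "\<exists>k\<in>{1..n}. a \<le> S k \<omega>")
      case True
      then have "\<omega> \<notin> A (Suc n)" by (force simp: A_def)
      then have "P (Suc n) \<omega> = P n \<omega>" by (simp add: P_def)
      moreover have "exp (lam * a - 2 * lam\<^sup>2 * V (Suc n) \<omega>) \<le> exp (lam * a - 2 * lam\<^sup>2 * V n \<omega>)"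
        by (simp add: S_Suc mult_left_mono)
      moreover have "\<exists>k\<in>{1..Suc n}. a \<le> S k \<omega>" using True by force
      moreover have "exp (lam * a - 2 * lam\<^sup>2 * V n \<omega>) \<le> P n \<omega>"
        using Suc.IH Suc.prems True by simp
      ultimately show ?thesis by (simp only: if_True)
    next
      case False
      then have "\<omega> \<in> A (Suc n)" using Suc.prems by (auto simp: A_def not_le)
      then have P_Suc: "P (Suc n) \<omega> = P n \<omega> * (1 + lam * z (Suc n) \<omega>)" by (simp add: P_def)
      have "exp (lam * S (Suc n) \<omega> - 2 * lam\<^sup>2 * V (Suc n) \<omega>)
          = exp (lam * S n \<omega> - 2 * lam\<^sup>2 * V n \<omega>) * exp (lam * z (Suc n) \<omega> - 2 * (lam * z (Suc n) \<omega>)\<^sup>2)"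
        by (simp add: S_Suc algebra_simps power_mult_distrib flip: exp_add)
      also have "\<dots> \<le> P n \<omega> * (1 + lam * z (Suc n) \<omega>)"
        using Suc False half[of "Suc n" \<omega>] by (intro mult_mono exp_le_one_plus) (auto intro: order_trans[OF exp_ge_zero])
      finally have *: "exp (lam * S (Suc n) \<omega> - 2 * lam\<^sup>2 * V (Suc n) \<omega>) \<le> P (Suc n) \<omega>"
        by (simp add: P_Suc)
      moreover have "exp (lam * a - 2 * lam\<^sup>2 * V (Suc n) \<omega>) \<le> exp (lam * S (Suc n) \<omega> - 2 * lam\<^sup>2 * V (Suc n) \<omega>)"
        if "\<exists>k\<in>{1..Suc n}. a \<le> S k \<omega>"
      proof -
        have "a \<le> S (Suc n) \<omega>" using that False by (auto simp: le_Suc_eq)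
        then show ?thesis using lam by simp
      qed
      ultimately show ?thesis by (smt (verit))
    qed
  qed
  have SM[measurable]: "S k \<in> borel_measurable M" for k
    using measurable_F[OF Sm[OF order_refl]] .
  have VM[measurable]: "V k \<in> borel_measurable M" for k
    unfolding V_def using zm(2) by (intro borel_measurable_sum borel_measurable_power) auto
  have [measurable]: "z j \<in> borel_measurable M" if "j \<in> {1..N}" for j using zm(2) that by auto
  have G[measurable]: "?G \<in> sets M" by measurable
  define E where "E = exp (lam * a - 2 * lam\<^sup>2 * q)"
  have "E * prob ?G = (\<integral>\<omega>. E * indicator ?G \<omega> \<partial>M)"
    by simp
  also have "\<dots> \<le> (\<integral>\<omega>. P N \<omega> + lam * exp (lam * a) * D \<omega> \<partial>M)"
  proof (rule integral_mono)
    show "integrable M (\<lambda>\<omega>. E * indicator ?G \<omega>)"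
      by (intro integrable_mult_right) (simp add: emeasure_eq_measure)
    show "integrable M (\<lambda>\<omega>. P N \<omega> + lam * exp (lam * a) * D \<omega>)" using mean(1) D(1) by simp
    fix \<omega> assume \<omega>: "\<omega> \<in> space M"
    show "E * indicator ?G \<omega> \<le> P N \<omega> + lam * exp (lam * a) * D \<omega>"
    proof (cases "\<omega> \<in> ?G")
      case True
      have "E \<le> exp (lam * a - 2 * lam\<^sup>2 * V N \<omega>)" using True by (simp add: E_def mult_left_mono)
      also have "\<dots> \<le> P N \<omega>" using on_G[OF \<omega>, of N] True by auto
      finally show ?thesis using True D(3)[OF \<omega>] lam by (simp add: add_increasing2)
    next
      case False
      then show ?thesis using lower[OF \<omega>, of N] by simp
    qed
  qed
  also have "\<dots> = 1 + lam * exp (lam * a) * expectation D"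
    using mean D(1) by simp
  finally have "exp (- (lam * a) + 2 * lam\<^sup>2 * q) * (E * prob ?G)
      \<le> exp (- (lam * a) + 2 * lam\<^sup>2 * q) * (1 + lam * exp (lam * a) * expectation D)"
    by (intro mult_left_mono) auto
  also have "exp (- (lam * a) + 2 * lam\<^sup>2 * q) * (E * prob ?G) = prob ?G"
    by (simp add: E_def mult.assoc[symmetric] flip: exp_add)
  finally show ?thesis .
qed

end

section \<open>Convergence in probability and the martingale central limit theorem\<close>

context prob_space
begin

lemma prob_tendsto_0_mono:
  assumes "(\<lambda>n. prob (A n)) \<longlonglongrightarrow> 0" "\<And>n. B n \<subseteq> A n" "\<And>n. A n \<in> events"
  shows "(\<lambda>n. prob (B n)) \<longlonglongrightarrow> 0"
proof (rule tendsto_sandwich[OF _ _ tendsto_const assms(1)])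
  show "\<forall>\<^sub>F n in sequentially. 0 \<le> prob (B n)" by simp
  show "\<forall>\<^sub>F n in sequentially. prob (B n) \<le> prob (A n)"
    using assms(2,3) by (intro always_eventually allI finite_measure_mono) auto
qed

lemma tendsto_in_prob_bounded_linear:
  assumes Y: "tendsto_in_prob M Y c" and L: "bounded_linear L"
    and [measurable]: "\<And>n. Y n \<in> borel_measurable M"
  shows "tendsto_in_prob M (\<lambda>n \<omega>. L (Y n \<omega>)) (L c)"
  unfolding tendsto_in_prob_def
proof (intro allI impI)
  fix e :: real assume e: "e > 0"
  interpret bounded_linear L by (rule L)
  obtain K where K: "K > 0" "\<And>x. norm (L x) \<le> norm x * K" using pos_bounded by blast
  have "(\<lambda>n. prob {\<omega> \<in> space M. dist (Y n \<omega>) c > e / K}) \<longlonglongrightarrow> 0"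
    using Y e K by (simp add: tendsto_in_prob_def)
  then show "(\<lambda>n. prob {\<omega> \<in> space M. dist (L (Y n \<omega>)) (L c) > e}) \<longlonglongrightarrow> 0"
  proof (rule prob_tendsto_0_mono)
    fix n
    have "e / K < dist (Y n \<omega>) c" if "e < dist (L (Y n \<omega>)) (L c)" for \<omega>
      using that K(1) K(2)[of "Y n \<omega> - c"] by (simp add: dist_norm diff pos_divide_less_eq)
    then show "{\<omega> \<in> space M. e < dist (L (Y n \<omega>)) (L c)} \<subseteq> {\<omega> \<in> space M. e / K < dist (Y n \<omega>) c}"
      by auto
  qed measurable
qed

lemma tendsto_in_prob_add:
  fixes Y Z :: "nat \<Rightarrow> 'a \<Rightarrow> 'b::{second_countable_topology, real_normed_vector}"
  assumes Y: "tendsto_in_prob M Y c" and Z: "tendsto_in_prob M Z d"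
    and [measurable]: "\<And>n. Y n \<in> borel_measurable M" "\<And>n. Z n \<in> borel_measurable M"
  shows "tendsto_in_prob M (\<lambda>n \<omega>. Y n \<omega> + Z n \<omega>) (c + d)"
  unfolding tendsto_in_prob_def
proof (intro allI impI)
  fix e :: real assume e: "e > 0"
  let ?A = "\<lambda>n. {\<omega> \<in> space M. dist (Y n \<omega>) c > e / 2}"
  let ?B = "\<lambda>n. {\<omega> \<in> space M. dist (Z n \<omega>) d > e / 2}"
  have "(\<lambda>n. prob (?A n) + prob (?B n)) \<longlonglongrightarrow> 0 + 0"
    using e by (intro tendsto_add Y[unfolded tendsto_in_prob_def, rule_format]
        Z[unfolded tendsto_in_prob_def, rule_format]) auto
  then have sum0: "(\<lambda>n. prob (?A n) + prob (?B n)) \<longlonglongrightarrow> 0" by simp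
  have "(\<lambda>n. prob (?A n \<union> ?B n)) \<longlonglongrightarrow> 0"
  proof (rule tendsto_sandwich[OF _ _ tendsto_const sum0])
    show "\<forall>\<^sub>F n in sequentially. prob (?A n \<union> ?B n) \<le> prob (?A n) + prob (?B n)"
      by (intro always_eventually allI measure_Un_le) measurable
  qed auto
  then show "(\<lambda>n. prob {\<omega> \<in> space M. dist (Y n \<omega> + Z n \<omega>) (c + d) > e}) \<longlonglongrightarrow> 0"
  proof (rule prob_tendsto_0_mono)
    fix n
    have "e / 2 < dist (Y n \<omega>) c \<or> e / 2 < dist (Z n \<omega>) d" if "e < dist (Y n \<omega> + Z n \<omega>) (c + d)" for \<omega>
      using that dist_triangle_add[of "Y n \<omega>" "Z n \<omega>" c d] by linarith
    then show "{\<omega> \<in> space M. e < dist (Y n \<omega> + Z n \<omega>) (c + d)} \<subseteq> ?A n \<union> ?B n" by auto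
  qed measurable
qed

lemma tendsto_in_prob_sum:
  fixes Y :: "'i \<Rightarrow> nat \<Rightarrow> 'a \<Rightarrow> 'b::{second_countable_topology, real_normed_vector}"
  assumes "finite I" "\<And>i. i \<in> I \<Longrightarrow> tendsto_in_prob M (Y i) (c i)"
    and "\<And>i n. i \<in> I \<Longrightarrow> Y i n \<in> borel_measurable M"
  shows "tendsto_in_prob M (\<lambda>n \<omega>. \<Sum>i\<in>I. Y i n \<omega>) (\<Sum>i\<in>I. c i)"
  using assms
proof (induction I rule: finite_induct)
  case empty
  then show ?case by (simp add: tendsto_in_prob_def)
next
  case (insert i I)
  then show ?case
    by (auto intro!: tendsto_in_prob_add borel_measurable_sum)
qed

end

text \<open>
  Quadratic variations enter only through the bilinear forms of the matrices; as bounded linear functions of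
  the matrix these inherit convergence in probability.
\<close>

lemma bounded_linear_matrix_form:
  fixes a b :: "real^'d"
  shows "bounded_linear (\<lambda>A::real^'d^'d. a \<bullet> (A *v b))"
  by (intro linear_conv_bounded_linear[THEN iffD1] linearI)
     (simp_all add: matrix_vector_mult_add_rdistrib inner_add_right scaleR_matrix_vector_assoc[symmetric])

lemma outer_product_form:
  fixes a b x :: "real^'d"
  shows "a \<bullet> ((\<chi> j k. x $ j * x $ k) *v b) = (a \<bullet> x) * (b \<bullet> x)"
  by (simp add: inner_vec_def matrix_vector_mult_def sum_product sum_distrib_left mult_ac)
     (subst sum.swap, simp add: mult_ac)

context discrete_filtration
begin

lemma martingale_differences_inner:
  fixes \<xi> :: "nat \<Rightarrow> 'a \<Rightarrow> real^'d" and a :: "nat \<Rightarrow> real^'d"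
  assumes adapted: "\<And>j. j \<ge> 1 \<Longrightarrow> \<xi> j \<in> borel_measurable (F j)"
    and integrable: "\<And>j. j \<ge> 1 \<Longrightarrow> integrable M (\<xi> j)"
    and centered: "\<And>j k. j \<ge> 1 \<Longrightarrow> AE \<omega> in M. real_cond_exp M (F (j - 1)) (\<lambda>\<omega>. \<xi> j \<omega> $ k) \<omega> = 0"
  shows "martingale_differences M F (\<lambda>j \<omega>. a j \<bullet> \<xi> j \<omega>)"
  unfolding martingale_differences_def
proof (intro conjI allI impI)
  fix j :: nat assume j: "1 \<le> j"
  show "(\<lambda>\<omega>. a j \<bullet> \<xi> j \<omega>) \<in> borel_measurable (F j)" using adapted[OF j] by measurable
  show "integrable M (\<lambda>\<omega>. a j \<bullet> \<xi> j \<omega>)" using integrable[OF j] by simp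
next
  fix j :: nat and g :: "'a \<Rightarrow> real" and B :: real
  assume j: "1 \<le> j" and g[measurable]: "g \<in> borel_measurable (F (j - 1))"
    and B: "\<forall>\<omega>\<in>space M. \<bar>g \<omega>\<bar> \<le> B"
  have [measurable]: "g \<in> borel_measurable M" by (rule measurable_F[OF g])
  have [measurable]: "\<xi> j \<in> borel_measurable M" using integrable[OF j] by auto
  have \<xi>_int: "integrable M (\<lambda>\<omega>. \<xi> j \<omega> $ k)" for k
    using integrable_bounded_linear[OF bounded_linear_vec_nth integrable[OF j]] .
  have int: "integrable M (\<lambda>\<omega>. g \<omega> * \<xi> j \<omega> $ k)" for k
  proof (rule Bochner_Integration.integrable_bound)
    show "integrable M (\<lambda>\<omega>. B * \<xi> j \<omega> $ k)" using \<xi>_int by simp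
    have [measurable]: "(\<lambda>\<omega>. \<xi> j \<omega> $ k) \<in> borel_measurable M" using \<xi>_int by simp
    show "(\<lambda>\<omega>. g \<omega> * \<xi> j \<omega> $ k) \<in> borel_measurable M"
      by measurable
    show "AE \<omega> in M. norm (g \<omega> * \<xi> j \<omega> $ k) \<le> norm (B * \<xi> j \<omega> $ k)"
      using B by (intro AE_I2) (auto simp: abs_mult intro!: mult_right_mono)
  qed
  interpret finite_measure_subalgebra M "F (j - 1)"
    by unfold_locales (rule subalgebra)
  have 0: "(\<integral>\<omega>. g \<omega> * \<xi> j \<omega> $ k \<partial>M) = 0" for k
  proof -
    have [measurable]: "(\<lambda>\<omega>. \<xi> j \<omega> $ k) \<in> borel_measurable M" using \<xi>_int by simp
    have "(\<integral>\<omega>. g \<omega> * \<xi> j \<omega> $ k \<partial>M)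
        = (\<integral>\<omega>. g \<omega> * real_cond_exp M (F (j - 1)) (\<lambda>\<omega>. \<xi> j \<omega> $ k) \<omega> \<partial>M)"
      by (rule real_cond_exp_intg(2)[symmetric, OF int g]) simp
    also have "\<dots> = (\<integral>\<omega>. 0 \<partial>M)"
      using centered[OF j, of k]
      by (intro integral_cong_AE) (auto intro: measurable_F[OF borel_measurable_cond_exp])
    finally show ?thesis by simp
  qed
  have "(\<integral>\<omega>. g \<omega> * (a j \<bullet> \<xi> j \<omega>) \<partial>M) = (\<integral>\<omega>. (\<Sum>k\<in>UNIV. a j $ k * (g \<omega> * \<xi> j \<omega> $ k)) \<partial>M)"
    by (simp add: inner_vec_def sum_distrib_left mult_ac)
  also have "\<dots> = (\<Sum>k\<in>UNIV. a j $ k * (\<integral>\<omega>. g \<omega> * \<xi> j \<omega> $ k \<partial>M))"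
    using int by (subst Bochner_Integration.integral_sum) auto
  finally show "(\<integral>\<omega>. g \<omega> * (a j \<bullet> \<xi> j \<omega>) \<partial>M) = 0" by (simp add: 0)
qed

text \<open>
  A function \<open>D n\<close> that dominates all increments of row \<open>n\<close> stands in for their maximum. In
  \<open>characteristic_function_bound\<close> the tolerance \<open>\<delta>\<close> is chosen first, to make the deterministic error small; then \<open>n\<close> makes the probabilistic
  errors small.
\<close>

lemma martingale_central_limit:
  fixes z :: "nat \<Rightarrow> nat \<Rightarrow> 'a \<Rightarrow> real" and D :: "nat \<Rightarrow> 'a \<Rightarrow> real"
  assumes mds: "\<And>n. martingale_differences M F (z n)"
    and D: "\<And>n. integrable M (D n)" "\<And>n \<omega> j. \<omega> \<in> space M \<Longrightarrow> j \<in> {1..N n} \<Longrightarrow> \<bar>z n j \<omega>\<bar> \<le> D n \<omega>"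
      "\<And>n \<omega>. \<omega> \<in> space M \<Longrightarrow> 0 \<le> D n \<omega>"
    and D0: "(\<lambda>n. expectation (D n)) \<longlonglongrightarrow> 0"
    and V: "tendsto_in_prob M (\<lambda>n \<omega>. \<Sum>j=1..N n. (z n j \<omega>)\<^sup>2) v" and v: "0 \<le> v"
  shows "(\<lambda>n. \<integral>\<omega>. iexp (\<Sum>j=1..N n. z n j \<omega>) \<partial>M) \<longlonglongrightarrow> of_real (exp (- (v / 2)))"
proof (rule tendstoI)
  fix e :: real assume e: "e > 0"
  define K where "K = exp ((v + 1) / 2)"
  define B where "B = 2 * (v + 1) + K"
  have B: "B > 0" using v by (simp add: B_def K_def add_nonneg_pos)
  define \<delta> where "\<delta> = min 1 (e / 2 / B)"
  have \<delta>: "0 < \<delta>" "\<delta> \<le> 1" using e B by (auto simp: \<delta>_def)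
  have \<delta>B: "\<delta> * B \<le> e / 2" using B by (simp add: \<delta>_def min_mult_distrib_right)
  define r where "r = (\<lambda>n. (1 + K) * (prob {\<omega> \<in> space M. \<bar>(\<Sum>j=1..N n. (z n j \<omega>)\<^sup>2) - v\<bar> > \<delta>}
       + expectation (D n) / \<delta>) + K * expectation (D n))"
  have "r \<longlonglongrightarrow> (1 + K) * (0 + 0 / \<delta>) + K * 0"
    unfolding r_def using V \<delta> D0
    by (intro tendsto_intros) (auto simp: tendsto_in_prob_def dist_real_def)
  then have "\<forall>\<^sub>F n in sequentially. r n < e / 2"
    using e by (intro order_tendstoD) auto
  then show "\<forall>\<^sub>F n in sequentially.
      dist (\<integral>\<omega>. iexp (\<Sum>j=1..N n. z n j \<omega>) \<partial>M) (of_real (exp (- (v / 2)))) < e"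
  proof eventually_elim
    case (elim n)
    have "cmod ((\<integral>\<omega>. iexp (\<Sum>j=1..N n. z n j \<omega>) \<partial>M) - of_real (exp (- (v / 2)))) \<le> \<delta> * B + r n"
      unfolding r_def B_def K_def add.assoc[symmetric]
      by (rule characteristic_function_bound[OF mds[of n] D(1)[of n] D(2)[of _ _ n] D(3)[of _ n] v \<delta>])
    then show ?case using elim \<delta>B by (simp add: dist_norm)
  qed
qed

end

section \<open>Linear interpolation of sequences\<close>

definition lin_interp :: "(nat \<Rightarrow> 'v::real_normed_vector) \<Rightarrow> real \<Rightarrow> 'v" where
  "lin_interp x u = x (nat \<lfloor>u\<rfloor>) + (u - real (nat \<lfloor>u\<rfloor>)) *\<^sub>R (x (Suc (nat \<lfloor>u\<rfloor>)) - x (nat \<lfloor>u\<rfloor>))"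

lemma scaled_walk_eq_lin_interp:
  "scaled_walk X n t \<omega> = lin_interp (\<lambda>k. (1 / sqrt (real n)) *\<^sub>R X k \<omega>) (real n * t)"
  by (simp add: scaled_walk_def lin_interp_def Let_def scaleR_diff_right)

lemma lin_interp_norm_le:
  assumes "0 \<le> u" "norm (x (nat \<lfloor>u\<rfloor>) - v) \<le> B" "norm (x (Suc (nat \<lfloor>u\<rfloor>)) - v) \<le> B"
  shows "norm (lin_interp x u - v) \<le> B"
proof -
  define s where "s = u - real (nat \<lfloor>u\<rfloor>)"
  have s: "0 \<le> s" "s \<le> 1" using assms(1) unfolding s_def by linarith+
  have "lin_interp x u - v = (1 - s) *\<^sub>R (x (nat \<lfloor>u\<rfloor>) - v) + s *\<^sub>R (x (Suc (nat \<lfloor>u\<rfloor>)) - v)"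
    by (simp add: lin_interp_def s_def[symmetric] algebra_simps)
  also have "norm \<dots> \<le> (1 - s) * B + s * B"
    using assms s by (intro order_trans[OF norm_triangle_ineq] add_mono) (auto intro!: mult_left_mono)
  finally show ?thesis by (simp add: algebra_simps)
qed

lemma lin_interp_diff: "lin_interp x u - lin_interp y u = lin_interp (\<lambda>k. x k - y k) u"
  by (simp add: lin_interp_def algebra_simps)

lemma lin_interp_piece:
  assumes "real k \<le> u" "u \<le> real (Suc k)"
  shows "lin_interp x u = x k + (u - real k) *\<^sub>R (x (Suc k) - x k)"
proof (cases "u = real (Suc k)")
  case True
  have "nat \<lfloor>u\<rfloor> = Suc k" unfolding True by (subst floor_of_nat) simp
  then show ?thesis using True by (simp add: lin_interp_def)
next
  case False
  then have "\<lfloor>u\<rfloor> = int k" using assms by (intro floor_unique) auto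
  then have "nat \<lfloor>u\<rfloor> = k" by simp
  then show ?thesis by (simp add: lin_interp_def)
qed

lemma continuous_on_lin_interp: "continuous_on {0..} (lin_interp x)"
proof -
  have initial: "continuous_on {0..real k} (lin_interp x)" for k
  proof (induction k)
    case 0
    show ?case by simp
  next
    case (Suc k)
    have "continuous_on {real k..real (Suc k)} (\<lambda>u. x k + (u - real k) *\<^sub>R (x (Suc k) - x k))"
      by (intro continuous_intros)
    then have "continuous_on {real k..real (Suc k)} (lin_interp x)"
      by (rule continuous_on_eq) (auto intro!: lin_interp_piece[symmetric])
    with Suc have "continuous_on ({0..real k} \<union> {real k..real (Suc k)}) (lin_interp x)"
      by (intro continuous_on_closed_Un) auto
    moreover have "{0..real k} \<union> {real k..real (Suc k)} = {0..real (Suc k)}" by auto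
    ultimately show ?case by simp
  qed
  show ?thesis
    unfolding continuous_on_eq_continuous_within
  proof
    fix u :: real assume u: "u \<in> {0..}"
    obtain k where k: "u < real k" using reals_Archimedean2 by blast
    have "continuous (at u within {0..real k}) (lin_interp x)"
      using initial[of k] u k by (simp add: continuous_on_eq_continuous_within)
    moreover have "at u within {0..real k} = at u within {0..}"
      by (rule at_within_nhd[of u "{..<real k}"]) (use k in auto)
    ultimately show "continuous (at u within {0..}) (lin_interp x)" by simp
  qed
qed


section \<open>Processes close to a martingale\<close>

text \<open>
  These assumptions are what the proof of the functional limit theorem uses of the walk: its sums \<open>X\<close>
  stay within an increasing error \<open>R\<close> of a martingale, and this error is negligible on the diffusive
  scale.
\<close>

locale near_martingale = discrete_filtration M F
  for M :: "'a measure" and F :: "nat \<Rightarrow> 'a measure" +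
  fixes \<xi> X :: "nat \<Rightarrow> 'a \<Rightarrow> real^'d" and R :: "nat \<Rightarrow> 'a \<Rightarrow> real" and C :: "real \<Rightarrow> real^'d^'d"
  assumes adapted: "\<And>j. j \<ge> 1 \<Longrightarrow> \<xi> j \<in> borel_measurable (F j)"
    and integrable_\<xi>: "\<And>j. j \<ge> 1 \<Longrightarrow> integrable M (\<xi> j)"
    and centered: "\<And>j k. j \<ge> 1 \<Longrightarrow> AE \<omega> in M. real_cond_exp M (F (j - 1)) (\<lambda>\<omega>. \<xi> j \<omega> $ k) \<omega> = 0"
    and max_increment: "(\<lambda>k. real k powr (- 1/2) * (\<integral>\<omega>. (MAX i\<in>{1..k}. norm (\<xi> i \<omega>)) \<partial>M)) \<longlonglongrightarrow> 0"
    and C_continuous: "continuous_on {0..} C"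
    and C_0: "C 0 = 0"
    and C_increasing: "\<And>s t \<alpha>. 0 \<le> s \<Longrightarrow> s < t \<Longrightarrow>
      (\<Sum>i\<in>UNIV. \<Sum>j\<in>UNIV. (C t $ i $ j - C s $ i $ j) * \<alpha> $ i * \<alpha> $ j) \<ge> 0"
    and quadratic_variation: "\<And>t. 0 \<le> t \<Longrightarrow> tendsto_in_prob M
           (\<lambda>n \<omega>. (1 / real n) *\<^sub>R
              (\<Sum>i=1..nat \<lfloor>real n * t\<rfloor>. (\<chi> j k. \<xi> i \<omega> $ j * \<xi> i \<omega> $ k) :: real^'d^'d))
           (C t)"
    and X_measurable[measurable]: "\<And>k. X k \<in> borel_measurable M"
    and R_integrable: "\<And>k. integrable M (R k)"
    and R_mono: "\<And>k m \<omega>. k \<le> m \<Longrightarrow> \<omega> \<in> space M \<Longrightarrow> R k \<omega> \<le> R m \<omega>"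
    and X_near: "\<And>k \<omega>. \<omega> \<in> space M \<Longrightarrow> norm (X k \<omega> - (\<Sum>i=1..k. \<xi> i \<omega>)) \<le> R k \<omega>"
    and R_small: "(\<lambda>k. expectation (R k) / sqrt (real k)) \<longlonglongrightarrow> 0"
begin

definition S :: "nat \<Rightarrow> 'a \<Rightarrow> real^'d" where "S k \<omega> = (\<Sum>i=1..k. \<xi> i \<omega>)"

definition max_norm :: "nat \<Rightarrow> 'a \<Rightarrow> real" where "max_norm k \<omega> = (MAX i\<in>{1..k}. norm (\<xi> i \<omega>))"

text \<open>
  One random variable bounds, up to time \<open>T\<close> and on the diffusive scale, the distance to the martingale,
  each of its increments and the interpolation error. The index \<open>Suc n * T + 1\<close> covers the right end point
  of the interpolation interval of \<open>T\<close>.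
\<close>

definition error :: "nat \<Rightarrow> nat \<Rightarrow> 'a \<Rightarrow> real" where
  "error T n \<omega> = (R (Suc n * T + 1) \<omega> + max_norm (Suc n * T + 1) \<omega>) / sqrt (real (Suc n))"

definition qv :: "real \<Rightarrow> nat \<Rightarrow> 'a \<Rightarrow> real^'d^'d" where
  "qv t n \<omega> = (1 / real (Suc n)) *\<^sub>R
     (\<Sum>i=1..nat \<lfloor>real (Suc n) * t\<rfloor>. (\<chi> j k. \<xi> i \<omega> $ j * \<xi> i \<omega> $ k))"

lemma \<xi>_measurable[measurable]: "j \<ge> 1 \<Longrightarrow> \<xi> j \<in> borel_measurable M"
  using integrable_\<xi> by auto

lemma S_measurable[measurable]: "S k \<in> borel_measurable M"
  unfolding S_def by (intro borel_measurable_sum) auto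

lemma norm_\<xi>_le_max: "i \<in> {1..k} \<Longrightarrow> norm (\<xi> i \<omega>) \<le> max_norm k \<omega>"
  unfolding max_norm_def by (intro Max_ge) auto

lemma max_norm_nonneg: "k \<ge> 1 \<Longrightarrow> 0 \<le> max_norm k \<omega>"
  using norm_\<xi>_le_max[of 1 k \<omega>] norm_ge_zero[of "\<xi> 1 \<omega>"] by (simp del: norm_ge_zero)

lemma R_nonneg: "\<omega> \<in> space M \<Longrightarrow> 0 \<le> R k \<omega>"
  using X_near[of \<omega> k] norm_ge_zero order_trans by blast

lemma integrable_max_norm: "k \<ge> 1 \<Longrightarrow> integrable M (max_norm k)"
proof (rule Bochner_Integration.integrable_bound)
  assume k: "k \<ge> 1"
  show "integrable M (\<lambda>\<omega>. \<Sum>i=1..k. norm (\<xi> i \<omega>))"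
    using integrable_\<xi> by (intro Bochner_Integration.integrable_sum integrable_norm) auto
  show "max_norm k \<in> borel_measurable M"
    unfolding max_norm_def by (intro borel_measurable_Max) auto
  have "max_norm k \<omega> \<le> (\<Sum>i=1..k. norm (\<xi> i \<omega>))" for \<omega>
    unfolding max_norm_def using k by (auto intro!: Max.boundedI member_le_sum)
  then show "AE \<omega> in M. norm (max_norm k \<omega>) \<le> norm (\<Sum>i=1..k. norm (\<xi> i \<omega>))"
    using max_norm_nonneg[OF k] by (auto simp: abs_of_nonneg sum_nonneg)
qed

text \<open>
  The index \<open>Suc n * T + 1\<close> is at most \<open>(T + 1) * Suc n\<close>, so the two square roots have a bounded ratio.
\<close>

lemma diffusive_rescaling:
  fixes g :: "nat \<Rightarrow> real"
  assumes "(\<lambda>k. g k / sqrt (real k)) \<longlonglongrightarrow> 0"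
  shows "(\<lambda>n. g (Suc n * T + 1) / sqrt (real (Suc n))) \<longlonglongrightarrow> 0"
proof (cases "T = 0")
  case True
  have "(\<lambda>n. g 1 * (1 / sqrt (real (Suc n)))) \<longlonglongrightarrow> g 1 * 0"
    by (intro tendsto_intros) real_asymp
  then show ?thesis using True by simp
next
  case False
  have fl: "filterlim (\<lambda>n. Suc n * T + 1) at_top sequentially"
    by (rule filterlim_subseq) (use False in \<open>auto simp: strict_mono_def\<close>)
  have "(\<lambda>n. g (Suc n * T + 1) / sqrt (real (Suc n * T + 1)) * sqrt (real (T + 1))) \<longlonglongrightarrow> 0 * sqrt (real (T + 1))"
    using filterlim_compose[OF assms fl] by (intro tendsto_intros) auto
  then have "(\<lambda>n. g (Suc n * T + 1) / sqrt (real (Suc n * T + 1)) * sqrt (real (T + 1))) \<longlonglongrightarrow> 0" by simp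
  then show ?thesis
  proof (rule Lim_null_comparison[rotated, OF tendsto_rabs_zero], intro always_eventually allI)
    fix n
    let ?k = "real (Suc n * T + 1)"
    have k: "?k > 0" by (simp only: of_nat_0_less_iff)
    have "?k \<le> real (Suc n) * real (T + 1)" by (simp add: algebra_simps)
    note k = k this
    have "sqrt ?k \<le> sqrt (real (Suc n)) * sqrt (real (T + 1))"
      unfolding real_sqrt_mult[symmetric] using k by (intro real_sqrt_le_mono) auto
    then have "1 / sqrt (real (Suc n)) \<le> sqrt (real (T + 1)) / sqrt ?k"
      using k by (simp add: field_simps)
    then have "\<bar>g (Suc n * T + 1)\<bar> * (1 / sqrt (real (Suc n))) \<le> \<bar>g (Suc n * T + 1)\<bar> * (sqrt (real (T + 1)) / sqrt ?k)"
      by (intro mult_left_mono) auto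
    then show "norm (g (Suc n * T + 1) / sqrt (real (Suc n)))
        \<le> \<bar>g (Suc n * T + 1) / sqrt ?k * sqrt (real (T + 1))\<bar>"
      by (simp add: abs_mult)
  qed
qed

lemma error_integrable: "integrable M (error T n)"
  unfolding error_def using R_integrable integrable_max_norm by auto

lemma error_nonneg: "\<omega> \<in> space M \<Longrightarrow> 0 \<le> error T n \<omega>"
  unfolding error_def using R_nonneg max_norm_nonneg by (auto intro!: divide_nonneg_nonneg add_nonneg_nonneg)

lemma error_tendsto_0: "(\<lambda>n. expectation (error T n)) \<longlonglongrightarrow> 0"
proof -
  have max: "(\<lambda>k. expectation (max_norm k) / sqrt (real k)) \<longlonglongrightarrow> 0"
    using max_increment by (simp add: max_norm_def[abs_def] powr_minus_divide powr_half_sqrt)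
  have "(\<lambda>n. expectation (R (Suc n * T + 1)) / sqrt (real (Suc n))
      + expectation (max_norm (Suc n * T + 1)) / sqrt (real (Suc n))) \<longlonglongrightarrow> 0 + 0"
    by (intro tendsto_add diffusive_rescaling R_small max)
  moreover have "expectation (error T n) = expectation (R (Suc n * T + 1)) / sqrt (real (Suc n))
      + expectation (max_norm (Suc n * T + 1)) / sqrt (real (Suc n))" for n
    unfolding error_def using R_integrable integrable_max_norm
    by (simp add: add_divide_distrib)
  ultimately show ?thesis by simp
qed

lemma \<xi>_le_error:
  assumes "\<omega> \<in> space M" "i \<in> {1..Suc n * T + 1}"
  shows "norm (\<xi> i \<omega>) / sqrt (real (Suc n)) \<le> error T n \<omega>"
  unfolding error_def using norm_\<xi>_le_max[OF assms(2)] R_nonneg[OF assms(1)]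
  by (intro divide_right_mono) (auto intro: add_increasing)

lemma R_le_error:
  assumes "\<omega> \<in> space M" "k \<le> Suc n * T + 1"
  shows "R k \<omega> / sqrt (real (Suc n)) \<le> error T n \<omega>"
  unfolding error_def using R_mono[OF assms(2,1)] max_norm_nonneg
  by (intro divide_right_mono) (auto intro: add_increasing2)

lemma qv_tendsto: "0 \<le> t \<Longrightarrow> tendsto_in_prob M (qv t) (C t)"
  unfolding tendsto_in_prob_def qv_def
  by (intro allI impI LIMSEQ_Suc quadratic_variation[of t, unfolded tendsto_in_prob_def, rule_format])

lemma qv_measurable[measurable]: "qv t n \<in> borel_measurable M"
proof -
  have "(\<lambda>\<omega>. (\<chi> j k. \<xi> i \<omega> $ j * \<xi> i \<omega> $ k) :: real^'d^'d) \<in> borel_measurable M" if "i \<ge> 1" for i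
  proof (rule measurable_compose[OF \<xi>_measurable[OF that]])
    show "(\<lambda>x. (\<chi> j k. x $ j * x $ k) :: real^'d^'d) \<in> borel_measurable borel"
      by (intro borel_measurable_continuous_onI continuous_intros)
  qed
  then show ?thesis unfolding qv_def by (intro borel_measurable_scaleR borel_measurable_sum) auto
qed

lemma floor_le_N:
  assumes "t \<le> real T"
  shows "nat \<lfloor>real (Suc n) * t\<rfloor> \<le> Suc n * T"
proof -
  have "real (Suc n) * t \<le> real (Suc n) * real T" using assms by (intro mult_left_mono) auto
  then have "real (Suc n) * t \<le> real (Suc n * T)" by (simp only: of_nat_mult)
  then have "\<lfloor>real (Suc n) * t\<rfloor> \<le> int (Suc n * T)" by linarith
  then show ?thesis by linarith
qed

text \<open>
  The interpolated walk lies between two consecutive points, and both are within \<open>error\<close> of the martingale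
  at the left one.
\<close>

lemma scaled_walk_near_S:
  assumes \<omega>: "\<omega> \<in> space M" and t: "0 \<le> t" "t \<le> real T"
  shows "norm (scaled_walk X (Suc n) t \<omega> - (1 / sqrt (real (Suc n))) *\<^sub>R S (nat \<lfloor>real (Suc n) * t\<rfloor>) \<omega>)
    \<le> error T n \<omega>"
  unfolding scaled_walk_eq_lin_interp
proof (rule lin_interp_norm_le)
  let ?m = "nat \<lfloor>real (Suc n) * t\<rfloor>"
  let ?r = "sqrt (real (Suc n))"
  have m: "?m \<le> Suc n * T" by (rule floor_le_N[OF t(2)])
  show "0 \<le> real (Suc n) * t" using t by simp
  have "norm (X ?m \<omega> - S ?m \<omega>) / ?r \<le> R ?m \<omega> / ?r"
    using X_near[OF \<omega>] by (intro divide_right_mono) (auto simp: S_def)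
  also have "\<dots> \<le> error T n \<omega>" using m by (intro R_le_error \<omega>) simp
  finally show "norm ((1 / ?r) *\<^sub>R X ?m \<omega> - (1 / ?r) *\<^sub>R S ?m \<omega>) \<le> error T n \<omega>"
    by (simp flip: scaleR_diff_right)
  have "norm (X (Suc ?m) \<omega> - S ?m \<omega>) \<le> norm (X (Suc ?m) \<omega> - S (Suc ?m) \<omega>) + norm (\<xi> (Suc ?m) \<omega>)"
    by (rule order_trans[OF _ norm_triangle_ineq]) (simp add: S_def)
  also have "\<dots> \<le> R (Suc n * T + 1) \<omega> + max_norm (Suc n * T + 1) \<omega>"
    using m X_near[OF \<omega>, of "Suc ?m"] R_mono[OF _ \<omega>, of "Suc ?m" "Suc n * T + 1"]
      norm_\<xi>_le_max[of "Suc ?m" "Suc n * T + 1" \<omega>]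
    unfolding S_def by (intro add_mono) auto
  finally have "norm (X (Suc ?m) \<omega> - S ?m \<omega>) / ?r \<le> error T n \<omega>"
    unfolding error_def by (intro divide_right_mono) auto
  then show "norm ((1 / ?r) *\<^sub>R X (Suc ?m) \<omega> - (1 / ?r) *\<^sub>R S ?m \<omega>) \<le> error T n \<omega>"
    by (simp flip: scaleR_diff_right)
qed

end

lemma iexp_lipschitz: "cmod (iexp a - iexp b) \<le> \<bar>a - b\<bar>"
proof -
  have "iexp a - iexp b = iexp b * (iexp (a - b) - 1)"
    by (simp add: algebra_simps flip: exp_add)
  then show ?thesis using iexp_approx1[of "a - b" 0] by (simp add: norm_mult)
qed

lemma sum_if_le:
  fixes f :: "nat \<Rightarrow> 'b::comm_monoid_add"
  assumes "m \<le> N"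
  shows "(\<Sum>l=1..N. if l \<le> m then f l else 0) = (\<Sum>l=1..m. f l)"
  using assms by (intro sum.mono_neutral_cong_right) auto

lemma sum_if_between:
  fixes f :: "nat \<Rightarrow> 'b::ab_group_add"
  assumes "a \<le> m" "m \<le> b"
  shows "(\<Sum>l=1..m. if a < l \<and> l \<le> b then f l else 0) = (\<Sum>l=1..m. f l) - (\<Sum>l=1..a. f l)"
proof -
  have "(\<Sum>l=1..m. f l) - (\<Sum>l=1..a. f l) = sum f ({1..m} - {1..a})"
    using assms by (intro sum_diff[symmetric]) auto
  also have "\<dots> = (\<Sum>l=1..m. if a < l \<and> l \<le> b then f l else 0)"
    using assms by (intro sum.mono_neutral_cong_left) auto
  finally show ?thesis by simp
qed

lemma (in prob_space) tendsto_in_prob_nonneg: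
  fixes Y :: "nat \<Rightarrow> 'a \<Rightarrow> real"
  assumes Y: "tendsto_in_prob M Y c" and pos: "\<And>n \<omega>. 0 \<le> Y n \<omega>"
  shows "0 \<le> c"
proof (rule ccontr)
  assume "\<not> 0 \<le> c"
  then have c: "- c / 2 > 0" by simp
  then have "(\<lambda>n. prob {\<omega> \<in> space M. dist (Y n \<omega>) c > - c / 2}) \<longlonglongrightarrow> 0"
    using Y unfolding tendsto_in_prob_def by blast
  moreover have "{\<omega> \<in> space M. dist (Y n \<omega>) c > - c / 2} = space M" for n
  proof -
    have "dist (Y n \<omega>) c > - c / 2" for \<omega>
      unfolding dist_real_def using pos[of n \<omega>] c by linarith
    then show ?thesis by auto
  qed
  ultimately show False by (simp add: prob_space LIMSEQ_const_iff)
qed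

lemma norm_integral_le:
  fixes f :: "'a \<Rightarrow> 'b::{banach, second_countable_topology}"
  assumes "integrable M f" "integrable M g" "\<And>\<omega>. \<omega> \<in> space M \<Longrightarrow> norm (f \<omega>) \<le> g \<omega>"
  shows "norm (\<integral>\<omega>. f \<omega> \<partial>M) \<le> (\<integral>\<omega>. g \<omega> \<partial>M)"
  using assms by (intro order_trans[OF integral_norm_bound] integral_mono) auto

lemma matrix_form_axis: "axis j 1 \<bullet> ((A::real^'d^'d) *v axis k 1) = A $ j $ k"
  by (simp add: matrix_vector_mult_basis inner_axis' column_def)

text \<open>
  The variance of \<open>\<Sum>k<K. c k \<bullet> W (t k)\<close> for a centered process \<open>W\<close> with independent increments
  and covariance matrix \<open>C t\<close> at time \<open>t\<close>.
\<close>

definition covariance_form ::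
    "(real \<Rightarrow> real^'d^'d) \<Rightarrow> (nat \<Rightarrow> real^'d) \<Rightarrow> (nat \<Rightarrow> real) \<Rightarrow> nat \<Rightarrow> real" where
  "covariance_form C c t K = (\<Sum>k<K. \<Sum>k'<K. c k \<bullet> (C (min (t k) (t k')) *v c k'))"

context near_martingale
begin

lemma qv_form:
  "a \<bullet> (qv t n \<omega> *v b)
    = (1 / real (Suc n)) * (\<Sum>l=1..nat \<lfloor>real (Suc n) * t\<rfloor>. (a \<bullet> \<xi> l \<omega>) * (b \<bullet> \<xi> l \<omega>))"
proof -
  interpret bounded_linear "\<lambda>A::real^'d^'d. a \<bullet> (A *v b)" by (rule bounded_linear_matrix_form)
  show ?thesis unfolding qv_def by (simp add: scaleR sum outer_product_form)
qed

lemma qv_form_measurable[measurable]: "(\<lambda>\<omega>. a \<bullet> (qv t n \<omega> *v b)) \<in> borel_measurable M"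
  unfolding qv_form by (intro borel_measurable_times borel_measurable_sum) auto

lemma qv_form_tendsto:
  "0 \<le> t \<Longrightarrow> tendsto_in_prob M (\<lambda>n \<omega>. a \<bullet> (qv t n \<omega> *v b)) (a \<bullet> (C t *v b))"
  by (rule tendsto_in_prob_bounded_linear[OF qv_tendsto bounded_linear_matrix_form]) auto

text \<open>
  The weight of the increment \<open>l\<close> in a linear combination of values of the rescaled martingale: it counts for
  all sampling times that are not earlier than \<open>l\<close>.
\<close>

definition sampling_weight :: "(nat \<Rightarrow> real^'d) \<Rightarrow> (nat \<Rightarrow> real) \<Rightarrow> nat \<Rightarrow> nat \<Rightarrow> nat \<Rightarrow> real^'d" where
  "sampling_weight c t K n l = (1 / sqrt (real (Suc n))) *\<^sub>R
     (\<Sum>k<K. if l \<le> nat \<lfloor>real (Suc n) * t k\<rfloor> then c k else 0)"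

text \<open>
  A linear combination of values of the martingale at several times is itself a martingale sum with
  deterministic weights, so one-dimensional convergence yields all joint laws.
\<close>

lemma sampled_martingale_sum:
  assumes t: "\<And>k. k < K \<Longrightarrow> t k \<le> real T"
  shows "(\<Sum>l=1..Suc n * T + 1. sampling_weight c t K n l \<bullet> \<xi> l \<omega>)
    = (\<Sum>k<K. c k \<bullet> ((1 / sqrt (real (Suc n))) *\<^sub>R S (nat \<lfloor>real (Suc n) * t k\<rfloor>) \<omega>))"
proof -
  have "(\<Sum>l=1..Suc n * T + 1. sampling_weight c t K n l \<bullet> \<xi> l \<omega>)
      = (1 / sqrt (real (Suc n))) * (\<Sum>l=1..Suc n * T + 1. \<Sum>k<K.
          if l \<le> nat \<lfloor>real (Suc n) * t k\<rfloor> then c k \<bullet> \<xi> l \<omega> else 0)"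
    unfolding sampling_weight_def inner_scaleR_left inner_sum_left sum_distrib_left
    by (intro sum.cong refl) simp
  also have "(\<Sum>l=1..Suc n * T + 1. \<Sum>k<K.
          if l \<le> nat \<lfloor>real (Suc n) * t k\<rfloor> then c k \<bullet> \<xi> l \<omega> else 0)
      = (\<Sum>k<K. \<Sum>l=1..nat \<lfloor>real (Suc n) * t k\<rfloor>. c k \<bullet> \<xi> l \<omega>)"
  proof (subst sum.swap, rule sum.cong[OF refl])
    fix k assume "k \<in> {..<K}"
    then have "nat \<lfloor>real (Suc n) * t k\<rfloor> \<le> Suc n * T + 1"
      using floor_le_N[OF t[of k], of n] by simp
    then show "(\<Sum>l=1..Suc n * T + 1. if l \<le> nat \<lfloor>real (Suc n) * t k\<rfloor> then c k \<bullet> \<xi> l \<omega> else 0)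
        = (\<Sum>l=1..nat \<lfloor>real (Suc n) * t k\<rfloor>. c k \<bullet> \<xi> l \<omega>)"
      by (rule sum_if_le)
  qed
  finally show ?thesis by (simp add: S_def inner_sum_right sum_distrib_left)
qed

lemma sampled_quadratic_variation:
  assumes t: "\<And>k. k < K \<Longrightarrow> t k \<le> real T"
  shows "(\<Sum>l=1..Suc n * T + 1. (sampling_weight c t K n l \<bullet> \<xi> l \<omega>)\<^sup>2)
    = (\<Sum>k<K. \<Sum>k'<K. c k \<bullet> (qv (min (t k) (t k')) n \<omega> *v c k'))"
proof -
  let ?m = "\<lambda>k. nat \<lfloor>real (Suc n) * t k\<rfloor>"
  have sq: "(sampling_weight c t K n l \<bullet> \<xi> l \<omega>)\<^sup>2 = (1 / real (Suc n)) * (\<Sum>k<K. \<Sum>k'<K.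
      if l \<le> min (?m k) (?m k') then (c k \<bullet> \<xi> l \<omega>) * (c k' \<bullet> \<xi> l \<omega>) else 0)" for l
  proof -
    have "(sampling_weight c t K n l \<bullet> \<xi> l \<omega>)\<^sup>2
        = (1 / real (Suc n)) * (\<Sum>k<K. if l \<le> ?m k then c k \<bullet> \<xi> l \<omega> else 0)\<^sup>2"
      by (simp add: sampling_weight_def inner_sum_left power_mult_distrib power_divide
          if_distrib[of "\<lambda>v. v \<bullet> _"] cong: if_cong)
    also have "(\<Sum>k<K. if l \<le> ?m k then c k \<bullet> \<xi> l \<omega> else 0)\<^sup>2 = (\<Sum>k<K. \<Sum>k'<K.
        if l \<le> min (?m k) (?m k') then (c k \<bullet> \<xi> l \<omega>) * (c k' \<bullet> \<xi> l \<omega>) else 0)"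
      unfolding power2_eq_square sum_product by (intro sum.cong refl) auto
    finally show ?thesis .
  qed
  have "(\<Sum>l=1..Suc n * T + 1. (sampling_weight c t K n l \<bullet> \<xi> l \<omega>)\<^sup>2)
      = (\<Sum>k<K. \<Sum>k'<K. (1 / real (Suc n)) * (\<Sum>l=1..Suc n * T + 1.
          if l \<le> min (?m k) (?m k') then (c k \<bullet> \<xi> l \<omega>) * (c k' \<bullet> \<xi> l \<omega>) else 0))"
    unfolding sq sum_distrib_left
    by (subst sum.swap, rule sum.cong[OF refl], rule sum.swap)
  also have "\<dots> = (\<Sum>k<K. \<Sum>k'<K. c k \<bullet> (qv (min (t k) (t k')) n \<omega> *v c k'))"
  proof (intro sum.cong refl)
    fix k k' assume k: "k \<in> {..<K}" "k' \<in> {..<K}"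
    have "nat \<lfloor>real (Suc n) * min (t k) (t k')\<rfloor> = min (?m k) (?m k')"
    proof (cases "t k \<le> t k'")
      case True
      then have "?m k \<le> ?m k'" by (intro nat_mono floor_mono mult_left_mono) auto
      then show ?thesis using True by (simp add: min_def)
    next
      case False
      then have "?m k' \<le> ?m k" by (intro nat_mono floor_mono mult_left_mono) auto
      then show ?thesis using False by (simp add: min_def)
    qed
    moreover have "min (?m k) (?m k') \<le> Suc n * T + 1"
      using floor_le_N[OF t[of k], of n] k by (simp add: min_le_iff_disj)
    ultimately show "(1 / real (Suc n)) * (\<Sum>l=1..Suc n * T + 1.
          if l \<le> min (?m k) (?m k') then (c k \<bullet> \<xi> l \<omega>) * (c k' \<bullet> \<xi> l \<omega>) else 0)
        = c k \<bullet> (qv (min (t k) (t k')) n \<omega> *v c k')"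
      unfolding qv_form by (subst sum_if_le) auto
  qed
  finally show ?thesis .
qed

lemma sampled_quadratic_variation_tendsto:
  assumes "\<And>k. k < K \<Longrightarrow> 0 \<le> t k"
  shows "tendsto_in_prob M (\<lambda>n \<omega>. \<Sum>k<K. \<Sum>k'<K. c k \<bullet> (qv (min (t k) (t k')) n \<omega> *v c k'))
    (covariance_form C c t K)"
  unfolding covariance_form_def using assms
  by (intro tendsto_in_prob_sum qv_form_tendsto borel_measurable_sum) auto

lemma upper_time:
  fixes t :: "nat \<Rightarrow> real"
  obtains T :: nat where "\<And>k. k < K \<Longrightarrow> t k \<le> real T"
proof -
  obtain T where T: "(\<Sum>k<K. \<bar>t k\<bar>) \<le> real T" using real_arch_simple by blast
  show ?thesis
  proof (rule that)
    fix k assume "k < K"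
    then have "\<bar>t k\<bar> \<le> (\<Sum>k<K. \<bar>t k\<bar>)" by (intro member_le_sum) auto
    then show "t k \<le> real T" using T by linarith
  qed
qed

text \<open>
  The form is a limit of sums of squares, hence nonnegative; this is what makes a Gaussian limit with
  this covariance exist.
\<close>

lemma covariance_form_nonneg:
  assumes t: "\<And>k. k < K \<Longrightarrow> 0 \<le> t k"
  shows "0 \<le> covariance_form C c t K"
proof -
  obtain T where T: "\<And>k. k < K \<Longrightarrow> t k \<le> real T" using upper_time[of K t] by blast
  show ?thesis
  proof (rule tendsto_in_prob_nonneg[OF sampled_quadratic_variation_tendsto[where t = t and K = K, OF t]])
    show "0 \<le> (\<Sum>k<K. \<Sum>k'<K. c k \<bullet> (qv (min (t k) (t k')) n \<omega> *v c k'))" for n \<omega>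
    proof -
      have "0 \<le> (\<Sum>l=1..Suc n * T + 1. (sampling_weight c t K n l \<bullet> \<xi> l \<omega>)\<^sup>2)"
        by (intro sum_nonneg zero_le_power2)
      also have "\<dots> = (\<Sum>k<K. \<Sum>k'<K. c k \<bullet> (qv (min (t k) (t k')) n \<omega> *v c k'))"
        by (rule sampled_quadratic_variation) (rule T)
      finally show ?thesis .
    qed
  qed
qed

lemma scaled_walk_measurable[measurable]: "scaled_walk X n t \<in> borel_measurable M"
  unfolding scaled_walk_def[abs_def] Let_def by measurable

proposition finite_dimensional_limit:
  assumes t: "\<And>k. k < K \<Longrightarrow> 0 \<le> t k"
  shows "(\<lambda>n. \<integral>\<omega>. iexp (\<Sum>k<K. c k \<bullet> scaled_walk X (Suc n) (t k) \<omega>) \<partial>M)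
    \<longlonglongrightarrow> of_real (exp (- (covariance_form C c t K / 2)))"
proof -
  obtain T where T: "\<And>k. k < K \<Longrightarrow> t k \<le> real T" using upper_time[of K t] by blast
  define b where "b = (\<Sum>k<K. norm (c k))"
  have b: "0 \<le> b" by (auto simp: b_def intro: sum_nonneg)
  define z where "z = (\<lambda>n l \<omega>. sampling_weight c t K n l \<bullet> \<xi> l \<omega>)"
  have "(\<lambda>n. \<integral>\<omega>. iexp (\<Sum>l=1..Suc n * T + 1. z n l \<omega>) \<partial>M)
    \<longlonglongrightarrow> of_real (exp (- (covariance_form C c t K / 2)))"
  proof (rule martingale_central_limit[where D = "\<lambda>n \<omega>. b * error T n \<omega>"])
    fix n
    show "martingale_differences M F (z n)"
      unfolding z_def by (rule martingale_differences_inner[OF adapted integrable_\<xi> centered])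
    show "integrable M (\<lambda>\<omega>. b * error T n \<omega>)" using error_integrable by simp
    fix \<omega> assume \<omega>: "\<omega> \<in> space M"
    show "0 \<le> b * error T n \<omega>" using b error_nonneg[OF \<omega>] by simp
    fix l assume l: "l \<in> {1..Suc n * T + 1}"
    have "norm (\<Sum>k<K. if l \<le> nat \<lfloor>real (Suc n) * t k\<rfloor> then c k else 0) \<le> b"
      unfolding b_def by (intro order_trans[OF norm_sum] sum_mono) auto
    then have "\<bar>z n l \<omega>\<bar> \<le> 1 / sqrt (real (Suc n)) * b * norm (\<xi> l \<omega>)"
      unfolding z_def sampling_weight_def
      by (intro order_trans[OF Cauchy_Schwarz_ineq2] mult_right_mono) (auto intro!: divide_right_mono)
    also have "\<dots> = b * (norm (\<xi> l \<omega>) / sqrt (real (Suc n)))" by simp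
    also have "\<dots> \<le> b * error T n \<omega>"
      using \<xi>_le_error[OF \<omega> l] b by (rule mult_left_mono)
    finally show "\<bar>z n l \<omega>\<bar> \<le> b * error T n \<omega>" .
  next
    show "(\<lambda>n. expectation (\<lambda>\<omega>. b * error T n \<omega>)) \<longlonglongrightarrow> 0"
      using tendsto_mult_right_zero[OF error_tendsto_0, of b T] by simp
    show "tendsto_in_prob M (\<lambda>n \<omega>. \<Sum>l=1..Suc n * T + 1. (z n l \<omega>)\<^sup>2) (covariance_form C c t K)"
      unfolding z_def
      by (subst sampled_quadratic_variation[of K t T]) (auto intro: T t sampled_quadratic_variation_tendsto)
  qed (rule covariance_form_nonneg[where t = t and K = K, OF t])
  moreover have "(\<lambda>n. (\<integral>\<omega>. iexp (\<Sum>k<K. c k \<bullet> scaled_walk X (Suc n) (t k) \<omega>) \<partial>M)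
      - (\<integral>\<omega>. iexp (\<Sum>l=1..Suc n * T + 1. z n l \<omega>) \<partial>M)) \<longlonglongrightarrow> 0"
  proof (rule Lim_null_comparison)
    show "(\<lambda>n. b * expectation (error T n)) \<longlonglongrightarrow> 0"
      by (rule tendsto_mult_right_zero[OF error_tendsto_0])
    show "\<forall>\<^sub>F n in sequentially. cmod ((\<integral>\<omega>. iexp (\<Sum>k<K. c k \<bullet> scaled_walk X (Suc n) (t k) \<omega>) \<partial>M)
      - (\<integral>\<omega>. iexp (\<Sum>l=1..Suc n * T + 1. z n l \<omega>) \<partial>M)) \<le> b * expectation (error T n)"
    proof (intro always_eventually allI)
      fix n
      let ?A = "\<lambda>\<omega>. \<Sum>k<K. c k \<bullet> scaled_walk X (Suc n) (t k) \<omega>"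
      let ?B = "\<lambda>\<omega>. \<Sum>l=1..Suc n * T + 1. z n l \<omega>"
      have [measurable]: "?B \<in> borel_measurable M"
        unfolding z_def by (intro borel_measurable_sum borel_measurable_inner) auto
      have [measurable]: "?A \<in> borel_measurable M" by measurable
      have int: "integrable M (\<lambda>\<omega>. iexp (?A \<omega>))" "integrable M (\<lambda>\<omega>. iexp (?B \<omega>))"
        by (rule integrable_iexp; measurable; simp only: Im_complex_of_real)+
      have "(\<integral>\<omega>. iexp (?A \<omega>) \<partial>M) - (\<integral>\<omega>. iexp (?B \<omega>) \<partial>M) = (\<integral>\<omega>. iexp (?A \<omega>) - iexp (?B \<omega>) \<partial>M)"
        using int by simp
      also have "cmod \<dots> \<le> (\<integral>\<omega>. b * error T n \<omega> \<partial>M)"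
      proof (rule norm_integral_le)
        fix \<omega> assume \<omega>: "\<omega> \<in> space M"
        have "cmod (iexp (?A \<omega>) - iexp (?B \<omega>)) \<le> \<bar>?A \<omega> - ?B \<omega>\<bar>" by (rule iexp_lipschitz)
        also have "?A \<omega> - ?B \<omega> = (\<Sum>k<K. c k \<bullet> (scaled_walk X (Suc n) (t k) \<omega>
            - (1 / sqrt (real (Suc n))) *\<^sub>R S (nat \<lfloor>real (Suc n) * t k\<rfloor>) \<omega>))"
          unfolding z_def
          by (subst sampled_martingale_sum[of K t T]) (auto intro: T simp: inner_diff_right sum_subtractf)
        also have "\<bar>\<dots>\<bar> \<le> (\<Sum>k<K. norm (c k) * error T n \<omega>)"
          using scaled_walk_near_S[OF \<omega> t T]
          by (intro order_trans[OF sum_abs] sum_mono order_trans[OF Cauchy_Schwarz_ineq2] mult_left_mono) auto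
        finally show "cmod (iexp (?A \<omega>) - iexp (?B \<omega>)) \<le> b * error T n \<omega>"
          by (simp add: b_def sum_distrib_right)
      qed (use int error_integrable in \<open>simp_all only: Bochner_Integration.integrable_diff integrable_mult_right\<close>)
      finally show "cmod ((\<integral>\<omega>. iexp (?A \<omega>) \<partial>M) - (\<integral>\<omega>. iexp (?B \<omega>) \<partial>M)) \<le> b * expectation (error T n)"
        by simp
    qed
  qed
  ultimately show ?thesis by (rule Lim_transform)
qed

end

lemma exp_minus_le_square:
  fixes x :: real
  assumes "x > 0"
  shows "exp (- x) < 2 / x\<^sup>2"
proof -
  have "1 + x + x\<^sup>2 / 2 \<le> exp x" using exp_lower_Taylor_quadratic[of x] assms by simp
  then have "x\<^sup>2 / 2 < exp x" using assms by linarith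
  then show ?thesis using assms by (simp add: exp_minus field_simps)
qed

context near_martingale
begin

definition block_oscillation :: "'d \<Rightarrow> real \<Rightarrow> real \<Rightarrow> real \<Rightarrow> nat \<Rightarrow> 'a set" where
  "block_oscillation j s t e n = {\<omega> \<in> space M.
     \<exists>l\<in>{nat \<lfloor>real (Suc n) * s\<rfloor>..nat \<lfloor>real (Suc n) * t\<rfloor>}.
       e \<le> \<bar>(S l \<omega> - S (nat \<lfloor>real (Suc n) * s\<rfloor>) \<omega>) $ j\<bar> / sqrt (real (Suc n))}"

lemma block_oscillation_sets[measurable]: "block_oscillation j s t e n \<in> sets M"
proof -
  have [measurable]: "(\<lambda>\<omega>. (S l \<omega> - S m \<omega>) $ j) \<in> borel_measurable M" for l m
    using borel_measurable_continuous_onI[OF continuous_on_component[OF continuous_on_id]]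
    by (rule measurable_compose[rotated]) measurable
  show ?thesis unfolding block_oscillation_def by measurable
qed

text \<open>
  The exponential bound with \<open>lam = e / (4 q)\<close> gives \<open>2 exp (- e\<^sup>2 / (8 q))\<close> in the limit. The
  weaker polynomial form is quadratic in \<open>q\<close>, so that the sum over the blocks of a fine grid
  is small.
\<close>

lemma prob_block_oscillation:
  assumes st: "0 \<le> s" "s \<le> t" "t \<le> real T" and e: "0 < e" and q: "0 < q"
    and Cq: "C t $ j $ j - C s $ j $ j < q"
  shows "\<forall>\<^sub>F n in sequentially. prob (block_oscillation j s t e n) \<le> 256 * q\<^sup>2 / e ^ 4"
proof -
  \<comment> \<open>This value minimizes the exponent \<open>- lam e + 2 lam\<^sup>2 q\<close> of the maximal inequality.\<close>
  define lam where "lam = e / (4 * q)"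
  define b where "b = 1 / (2 * lam)"
  have lam: "0 < lam" "lam * b \<le> 1/2" using e q by (auto simp: lam_def b_def)
  have b: "0 < b" using lam by (simp add: b_def)
  define V where "V = (\<lambda>n \<omega>. axis j 1 \<bullet> (qv t n \<omega> *v axis j 1) - axis j 1 \<bullet> (qv s n \<omega> *v axis j 1))"
  have [measurable]: "V n \<in> borel_measurable M" for n unfolding V_def by measurable
  have V: "tendsto_in_prob M V (C t $ j $ j - C s $ j $ j)"
  proof -
    have "tendsto_in_prob M (\<lambda>n \<omega>. axis j 1 \<bullet> (qv t n \<omega> *v axis j 1) + (- axis j 1) \<bullet> (qv s n \<omega> *v axis j 1))
       (axis j 1 \<bullet> (C t *v axis j 1) + (- axis j 1) \<bullet> (C s *v axis j 1))"
      using st by (intro tendsto_in_prob_add qv_form_tendsto) auto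
    then show ?thesis by (simp add: V_def[abs_def] matrix_form_axis)
  qed
  let ?a = "\<lambda>n. nat \<lfloor>real (Suc n) * s\<rfloor>"
  let ?b = "\<lambda>n. nat \<lfloor>real (Suc n) * t\<rfloor>"
  let ?N = "\<lambda>n. Suc n * T + 1"
  have ab: "?a n \<le> ?b n" for n using st by (intro nat_mono floor_mono mult_left_mono) auto
  have bN: "?b n \<le> ?N n" for n using floor_le_N[OF st(3), of n] by simp
  \<comment> \<open>The martingale restarted at the beginning of the block; the sign \<open>\<sigma>\<close> gives both one-sided bounds.\<close>
  define z where "z = (\<lambda>\<sigma> n l \<omega>. (if ?a n < l \<and> l \<le> ?b n
      then (\<sigma> / sqrt (real (Suc n))) *\<^sub>R axis j (1::real) else 0) \<bullet> \<xi> l \<omega>)"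
  have z_eq: "z \<sigma> n l \<omega> = (if ?a n < l \<and> l \<le> ?b n then \<sigma> / sqrt (real (Suc n)) * \<xi> l \<omega> $ j else 0)"
    for \<sigma> n l \<omega> by (simp add: z_def inner_axis')
  have z_sum: "(\<Sum>l=1..m. z \<sigma> n l \<omega>) = \<sigma> / sqrt (real (Suc n)) * (S m \<omega> - S (?a n) \<omega>) $ j"
    if "?a n \<le> m" "m \<le> ?b n" for \<sigma> n m \<omega>
    unfolding z_eq using sum_if_between[OF that, of "\<lambda>l. \<sigma> / sqrt (real (Suc n)) * \<xi> l \<omega> $ j"]
    by (simp add: S_def sum_component sum_distrib_left right_diff_distrib)
  have z_qv: "(\<Sum>l=1..?N n. (z \<sigma> n l \<omega>)\<^sup>2) = V n \<omega>" if "\<bar>\<sigma>\<bar> = 1" for \<sigma> n \<omega>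
  proof -
    have \<sigma>: "\<sigma>\<^sup>2 = 1" using that by (metis one_power2 power2_abs)
    have "(\<Sum>l=1..?N n. (z \<sigma> n l \<omega>)\<^sup>2)
        = (\<Sum>l=1..?N n. if l \<le> ?b n then (if ?a n < l \<and> l \<le> ?b n then (\<xi> l \<omega> $ j)\<^sup>2 / real (Suc n) else 0) else 0)"
      by (intro sum.cong refl) (auto simp: z_eq power_mult_distrib power_divide \<sigma>)
    also have "\<dots> = (\<Sum>l=1..?b n. (\<xi> l \<omega> $ j)\<^sup>2 / real (Suc n)) - (\<Sum>l=1..?a n. (\<xi> l \<omega> $ j)\<^sup>2 / real (Suc n))"
      by (subst sum_if_le[OF bN], subst sum_if_between[OF ab order_refl]) (rule refl)
    also have "\<dots> = V n \<omega>"
      unfolding V_def qv_form by (simp add: inner_axis' power2_eq_square sum_divide_distrib)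
    finally show ?thesis .
  qed
  have z_mds: "martingale_differences M F (z \<sigma> n)" for \<sigma> n
    unfolding z_def by (rule martingale_differences_inner[OF adapted integrable_\<xi> centered])
  have z_le: "\<bar>z \<sigma> n l \<omega>\<bar> \<le> error T n \<omega>"
    if "\<bar>\<sigma>\<bar> = 1" "\<omega> \<in> space M" "l \<in> {1..?N n}" for \<sigma> n l \<omega>
  proof -
    have "\<bar>\<xi> l \<omega> $ j\<bar> / sqrt (real (Suc n)) \<le> norm (\<xi> l \<omega>) / sqrt (real (Suc n))"
      by (intro divide_right_mono component_le_norm_cart) auto
    then show ?thesis
      using that \<xi>_le_error[OF that(2,3)] error_nonneg[OF that(2), of T n]
      by (auto simp: z_eq abs_mult)
  qed
  define G where "G = (\<lambda>\<sigma> n. {\<omega> \<in> space M. (\<exists>k\<in>{1..?N n}. e \<le> (\<Sum>l=1..k. z \<sigma> n l \<omega>))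
      \<and> (\<Sum>l=1..?N n. (z \<sigma> n l \<omega>)\<^sup>2) \<le> q \<and> (\<forall>l\<in>{1..?N n}. \<bar>z \<sigma> n l \<omega>\<bar> \<le> b)})"
  have [measurable]: "z \<sigma> n l \<in> borel_measurable M" if "l \<ge> 1" for \<sigma> n l
    using that unfolding z_def by measurable
  have [measurable]: "(\<lambda>\<omega>. \<Sum>l=1..k. z \<sigma> n l \<omega>) \<in> borel_measurable M" for \<sigma> n k
    by (intro borel_measurable_sum) auto
  have [measurable]: "(\<lambda>\<omega>. \<Sum>l=1..k. (z \<sigma> n l \<omega>)\<^sup>2) \<in> borel_measurable M" for \<sigma> n k
    by (intro borel_measurable_sum borel_measurable_power) auto
  have G_sets[measurable]: "G \<sigma> n \<in> sets M" for \<sigma> n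
    unfolding G_def by measurable
  define r where "r = (\<lambda>n. exp (- (e\<^sup>2 / (8 * q))) * (1 + lam * exp (lam * e) * expectation (error T n)))"
  have G_prob: "prob (G \<sigma> n) \<le> r n" if "\<bar>\<sigma>\<bar> = 1" for \<sigma> n
  proof -
    have "prob (G \<sigma> n) \<le> exp (- (lam * e) + 2 * lam\<^sup>2 * q) * (1 + lam * exp (lam * e) * expectation (error T n))"
      unfolding G_def
      by (rule exponential_maximal_inequality[OF z_mds error_integrable z_le[OF that] error_nonneg lam e])
    also have "- (lam * e) + 2 * lam\<^sup>2 * q = - (e\<^sup>2 / (8 * q))"
      using q by (simp add: lam_def field_simps power2_eq_square)
    finally show ?thesis by (simp add: r_def)
  qed
  define VB where "VB = (\<lambda>n. {\<omega> \<in> space M. dist (V n \<omega>) (C t $ j $ j - C s $ j $ j) > q - (C t $ j $ j - C s $ j $ j)})"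
  define EB where "EB = (\<lambda>n. {\<omega> \<in> space M. b \<le> error T n \<omega>})"
  have [measurable]: "error T n \<in> borel_measurable M" for n using error_integrable by auto
  have [measurable]: "VB n \<in> sets M" "EB n \<in> sets M" for n unfolding VB_def EB_def by measurable
  have sub: "block_oscillation j s t e n \<subseteq> G 1 n \<union> G (-1) n \<union> (VB n \<union> EB n)" for n
  proof
    fix \<omega> assume "\<omega> \<in> block_oscillation j s t e n"
    then obtain l where \<omega>: "\<omega> \<in> space M" and l: "?a n \<le> l" "l \<le> ?b n"
      and big: "e \<le> \<bar>(S l \<omega> - S (?a n) \<omega>) $ j\<bar> / sqrt (real (Suc n))"
      by (auto simp: block_oscillation_def)
    have l1: "1 \<le> l"
    proof (rule ccontr)
      assume "\<not> 1 \<le> l"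
      then have "l = 0" by simp
      moreover from this have "?a n = 0" using l(1) by (metis le_zero_eq)
      ultimately show False using big e by (simp del: nat_eq_iff of_nat_Suc)
    qed
    show "\<omega> \<in> G 1 n \<union> G (-1) n \<union> (VB n \<union> EB n)"
    proof (cases "\<omega> \<in> VB n \<union> EB n")
      case False
      then have "V n \<omega> \<le> q" and err: "error T n \<omega> < b"
        using \<omega> unfolding VB_def EB_def dist_real_def by auto
      define \<sigma> :: real where "\<sigma> = (if (S l \<omega> - S (?a n) \<omega>) $ j \<ge> 0 then 1 else - 1)"
      have \<sigma>: "\<bar>\<sigma>\<bar> = 1" by (simp add: \<sigma>_def)
      have "e \<le> (\<Sum>i=1..l. z \<sigma> n i \<omega>)"
        using big unfolding z_sum[OF l] \<sigma>_def by (auto simp: abs_if split: if_splits)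
      moreover have "l \<in> {1..?N n}" using l1 l(2) bN[of n] by simp
      moreover have "\<bar>z \<sigma> n i \<omega>\<bar> \<le> b" if "i \<in> {1..?N n}" for i
        using z_le[OF \<sigma> \<omega> that] err by linarith
      ultimately have "\<omega> \<in> G \<sigma> n"
        using \<omega> \<open>V n \<omega> \<le> q\<close> unfolding G_def z_qv[OF \<sigma>] by blast
      then show ?thesis by (auto simp: \<sigma>_def split: if_splits)
    qed simp
  qed
  have "(\<lambda>n. 2 * r n + (prob (VB n) + expectation (error T n) / b))
     \<longlonglongrightarrow> 2 * (exp (- (e\<^sup>2 / (8 * q))) * (1 + lam * exp (lam * e) * 0)) + (0 + 0 / b)"
  proof (intro tendsto_add tendsto_mult tendsto_divide tendsto_const error_tendsto_0)
    show "r \<longlonglongrightarrow> exp (- (e\<^sup>2 / (8 * q))) * (1 + lam * exp (lam * e) * 0)"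
      unfolding r_def by (intro tendsto_intros error_tendsto_0)
    show "(\<lambda>n. prob (VB n)) \<longlonglongrightarrow> 0"
      using V Cq unfolding VB_def tendsto_in_prob_def by simp
  qed (use b in simp)
  moreover have "2 * (exp (- (e\<^sup>2 / (8 * q))) * (1 + lam * exp (lam * e) * 0)) + (0 + 0 / b) < 256 * q\<^sup>2 / e ^ 4"
  proof -
    have "exp (- (e\<^sup>2 / (8 * q))) < 2 / (e\<^sup>2 / (8 * q))\<^sup>2"
      using e q by (intro exp_minus_le_square) simp
    also have "\<dots> = 128 * q\<^sup>2 / e ^ 4" using e q by (simp add: field_simps power2_eq_square power4_eq_xxxx)
    finally show ?thesis by simp
  qed
  ultimately have "\<forall>\<^sub>F n in sequentially. 2 * r n + (prob (VB n) + expectation (error T n) / b) < 256 * q\<^sup>2 / e ^ 4"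
    by (rule order_tendstoD)
  then show ?thesis
  proof eventually_elim
    case (elim n)
    have "prob (block_oscillation j s t e n) \<le> prob (G 1 n \<union> G (-1) n \<union> (VB n \<union> EB n))"
      by (intro finite_measure_mono[OF sub]) measurable
    also have "\<dots> \<le> prob (G 1 n \<union> G (-1) n) + prob (VB n \<union> EB n)" by (rule measure_Un_le) measurable
    also have "\<dots> \<le> (prob (G 1 n) + prob (G (-1) n)) + (prob (VB n) + prob (EB n))"
      by (intro add_mono measure_Un_le) measurable
    also have "prob (EB n) \<le> expectation (error T n) / b"
      unfolding EB_def using error_nonneg b
      by (intro integral_Markov_inequality_measure[OF error_integrable, where A = "{}"]) auto
    also have "prob (G 1 n) \<le> r n" by (rule G_prob) simp
    also have "prob (G (-1) n) \<le> r n" by (rule G_prob) simp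
    finally show ?case using elim by linarith
  qed
qed

lemma C_diag_mono:
  assumes "0 \<le> s" "s \<le> t"
  shows "C s $ j $ j \<le> C t $ j $ j"
proof (cases "s = t")
  case False
  have "(\<Sum>i\<in>UNIV. \<Sum>k\<in>UNIV. (C t $ i $ k - C s $ i $ k) * (axis j 1 :: real^'d) $ i * (axis j 1 :: real^'d) $ k)
      = C t $ j $ j - C s $ j $ j"
    by (simp add: axis_def if_distrib[of "\<lambda>x. _ * x"] cong: if_cong)
  then show ?thesis using C_increasing[of s t "axis j 1"] assms False by simp
qed simp

text \<open>
  The grid increments of each diagonal entry of \<open>C\<close> have a bounded sum, and they are uniformly small for
  a fine grid; hence so is the sum of their squares, which bounds the probability that some block
  oscillates. The summand \<open>1 / m\<close> keeps the block parameters strictly above the increments.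
\<close>

proposition oscillation_tight:
  assumes e: "0 < e" and \<eta>: "0 < \<eta>"
  shows "\<exists>m0\<ge>1. \<forall>m\<ge>m0. \<forall>\<^sub>F n in sequentially. \<exists>B\<in>sets M. prob B \<le> \<eta> \<and>
    (\<forall>\<omega>\<in>space M - B. \<forall>k<m * T. \<forall>t. real k / real m \<le> t \<and> t \<le> real (Suc k) / real m \<longrightarrow>
       norm (scaled_walk X (Suc n) t \<omega> - scaled_walk X (Suc n) (real k / real m) \<omega>) \<le> e)"
proof -
  define e' where "e' = e / (2 * real CARD('d))"
  have e': "0 < e'" using e by (simp add: e'_def)
  define H where "H = (\<Sum>j\<in>(UNIV::'d set). C (real T) $ j $ j + real T)"
  have C0: "0 \<le> C t $ j $ j" if "0 \<le> t" for t j
    using C_diag_mono[of 0 t j] that C_0 by simp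
  have H: "0 \<le> H" unfolding H_def by (intro sum_nonneg add_nonneg_nonneg C0) auto
  \<comment> \<open>The sum of \<open>256 q\<^sup>2 / e'\<^sup>4\<close> over all blocks and coordinates is at most \<open>256 \<kappa> H / e'\<^sup>4 \<le> \<eta> / 2\<close> if every \<open>q\<close> is at most \<open>\<kappa>\<close>.\<close>
  define \<kappa> where "\<kappa> = \<eta> * e' ^ 4 / (512 * (H + 1))"
  have \<kappa>: "0 < \<kappa>" using \<eta> e' H by (simp add: \<kappa>_def)
  have "uniformly_continuous_on {0..real T} C"
    by (intro compact_uniformly_continuous continuous_on_subset[OF C_continuous]) auto
  then obtain \<delta> where \<delta>: "\<delta> > 0"
    "\<And>s t. s \<in> {0..real T} \<Longrightarrow> t \<in> {0..real T} \<Longrightarrow> dist s t < \<delta> \<Longrightarrow> dist (C s) (C t) < \<kappa> / 2"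
    unfolding uniformly_continuous_on_def using \<kappa> by (meson half_gt_zero)
  obtain m0 :: nat where m0: "m0 > 0" "1 / real m0 < min \<delta> (\<kappa> / 2)"
    using \<delta>(1) \<kappa> nat_approx_posE[of "min \<delta> (\<kappa> / 2)"] by (metis half_gt_zero min_less_iff_conj zero_less_Suc)
  show ?thesis
  proof (intro exI[of _ m0] conjI allI impI)
    show "1 \<le> m0" using m0 by simp
    fix m assume "m0 \<le> m"
    then have m: "0 < m" "1 / real m \<le> 1 / real m0" using m0 by (auto simp: frac_le)
    define g where "g = (\<lambda>k. real k / real m)"
    have g: "0 \<le> g k" "g k \<le> g (Suc k)" "g (Suc k) - g k = 1 / real m" for k
      using m by (auto simp: g_def field_simps)
    have gT: "g k \<le> real T" if "k \<le> m * T" for k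
    proof -
      have "real k \<le> real (m * T)" using that by (simp only: of_nat_le_iff)
      then show ?thesis using m by (simp add: g_def field_simps)
    qed
    define q where "q = (\<lambda>k j. C (g (Suc k)) $ j $ j - C (g k) $ j $ j + 1 / real m)"
    have q_pos: "0 < q k j" for k j
      using C_diag_mono[OF g(1,2), of k j] m by (simp add: q_def add_nonneg_pos)
    have q_le: "q k j \<le> \<kappa>" if "k < m * T" for k j
    proof -
      have "dist (g (Suc k)) (g k) < \<delta>" using g(2,3)[of k] m m0 by (simp add: dist_real_def)
      then have "dist (C (g (Suc k))) (C (g k)) < \<kappa> / 2"
        using gT[of k] gT[of "Suc k"] that g(1) by (intro \<delta>(2)) auto
      moreover have "C (g (Suc k)) $ j $ j - C (g k) $ j $ j \<le> dist (C (g (Suc k))) (C (g k))"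
      proof -
        have "C (g (Suc k)) $ j $ j - C (g k) $ j $ j \<le> norm ((C (g (Suc k)) - C (g k)) $ j $ j)" by simp
        also have "\<dots> \<le> norm ((C (g (Suc k)) - C (g k)) $ j)" by (rule Finite_Cartesian_Product.norm_nth_le)
        also have "\<dots> \<le> norm (C (g (Suc k)) - C (g k))" by (rule Finite_Cartesian_Product.norm_nth_le)
        finally show ?thesis by (simp add: dist_norm)
      qed
      ultimately show ?thesis using m m0 by (simp add: q_def)
    qed
    have q_sum: "(\<Sum>k<m * T. q k j) = C (real T) $ j $ j + real T" for j
    proof -
      have "(\<Sum>k<m * T. q k j) = (C (g (m * T)) $ j $ j - C (g 0) $ j $ j) + real (m * T) * (1 / real m)"
        using sum_lessThan_telescope[of "\<lambda>k. C (g k) $ j $ j" "m * T"] by (simp add: q_def sum.distrib)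
      then show ?thesis using m C_0 by (simp add: g_def)
    qed
    have total: "(\<Sum>j\<in>UNIV. \<Sum>k<m * T. 256 * (q k j)\<^sup>2 / e' ^ 4) \<le> \<eta> / 2"
    proof -
      have "(\<Sum>j\<in>UNIV. \<Sum>k<m * T. 256 * (q k j)\<^sup>2 / e' ^ 4)
          \<le> (\<Sum>j\<in>(UNIV::'d set). \<Sum>k<m * T. 256 * (\<kappa> * q k j) / e' ^ 4)"
        using q_le q_pos e'
        by (intro sum_mono divide_right_mono mult_left_mono) (auto simp: power2_eq_square less_imp_le)
      also have "\<dots> = 256 * \<kappa> / e' ^ 4 * H"
        unfolding H_def q_sum[symmetric] sum_distrib_left by (intro sum.cong refl) simp
      also have "\<dots> \<le> 256 * \<kappa> / e' ^ 4 * (H + 1)"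
        using \<kappa> e' by (intro mult_left_mono) auto
      also have "\<dots> = \<eta> / 2"
      proof -
        have "256 * (\<eta> * p / (512 * h)) / p * h = \<eta> / 2" if "p > 0" "h > 0" for p h :: real
          using that by (simp add: field_simps)
        from this[of "e' ^ 4" "H + 1"] show ?thesis using e' H by (simp add: \<kappa>_def)
      qed
      finally show ?thesis .
    qed
    have "\<forall>\<^sub>F n in sequentially. \<forall>j\<in>UNIV. \<forall>k\<in>{..<m * T}.
        prob (block_oscillation j (g k) (g (Suc k)) e' n) \<le> 256 * (q k j)\<^sup>2 / e' ^ 4"
    proof (intro eventually_ball_finite ballI)
      fix j k assume k: "k \<in> {..<m * T}"
      show "\<forall>\<^sub>F n in sequentially. prob (block_oscillation j (g k) (g (Suc k)) e' n) \<le> 256 * (q k j)\<^sup>2 / e' ^ 4"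
      proof (rule prob_block_oscillation[OF g(1,2) _ e' q_pos])
        show "g (Suc k) \<le> real T" using k by (intro gT) auto
        show "C (g (Suc k)) $ j $ j - C (g k) $ j $ j < q k j" using m by (simp add: q_def)
      qed
    qed auto
    moreover have "\<forall>\<^sub>F n in sequentially. expectation (error T n) < \<eta> / 2 * (e / 4)"
      using e \<eta> by (intro order_tendstoD[OF error_tendsto_0]) simp
    ultimately show "\<forall>\<^sub>F n in sequentially. \<exists>B\<in>sets M. prob B \<le> \<eta> \<and>
    (\<forall>\<omega>\<in>space M - B. \<forall>k<m * T. \<forall>t. real k / real m \<le> t \<and> t \<le> real (Suc k) / real m \<longrightarrow>
       norm (scaled_walk X (Suc n) t \<omega> - scaled_walk X (Suc n) (real k / real m) \<omega>) \<le> e)"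
    proof eventually_elim
      case (elim n)
      define B1 where "B1 = (\<Union>j\<in>UNIV. \<Union>k<m * T. block_oscillation j (g k) (g (Suc k)) e' n)"
      define B2 where "B2 = {\<omega> \<in> space M. e / 4 \<le> error T n \<omega>}"
      have [measurable]: "error T n \<in> borel_measurable M" using error_integrable by auto
      have sets: "B1 \<in> sets M" "B2 \<in> sets M" unfolding B1_def B2_def by measurable
      have "prob B1 \<le> (\<Sum>j\<in>UNIV. \<Sum>k<m * T. prob (block_oscillation j (g k) (g (Suc k)) e' n))"
        unfolding B1_def
        by (intro order_trans[OF measure_UNION_le] sum_mono) (auto intro!: measure_UNION_le)
      also have "\<dots> \<le> (\<Sum>j\<in>UNIV. \<Sum>k<m * T. 256 * (q k j)\<^sup>2 / e' ^ 4)"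
        using elim by (intro sum_mono) auto
      finally have B1: "prob B1 \<le> \<eta> / 2" using total by simp
      have "prob B2 \<le> expectation (error T n) / (e / 4)"
        unfolding B2_def using error_nonneg e
        by (intro integral_Markov_inequality_measure[OF error_integrable, where A = "{}"]) auto
      also have "\<dots> \<le> \<eta> / 2" using elim(2) e by (simp add: field_simps)
      finally have B2: "prob B2 \<le> \<eta> / 2" .
      show ?case
      proof (intro bexI[of _ "B1 \<union> B2"] conjI ballI allI impI)
        show "prob (B1 \<union> B2) \<le> \<eta>" using measure_Un_le[of B1 M B2] sets B1 B2 by simp
        show "B1 \<union> B2 \<in> sets M" using sets by auto
        fix \<omega> k t
        assume \<omega>: "\<omega> \<in> space M - (B1 \<union> B2)" and k: "k < m * T"
          and t: "real k / real m \<le> t \<and> t \<le> real (Suc k) / real m"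
        let ?r = "sqrt (real (Suc n))"
        let ?a = "nat \<lfloor>real (Suc n) * g k\<rfloor>"
        let ?l = "nat \<lfloor>real (Suc n) * t\<rfloor>"
        have t_block: "g k \<le> t" "t \<le> g (Suc k)" using t unfolding g_def by blast+
        then have tg: "g k \<le> t" "t \<le> g (Suc k)" "0 \<le> t" "t \<le> real T" "g k \<le> real T"
          using g(1)[of k] gT[of "Suc k"] gT[of k] k by auto
        have err: "error T n \<omega> < e / 4" using \<omega> by (auto simp: B2_def)
        have l: "?l \<in> {?a..nat \<lfloor>real (Suc n) * g (Suc k)\<rfloor>}"
          using tg by (auto intro!: nat_mono floor_mono mult_left_mono)
        have comp: "\<bar>(S ?l \<omega> - S ?a \<omega>) $ j\<bar> / ?r < e'" for j
        proof (rule ccontr)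
          assume "\<not> ?thesis"
          then have "\<omega> \<in> block_oscillation j (g k) (g (Suc k)) e' n"
            using \<omega> l unfolding block_oscillation_def by (auto simp: not_less simp del: of_nat_Suc)
          then show False using \<omega> k by (auto simp: B1_def)
        qed
        have "norm ((1 / ?r) *\<^sub>R S ?l \<omega> - (1 / ?r) *\<^sub>R S ?a \<omega>)
            \<le> (\<Sum>j\<in>UNIV. \<bar>((1 / ?r) *\<^sub>R S ?l \<omega> - (1 / ?r) *\<^sub>R S ?a \<omega>) $ j\<bar>)"
          by (rule norm_le_l1_cart)
        also have "\<dots> = (\<Sum>j\<in>UNIV. \<bar>(S ?l \<omega> - S ?a \<omega>) $ j\<bar> / ?r)"
          by (intro sum.cong refl) (simp add: abs_divide flip: diff_divide_distrib)
        also have "\<dots> \<le> (\<Sum>j\<in>(UNIV::'d set). e')"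
          using comp by (intro sum_mono less_imp_le)
        also have "\<dots> = e / 2" by (simp add: e'_def)
        finally have S: "norm ((1 / ?r) *\<^sub>R S ?l \<omega> - (1 / ?r) *\<^sub>R S ?a \<omega>) \<le> e / 2" .
        have \<omega>M: "\<omega> \<in> space M" using \<omega> by simp
        have near_g: "norm ((1 / ?r) *\<^sub>R S ?a \<omega> - scaled_walk X (Suc n) (g k) \<omega>) \<le> error T n \<omega>"
          by (subst norm_minus_commute) (rule scaled_walk_near_S[OF \<omega>M g(1) tg(5)])
        have "norm (scaled_walk X (Suc n) t \<omega> - scaled_walk X (Suc n) (g k) \<omega>)
          \<le> error T n \<omega> + e / 2 + error T n \<omega>"
          by (rule norm_diff_triangle_le[OF norm_diff_triangle_le[OF scaled_walk_near_S[OF \<omega>M tg(3,4)] S] near_g])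
        then show "norm (scaled_walk X (Suc n) t \<omega> - scaled_walk X (Suc n) (real k / real m) \<omega>) \<le> e"
          using err by (simp add: g_def)
      qed
    qed
  qed
qed

end

section \<open>Weak convergence of finite-dimensional distributions\<close>

definition finite_functional :: "(('i \<Rightarrow> 'e::euclidean_space) \<Rightarrow> real) \<Rightarrow> bool" where
  "finite_functional a \<longleftrightarrow> (\<exists>I c. finite I \<and> a = (\<lambda>x. \<Sum>i\<in>I. c i \<bullet> x i))"

lemma finite_functional_0: "finite_functional (\<lambda>x. 0)"
  unfolding finite_functional_def by (intro exI[of _ "{}"]) auto

lemma finite_functional_uminus:
  assumes "finite_functional a"
  shows "finite_functional (\<lambda>x. - a x)"
proof -
  obtain I c where "finite I" "a = (\<lambda>x. \<Sum>i\<in>I. c i \<bullet> x i)"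
    using assms by (auto simp: finite_functional_def)
  then show ?thesis
    unfolding finite_functional_def
    by (intro exI[of _ I] exI[of _ "\<lambda>i. - c i"]) (simp add: sum_negf)
qed

lemma finite_functional_add:
  assumes "finite_functional a" "finite_functional b"
  shows "finite_functional (\<lambda>x. a x + b x)"
proof -
  obtain I c where a: "finite I" "a = (\<lambda>x. \<Sum>i\<in>I. c i \<bullet> x i)"
    using assms by (auto simp: finite_functional_def)
  obtain J d where b: "finite J" "b = (\<lambda>x. \<Sum>i\<in>J. d i \<bullet> x i)"
    using assms by (auto simp: finite_functional_def)
  have "(\<Sum>i\<in>I. c i \<bullet> x i) = (\<Sum>i\<in>I \<union> J. (if i \<in> I then c i else 0) \<bullet> x i)" for x
    using a(1) b(1) by (intro sum.mono_neutral_cong_left) auto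
  moreover have "(\<Sum>i\<in>J. d i \<bullet> x i) = (\<Sum>i\<in>I \<union> J. (if i \<in> J then d i else 0) \<bullet> x i)" for x
    using a(1) b(1) by (intro sum.mono_neutral_cong_left) auto
  ultimately have "(\<lambda>x. a x + b x)
      = (\<lambda>x. \<Sum>i\<in>I \<union> J. ((if i \<in> I then c i else 0) + (if i \<in> J then d i else 0)) \<bullet> x i)"
    by (simp add: a(2) b(2) inner_add_left sum.distrib)
  then show ?thesis
    unfolding finite_functional_def using a(1) b(1)
    by (intro exI[of _ "I \<union> J"] exI[of _ "\<lambda>i. (if i \<in> I then c i else 0) + (if i \<in> J then d i else 0)"]) auto
qed

lemma finite_functional_coordinate: "finite_functional (\<lambda>x. c \<bullet> x i)"
  unfolding finite_functional_def by (intro exI[of _ "{i}"] exI[of _ "\<lambda>_. c"]) auto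

inductive trig_polynomial :: "(('i \<Rightarrow> 'e::euclidean_space) \<Rightarrow> real) \<Rightarrow> bool" where
  cos: "finite_functional a \<Longrightarrow> trig_polynomial (\<lambda>x. r * cos (a x + \<theta>))"
| add: "trig_polynomial f \<Longrightarrow> trig_polynomial g \<Longrightarrow> trig_polynomial (\<lambda>x. f x + g x)"

lemma trig_polynomial_const: "trig_polynomial (\<lambda>x. c)"
  using trig_polynomial.cos[OF finite_functional_0, of c 0] by simp

text \<open>
  A product of cosines is a sum of cosines of the sum and of the difference of the arguments.
\<close>

lemma trig_polynomial_mult_cos:
  assumes "trig_polynomial g" "finite_functional a"
  shows "trig_polynomial (\<lambda>x. r * cos (a x + \<theta>) * g x)"
  using assms(1)
proof induction
  case (cos b s \<phi>)
  have "r * cos (a x + \<theta>) * (s * cos (b x + \<phi>))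
      = r * s / 2 * cos ((a x + - b x) + (\<theta> - \<phi>)) + r * s / 2 * cos ((a x + b x) + (\<theta> + \<phi>))" for x
  proof -
    have "cos (a x + \<theta>) * cos (b x + \<phi>)
        = (cos ((a x + - b x) + (\<theta> - \<phi>)) + cos ((a x + b x) + (\<theta> + \<phi>))) / 2"
      unfolding cos_times_cos by (simp add: algebra_simps)
    then have "r * cos (a x + \<theta>) * (s * cos (b x + \<phi>))
        = r * s * ((cos ((a x + - b x) + (\<theta> - \<phi>)) + cos ((a x + b x) + (\<theta> + \<phi>))) / 2)"
      by (metis (no_types, opaque_lifting) mult.assoc mult.left_commute)
    then show ?thesis by (simp add: field_simps)
  qed
  moreover have "trig_polynomial (\<lambda>x. r * s / 2 * cos ((a x + - b x) + (\<theta> - \<phi>))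
      + r * s / 2 * cos ((a x + b x) + (\<theta> + \<phi>)))"
    by (intro trig_polynomial.intros finite_functional_add finite_functional_uminus assms cos)
  ultimately show ?case by simp
next
  case (add f g)
  then show ?case using trig_polynomial.add by (fastforce simp: distrib_left)
qed

lemma trig_polynomial_mult:
  assumes "trig_polynomial f" "trig_polynomial g"
  shows "trig_polynomial (\<lambda>x. f x * g x)"
  using assms(1)
proof induction
  case (cos a r \<theta>)
  then show ?case using trig_polynomial_mult_cos[OF assms(2)] by blast
next
  case (add f f')
  then show ?case using trig_polynomial.add by (fastforce simp: distrib_right)
qed

lemma finite_functional_measurable:
  assumes "finite_functional a" "\<And>i. (\<lambda>\<omega>. Y \<omega> i) \<in> borel_measurable M"
  shows "(\<lambda>\<omega>. a (Y \<omega>)) \<in> borel_measurable M"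
proof -
  obtain I c where "finite I" "a = (\<lambda>x. \<Sum>i\<in>I. c i \<bullet> x i)"
    using assms by (auto simp: finite_functional_def)
  then show ?thesis using assms(2) by auto
qed

lemma (in prob_space) integrable_trig_polynomial:
  assumes "trig_polynomial p" "\<And>i. (\<lambda>\<omega>. Y \<omega> i) \<in> borel_measurable M"
  shows "integrable M (\<lambda>\<omega>. p (Y \<omega>))"
  using assms(1)
proof induction
  case (cos a r \<theta>)
  have [measurable]: "(\<lambda>\<omega>. a (Y \<omega>)) \<in> borel_measurable M"
    by (rule finite_functional_measurable[OF cos assms(2)])
  show ?case
    by (intro integrable_mult_right integrable_const_bound[of _ 1]) (auto intro!: AE_I2)
qed auto

lemma trig_polynomial_converges:
  assumes M: "prob_space M" and N: "prob_space N"
    and Y: "\<And>n i. (\<lambda>\<omega>. Y n \<omega> i) \<in> borel_measurable M" and W: "\<And>i. (\<lambda>\<omega>. W \<omega> i) \<in> borel_measurable N"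
    and conv: "\<And>a \<theta>. finite_functional a \<Longrightarrow>
      (\<lambda>n. \<integral>\<omega>. cos (a (Y n \<omega>) + \<theta>) \<partial>M) \<longlonglongrightarrow> (\<integral>\<omega>. cos (a (W \<omega>) + \<theta>) \<partial>N)"
    and p: "trig_polynomial p"
  shows "(\<lambda>n. \<integral>\<omega>. p (Y n \<omega>) \<partial>M) \<longlonglongrightarrow> (\<integral>\<omega>. p (W \<omega>) \<partial>N)"
  using p
proof induction
  case (cos a r \<theta>)
  then show ?case using tendsto_mult_left[OF conv] by simp
next
  case (add f g)
  have int: "integrable M (\<lambda>\<omega>. f (Y n \<omega>))" "integrable M (\<lambda>\<omega>. g (Y n \<omega>))"
    "integrable N (\<lambda>\<omega>. f (W \<omega>))" "integrable N (\<lambda>\<omega>. g (W \<omega>))" for n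
    by (intro prob_space.integrable_trig_polynomial[OF M] prob_space.integrable_trig_polynomial[OF N] Y W add)+
  show ?case
    unfolding Bochner_Integration.integral_add[OF int(1,2)] Bochner_Integration.integral_add[OF int(3,4)]
    by (rule tendsto_add) (rule add)+
qed

text \<open>
  Coordinatewise, \<open>v\<close> is replaced by \<open>L sin (v / L)\<close>. This is close to \<open>v\<close> on bounded sets
  when \<open>L\<close> is large, takes values in a cube, and turns polynomials into trigonometric polynomials.
\<close>

definition sine_clip :: "real \<Rightarrow> 'e::euclidean_space \<Rightarrow> 'e" where
  "sine_clip L v = (\<Sum>b\<in>Basis. (L * sin (v \<bullet> b / L)) *\<^sub>R b)"

lemma sine_clip_inner: "b \<in> Basis \<Longrightarrow> sine_clip L v \<bullet> b = L * sin (v \<bullet> b / L)"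
  by (simp add: sine_clip_def)

lemma sine_clip_error:
  fixes v :: "'e::euclidean_space"
  assumes "L > 0" "norm v \<le> A"
  shows "norm (sine_clip L v - v) \<le> real DIM('e) * A\<^sup>2 / (2 * L)"
proof -
  have "norm (sine_clip L v - v) \<le> (\<Sum>b\<in>Basis. \<bar>(sine_clip L v - v) \<bullet> b\<bar>)" by (rule norm_le_l1)
  also have "\<dots> \<le> (\<Sum>b\<in>(Basis::'e set). A\<^sup>2 / (2 * L))"
  proof (rule sum_mono)
    fix b :: 'e assume b: "b \<in> Basis"
    define u where "u = v \<bullet> b / L"
    have sin_u: "\<bar>sin u - u\<bar> \<le> u\<^sup>2 / 2"
      using Maclaurin_sin_bound[of u 2] by (simp add: sin_coeff_def eval_nat_numeral divide_simps)
    have "(sine_clip L v - v) \<bullet> b = L * (sin u - u)"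
      using assms(1) b by (simp add: inner_diff_left sine_clip_inner u_def right_diff_distrib)
    then have "\<bar>(sine_clip L v - v) \<bullet> b\<bar> = L * \<bar>sin u - u\<bar>" using assms(1) by (simp add: abs_mult)
    also have "\<dots> \<le> L * (u\<^sup>2 / 2)" using sin_u assms(1) by (intro mult_left_mono) auto
    also have "\<dots> = (v \<bullet> b)\<^sup>2 / (2 * L)" using assms(1) by (simp add: u_def power_divide power2_eq_square[of L])
    also have "\<dots> \<le> A\<^sup>2 / (2 * L)"
    proof (intro divide_right_mono)
      have "\<bar>v \<bullet> b\<bar> \<le> A" using Basis_le_norm[OF b, of v] assms(2) by linarith
      then have "\<bar>v \<bullet> b\<bar>\<^sup>2 \<le> A\<^sup>2" by (intro power_mono) auto
      then show "(v \<bullet> b)\<^sup>2 \<le> A\<^sup>2" by (simp only: power2_abs)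
    qed (use assms in simp)
    finally show "\<bar>(sine_clip L v - v) \<bullet> b\<bar> \<le> A\<^sup>2 / (2 * L)" .
  qed
  finally show ?thesis by simp
qed

text \<open>
  Dependence on the coordinates in \<open>I\<close> only is part of the Lipschitz condition. The constants are kept as
  arguments because they enter the error estimates.
\<close>

definition finitely_lipschitz :: "'i set \<Rightarrow> real \<Rightarrow> real \<Rightarrow> (('i \<Rightarrow> 'e::euclidean_space) \<Rightarrow> real) \<Rightarrow> bool" where
  "finitely_lipschitz I B K G \<longleftrightarrow> finite I \<and> 0 \<le> B \<and> 0 \<le> K \<and> (\<forall>x. \<bar>G x\<bar> \<le> B) \<and>
     (\<forall>x y. \<bar>G x - G y\<bar> \<le> K * (\<Sum>i\<in>I. norm (x i - y i)))"

lemma finitely_lipschitzD: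
  assumes "finitely_lipschitz I B K G"
  shows "finite I" "0 \<le> B" "0 \<le> K" "\<bar>G x\<bar> \<le> B" "\<bar>G x - G y\<bar> \<le> K * (\<Sum>i\<in>I. norm (x i - y i))"
  using assms unfolding finitely_lipschitz_def by blast+

lemma finitely_lipschitz_continuous:
  assumes "finitely_lipschitz I B K G"
  shows "continuous_on A G"
proof -
  have coord: "continuous_on UNIV (\<lambda>y::'a \<Rightarrow> 'b. y i)" for i
    by (rule continuous_on_product_coordinates)
  have "(G \<longlongrightarrow> G x) (at x)" for x
  proof -
    have "((\<lambda>y. K * (\<Sum>i\<in>I. norm (y i - x i))) \<longlongrightarrow> K * (\<Sum>i\<in>I. norm (x i - x i))) (at x)"
      using coord by (intro tendsto_intros) (auto simp: continuous_on_def)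
    then have "((\<lambda>y. G y - G x) \<longlongrightarrow> 0) (at x)"
      using finitely_lipschitzD(5)[OF assms]
      by (intro Lim_null_comparison[of "\<lambda>y. G y - G x", OF always_eventually]) simp_all
    then show ?thesis by (simp add: LIM_zero_iff)
  qed
  then have "continuous_on UNIV G" by (simp add: continuous_on_def)
  then show ?thesis by (rule continuous_on_subset) simp
qed

lemma finitely_lipschitz_measurable:
  fixes Y :: "'a \<Rightarrow> 'i::countable \<Rightarrow> 'e::euclidean_space"
  assumes "finitely_lipschitz I B K G" and Y: "\<And>i. (\<lambda>\<omega>. Y \<omega> i) \<in> borel_measurable M"
  shows "(\<lambda>\<omega>. G (Y \<omega>)) \<in> borel_measurable M"
proof (rule measurable_compose[of Y M borel])
  show "Y \<in> borel_measurable M" by (rule measurable_coordinatewise_then_product) (rule Y)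
  show "G \<in> borel_measurable borel"
    by (rule borel_measurable_continuous_onI[OF finitely_lipschitz_continuous[OF assms(1)]])
qed

lemma (in prob_space) integrable_finitely_lipschitz:
  fixes Y :: "'a \<Rightarrow> 'i::countable \<Rightarrow> 'e::euclidean_space"
  assumes "finitely_lipschitz I B K G" and Y: "\<And>i. (\<lambda>\<omega>. Y \<omega> i) \<in> borel_measurable M"
  shows "integrable M (\<lambda>\<omega>. G (Y \<omega>))"
  using finitely_lipschitz_measurable[OF assms] finitely_lipschitzD(4)[OF assms(1)]
  by (intro integrable_const_bound[of _ B]) auto

text \<open>
  Stone--Weierstrass on the cube, applied to the algebra of functions that become trigonometric
  polynomials after clipping.
\<close>

lemma trig_polynomial_approximation:
  fixes G :: "('i::countable \<Rightarrow> 'e::euclidean_space) \<Rightarrow> real"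
  assumes G: "continuous_on UNIV G" and L: "L > 0" and e: "e > 0"
  obtains p where "trig_polynomial p" "\<And>x. \<bar>G (\<lambda>i. sine_clip L (x i)) - p x\<bar> < e"
proof -
  define Q :: "'e set" where "Q = cbox (- L *\<^sub>R One) (L *\<^sub>R One)"
  define P where "P = (\<lambda>f :: ('i \<Rightarrow> 'e) \<Rightarrow> real. continuous_on UNIV f \<and>
      trig_polynomial (\<lambda>x. f (\<lambda>i. sine_clip L (x i))))"
  have coord: "continuous_on UNIV (\<lambda>y::'i \<Rightarrow> 'e. y i)" for i
    by (rule continuous_on_product_coordinates)
  have "\<exists>f. P f \<and> (\<forall>x\<in>PiE UNIV (\<lambda>_. Q). \<bar>G x - f x\<bar> < e)"
  proof (rule Stone_Weierstrass_HOL)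
    have "compactin (product_topology (\<lambda>_::'i. euclidean) UNIV) (PiE UNIV (\<lambda>_. Q))"
      by (simp add: compactin_PiE Q_def)
    then show "compact (PiE (UNIV::'i set) (\<lambda>_. Q))"
      by (simp add: euclidean_product_topology)
    show "P (\<lambda>x. c)" for c by (simp add: P_def trig_polynomial_const)
    show "continuous_on (PiE UNIV (\<lambda>_. Q)) f" if "P f" for f
      using that by (auto simp: P_def intro: continuous_on_subset)
    show "P (\<lambda>x. f x + g x)" if "P f \<and> P g" for f g
      using that by (auto simp: P_def intro!: continuous_on_add trig_polynomial.add)
    show "P (\<lambda>x. f x * g x)" if "P f \<and> P g" for f g
      using that by (auto simp: P_def intro!: continuous_on_mult trig_polynomial_mult)
    show "continuous_on (PiE UNIV (\<lambda>_. Q)) G" using G by (rule continuous_on_subset) simp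
    show "0 < e" by (rule e)
    fix x y :: "'i \<Rightarrow> 'e"
    assume "x \<in> PiE UNIV (\<lambda>_. Q) \<and> y \<in> PiE UNIV (\<lambda>_. Q) \<and> x \<noteq> y"
    then obtain i where "x i \<noteq> y i" by (meson ext)
    then obtain b where b: "b \<in> Basis" "x i \<bullet> b \<noteq> y i \<bullet> b" by (meson euclidean_eq_iff)
    have "trig_polynomial (\<lambda>x::'i \<Rightarrow> 'e. L * cos ((b /\<^sub>R L) \<bullet> x i + (- (pi / 2))))"
      by (intro trig_polynomial.cos finite_functional_coordinate)
    also have "(\<lambda>x::'i \<Rightarrow> 'e. L * cos ((b /\<^sub>R L) \<bullet> x i + (- (pi / 2)))) = (\<lambda>x. sine_clip L (x i) \<bullet> b)"
    proof
      fix x :: "'i \<Rightarrow> 'e"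
      have u: "(b /\<^sub>R L) \<bullet> x i = x i \<bullet> b / L" by (simp add: inner_commute divide_inverse_commute)
      have "cos (s + - (pi / 2)) = sin s" for s :: real by (simp add: cos_diff)
      then show "L * cos ((b /\<^sub>R L) \<bullet> x i + (- (pi / 2))) = sine_clip L (x i) \<bullet> b"
        unfolding u sine_clip_inner[OF b(1)] by (rule arg_cong)
    qed
    finally have "P (\<lambda>x. x i \<bullet> b)"
      using coord by (auto simp: P_def intro!: continuous_on_inner)
    with b(2) show "\<exists>f. P f \<and> f x \<noteq> f y" by blast
  qed
  then obtain f where f: "P f" "\<And>x. x \<in> PiE UNIV (\<lambda>_. Q) \<Longrightarrow> \<bar>G x - f x\<bar> < e" by blast
  show ?thesis
  proof (rule that)
    show "trig_polynomial (\<lambda>x. f (\<lambda>i. sine_clip L (x i)))" using f(1) by (simp add: P_def)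
    fix x :: "'i \<Rightarrow> 'e"
    have "sine_clip L v \<in> Q" for v
    proof -
      have "\<bar>L * sin s\<bar> \<le> L" for s using L abs_sin_le_one[of s] by (simp add: abs_mult mult_left_le)
      then have "- L \<le> L * sin s" "L * sin s \<le> L" for s by (auto simp: abs_le_iff minus_le_iff)
      then show ?thesis by (auto simp: Q_def mem_box sine_clip_inner)
    qed
    then show "\<bar>G (\<lambda>i. sine_clip L (x i)) - f (\<lambda>i. sine_clip L (x i))\<bar> < e"
      by (intro f(2)) auto
  qed
qed

text \<open>
  Clipping costs little where all relevant coordinates are at most \<open>A\<close>, and at most \<open>2 B\<close> elsewhere; after
  clipping, \<open>p\<close> is uniformly close to \<open>G\<close>.
\<close>

lemma (in prob_space) trig_approximation_error:
  fixes Y :: "'a \<Rightarrow> 'i::countable \<Rightarrow> 'e::euclidean_space"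
  assumes G: "finitely_lipschitz I B K G" and Y: "\<And>i. (\<lambda>\<omega>. Y \<omega> i) \<in> borel_measurable M"
    and L: "L > 0" and p: "trig_polynomial p" "\<And>x. \<bar>G (\<lambda>i. sine_clip L (x i)) - p x\<bar> < e"
    and tail: "\<And>i. i \<in> I \<Longrightarrow> prob {\<omega> \<in> space M. norm (Y \<omega> i) > A} \<le> \<eta>"
  shows "\<bar>(\<integral>\<omega>. G (Y \<omega>) \<partial>M) - (\<integral>\<omega>. p (Y \<omega>) \<partial>M)\<bar>
    \<le> e + K * (real (card I) * (real DIM('e) * A\<^sup>2 / (2 * L))) + 2 * B * (real (card I) * \<eta>)"
proof -
  note GD = finitely_lipschitzD[OF G]
  define T where "T = (\<lambda>i. {\<omega> \<in> space M. norm (Y \<omega> i) > A})"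
  have [measurable]: "(\<lambda>\<omega>. Y \<omega> i) \<in> borel_measurable M" for i by (rule Y)
  have T[measurable]: "T i \<in> sets M" for i unfolding T_def by measurable
  define \<tau> where "\<tau> = K * (real (card I) * (real DIM('e) * A\<^sup>2 / (2 * L)))"
  have \<tau>: "0 \<le> \<tau>" using GD(3) L by (simp add: \<tau>_def)
  have pointwise: "\<bar>G (Y \<omega>) - p (Y \<omega>)\<bar> \<le> e + \<tau> + 2 * B * (\<Sum>i\<in>I. indicator (T i) \<omega>)"
    if \<omega>: "\<omega> \<in> space M" for \<omega>
  proof (cases "\<exists>i\<in>I. \<omega> \<in> T i")
    case True
    then obtain i where "i \<in> I" "\<omega> \<in> T i" by blast
    then have "1 \<le> (\<Sum>i\<in>I. indicat_real (T i) \<omega>)"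
      using member_le_sum[of i I "\<lambda>i. indicat_real (T i) \<omega>"] GD(1) by simp
    then have "2 * B * 1 \<le> 2 * B * (\<Sum>i\<in>I. indicat_real (T i) \<omega>)"
      using GD(2) by (intro mult_left_mono) auto
    moreover have "\<bar>G (Y \<omega>) - p (Y \<omega>)\<bar> \<le> 2 * B + e"
      using p(2)[of "Y \<omega>"] GD(4)[of "Y \<omega>"] GD(4)[of "\<lambda>i. sine_clip L (Y \<omega> i)"] by linarith
    ultimately show ?thesis using \<tau> by linarith
  next
    case False
    have "\<bar>G (\<lambda>i. sine_clip L (Y \<omega> i)) - G (Y \<omega>)\<bar> \<le> K * (\<Sum>i\<in>I. norm (sine_clip L (Y \<omega> i) - Y \<omega> i))"
      by (rule GD(5))
    also have "\<dots> \<le> K * (\<Sum>i\<in>I. real DIM('e) * A\<^sup>2 / (2 * L))"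
      using False \<omega> GD(3) L by (intro mult_left_mono sum_mono sine_clip_error) (auto simp: T_def)
    also have "\<dots> = \<tau>" by (simp add: \<tau>_def)
    finally have "\<bar>G (Y \<omega>) - p (Y \<omega>)\<bar> \<le> e + \<tau>" using p(2)[of "Y \<omega>"] by linarith
    moreover have "0 \<le> 2 * B * (\<Sum>i\<in>I. indicat_real (T i) \<omega>)"
      using GD(2) by (intro mult_nonneg_nonneg sum_nonneg) auto
    ultimately show ?thesis by linarith
  qed
  have int: "integrable M (\<lambda>\<omega>. G (Y \<omega>))" "integrable M (\<lambda>\<omega>. p (Y \<omega>))"
    using integrable_finitely_lipschitz[OF G Y] integrable_trig_polynomial[OF p(1) Y] by auto
  have "\<bar>(\<integral>\<omega>. G (Y \<omega>) \<partial>M) - (\<integral>\<omega>. p (Y \<omega>) \<partial>M)\<bar> = \<bar>\<integral>\<omega>. G (Y \<omega>) - p (Y \<omega>) \<partial>M\<bar>"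
    using int by simp
  also have "\<dots> \<le> (\<integral>\<omega>. \<bar>G (Y \<omega>) - p (Y \<omega>)\<bar> \<partial>M)" by (rule integral_abs_bound)
  also have "\<dots> \<le> (\<integral>\<omega>. e + \<tau> + 2 * B * (\<Sum>i\<in>I. indicator (T i) \<omega>) \<partial>M)"
    using int pointwise by (intro integral_mono) (auto simp: emeasure_eq_measure)
  also have "\<dots> = e + \<tau> + 2 * B * (\<Sum>i\<in>I. prob (T i))"
    by (simp add: emeasure_eq_measure prob_space)
  also have "(\<Sum>i\<in>I. prob (T i)) \<le> (\<Sum>i\<in>I. \<eta>)" using tail by (intro sum_mono) (auto simp: T_def)
  finally show ?thesis using GD(2) by (simp add: \<tau>_def mult_left_mono)
qed

lemma (in prob_space) norm_tail_small:
  fixes Y :: "'a \<Rightarrow> 'e::euclidean_space"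
  assumes [measurable]: "Y \<in> borel_measurable M" and "\<eta> > 0"
  shows "\<exists>A. prob {\<omega> \<in> space M. norm (Y \<omega>) > A} \<le> \<eta>"
proof -
  define S where "S = (\<lambda>k::nat. {\<omega> \<in> space M. norm (Y \<omega>) > real k})"
  have "(\<lambda>k. prob (S k)) \<longlonglongrightarrow> prob (\<Inter>k. S k)"
  proof (rule finite_Lim_measure_decseq)
    have "S k \<in> sets M" for k unfolding S_def by measurable
    then show "range S \<subseteq> sets M" by blast
    have "real m < norm (Y \<omega>)" if "m \<le> n" "real n < norm (Y \<omega>)" for m n \<omega>
      using that by linarith
    then show "decseq S" unfolding decseq_def S_def by blast
  qed
  moreover have "(\<Inter>k. S k) = {}"
  proof -
    have "\<exists>k. \<omega> \<notin> S k" for \<omega>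
      using real_arch_simple[of "norm (Y \<omega>)"] by (auto simp: S_def not_less)
    then show ?thesis by blast
  qed
  ultimately have "(\<lambda>k. prob (S k)) \<longlonglongrightarrow> 0" by simp
  then have "\<forall>\<^sub>F k in sequentially. prob (S k) < \<eta>" using assms(2) by (rule order_tendstoD)
  then obtain k where "prob (S k) < \<eta>" by (auto simp: eventually_sequentially)
  then show ?thesis by (intro exI[of _ "real k"]) (simp add: S_def)
qed

text \<open>
  Levy's continuity theorem for finitely many vector-valued coordinates. Tightness gives a bound \<open>A\<close> for
  the coordinates, then \<open>L\<close> is chosen large in terms of \<open>A\<close>, and then a trigonometric polynomial that is close to
  the clipped functional; its expectations converge by hypothesis.
\<close>

theorem finite_dimensional_weak_convergence:
  fixes Y :: "nat \<Rightarrow> 'a \<Rightarrow> 'i::countable \<Rightarrow> 'e::euclidean_space" and W :: "'b \<Rightarrow> 'i \<Rightarrow> 'e"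
  assumes M: "prob_space M" and N: "prob_space N"
    and Y: "\<And>n i. (\<lambda>\<omega>. Y n \<omega> i) \<in> borel_measurable M" and W: "\<And>i. (\<lambda>\<omega>. W \<omega> i) \<in> borel_measurable N"
    and conv: "\<And>a \<theta>. finite_functional a \<Longrightarrow>
      (\<lambda>n. \<integral>\<omega>. cos (a (Y n \<omega>) + \<theta>) \<partial>M) \<longlonglongrightarrow> (\<integral>\<omega>. cos (a (W \<omega>) + \<theta>) \<partial>N)"
    and tight: "\<And>i \<eta>. \<eta> > 0 \<Longrightarrow>
      \<exists>A. \<forall>\<^sub>F n in sequentially. measure M {\<omega> \<in> space M. norm (Y n \<omega> i) > A} \<le> \<eta>"
    and G: "finitely_lipschitz I B K G"
  shows "(\<lambda>n. \<integral>\<omega>. G (Y n \<omega>) \<partial>M) \<longlonglongrightarrow> (\<integral>\<omega>. G (W \<omega>) \<partial>N)"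
proof (rule tendstoI)
  fix e :: real assume e: "e > 0"
  interpret M: prob_space M by (rule M)
  interpret N: prob_space N by (rule N)
  note GD = finitely_lipschitzD[OF G]
  \<comment> \<open>With these choices of \<open>\<eta>\<close> and \<open>L\<close> the error from the tails and the error of clipping are at most
    \<open>e / 10\<close> each.\<close>
  define \<eta> where "\<eta> = e / (20 * (B + 1) * (real (card I) + 1))"
  have \<eta>: "\<eta> > 0" using e GD(2) by (simp add: \<eta>_def)
  have [measurable]: "(\<lambda>\<omega>. Y n \<omega> i) \<in> borel_measurable M" "(\<lambda>\<omega>. W \<omega> i) \<in> borel_measurable N" for n i
    by (rule Y W)+
  obtain a where a: "\<And>i. \<forall>\<^sub>F n in sequentially. measure M {\<omega> \<in> space M. norm (Y n \<omega> i) > a i} \<le> \<eta>"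
  proof -
    have "\<forall>i. \<exists>A. \<forall>\<^sub>F n in sequentially. measure M {\<omega> \<in> space M. norm (Y n \<omega> i) > A} \<le> \<eta>"
      by (intro allI tight \<eta>)
    from choice[OF this] show ?thesis using that by blast
  qed
  obtain a' where a': "\<And>i. measure N {\<omega> \<in> space N. norm (W \<omega> i) > a' i} \<le> \<eta>"
  proof -
    have "\<forall>i. \<exists>A. measure N {\<omega> \<in> space N. norm (W \<omega> i) > A} \<le> \<eta>"
      by (intro allI N.norm_tail_small W \<eta>)
    from choice[OF this] show ?thesis using that by blast
  qed
  define A where "A = (\<Sum>i\<in>I. \<bar>a i\<bar> + \<bar>a' i\<bar>)"
  have A: "a i \<le> A" "a' i \<le> A" if "i \<in> I" for i
  proof -
    have "\<bar>a i\<bar> + \<bar>a' i\<bar> \<le> A" unfolding A_def by (rule member_le_sum[OF that, of "\<lambda>i. \<bar>a i\<bar> + \<bar>a' i\<bar>"]) (simp_all add: GD(1))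
    then show "a i \<le> A" "a' i \<le> A" by linarith+
  qed
  have tailY: "\<forall>\<^sub>F n in sequentially. \<forall>i\<in>I. measure M {\<omega> \<in> space M. norm (Y n \<omega> i) > A} \<le> \<eta>"
  proof (intro eventually_ball_finite[OF GD(1)] ballI)
    fix i assume i: "i \<in> I"
    show "\<forall>\<^sub>F n in sequentially. measure M {\<omega> \<in> space M. norm (Y n \<omega> i) > A} \<le> \<eta>"
      using a[of i]
    proof eventually_elim
      case (elim n)
      have "measure M {\<omega> \<in> space M. norm (Y n \<omega> i) > A} \<le> measure M {\<omega> \<in> space M. norm (Y n \<omega> i) > a i}"
        using A(1)[OF i] by (intro M.finite_measure_mono) auto
      with elim show ?case by linarith
    qed
  qed
  have tailW: "measure N {\<omega> \<in> space N. norm (W \<omega> i) > A} \<le> \<eta>" if i: "i \<in> I" for i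
  proof -
    have "measure N {\<omega> \<in> space N. norm (W \<omega> i) > A} \<le> measure N {\<omega> \<in> space N. norm (W \<omega> i) > a' i}"
      using A(2)[OF i] by (intro N.finite_measure_mono) auto
    with a'[of i] show ?thesis by linarith
  qed
  define Q where "Q = K * (real (card I) * (real DIM('e) * A\<^sup>2))"
  have Q: "0 \<le> Q" using GD(3) by (simp add: Q_def)
  define L where "L = 5 * (Q + 1) / e"
  have L: "L > 0" using Q e by (simp add: L_def)
  obtain p where p: "trig_polynomial p" "\<And>x. \<bar>G (\<lambda>i. sine_clip L (x i)) - p x\<bar> < e / 10"
    using trig_polynomial_approximation[OF finitely_lipschitz_continuous[OF G] L, of "e / 10"] e by auto
  define r where "r = e / 10 + K * (real (card I) * (real DIM('e) * A\<^sup>2 / (2 * L))) + 2 * B * (real (card I) * \<eta>)"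
  have r: "r \<le> 3 * e / 10"
  proof -
    have "K * (real (card I) * (real DIM('e) * A\<^sup>2 / (2 * L))) = Q / (2 * L)" by (simp add: Q_def)
    also have "\<dots> = e / 10 * (Q / (Q + 1))" using e Q by (simp add: L_def)
    also have "\<dots> \<le> e / 10 * 1" using e Q by (intro mult_left_mono) auto
    finally have 1: "K * (real (card I) * (real DIM('e) * A\<^sup>2 / (2 * L))) \<le> e / 10" by simp
    have "2 * B * (real (card I) * \<eta>) \<le> 2 * (B + 1) * ((real (card I) + 1) * \<eta>)"
      using GD(2) \<eta> by (intro mult_mono) auto
    also have "\<dots> = e / 10"
    proof -
      have "2 * b * (c * (e / (20 * b * c))) = e / 10" if "b > 0" "c > 0" for b c :: real
        using that by (simp add: field_simps)
      from this[of "B + 1" "real (card I) + 1"] show ?thesis using GD(2) by (simp add: \<eta>_def)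
    qed
    finally show ?thesis using 1 by (simp add: r_def)
  qed
  have errW: "\<bar>(\<integral>\<omega>. G (W \<omega>) \<partial>N) - (\<integral>\<omega>. p (W \<omega>) \<partial>N)\<bar> \<le> r"
    unfolding r_def by (rule N.trig_approximation_error[OF G W L p tailW])
  have "\<forall>\<^sub>F n in sequentially. dist (\<integral>\<omega>. p (Y n \<omega>) \<partial>M) (\<integral>\<omega>. p (W \<omega>) \<partial>N) < e / 10"
    using e by (intro tendstoD[OF trig_polynomial_converges[OF M N Y W conv p(1)]]) auto
  then show "\<forall>\<^sub>F n in sequentially. dist (\<integral>\<omega>. G (Y n \<omega>) \<partial>M) (\<integral>\<omega>. G (W \<omega>) \<partial>N) < e"
    using tailY
  proof eventually_elim
    case (elim n)
    have "\<bar>(\<integral>\<omega>. G (Y n \<omega>) \<partial>M) - (\<integral>\<omega>. p (Y n \<omega>) \<partial>M)\<bar> \<le> r"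
      unfolding r_def using elim by (intro M.trig_approximation_error[OF G Y L p]) auto
    then show ?case using errW r elim(1) e by (simp add: dist_real_def abs_if split: if_splits)
  qed
qed

section \<open>Gaussian fields with a given covariance kernel\<close>

definition psd_kernel :: "(nat \<Rightarrow> nat \<Rightarrow> real) \<Rightarrow> bool" where
  "psd_kernel K \<longleftrightarrow> (\<forall>i j. K i j = K j i) \<and>
     (\<forall>I c. finite I \<longrightarrow> 0 \<le> (\<Sum>i\<in>I. \<Sum>j\<in>I. c i * c j * K i j))"

lemma psd_kernel_sym: "psd_kernel K \<Longrightarrow> K i j = K j i"
  unfolding psd_kernel_def by (elim conjE allE)

lemma psd_kernel_nonneg:
  "psd_kernel K \<Longrightarrow> finite I \<Longrightarrow> 0 \<le> (\<Sum>i\<in>I. \<Sum>j\<in>I. c i * c j * K i j)"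
  unfolding psd_kernel_def by (elim conjE allE impE)

lemma psd_kernel_diag: "psd_kernel K \<Longrightarrow> 0 \<le> K i i"
  using psd_kernel_nonneg[of K "{i}" "\<lambda>_. 1"] by simp

text \<open>
  Otherwise the form would be negative at \<open>e i + x e n\<close> for a suitable \<open>x\<close>, being affine in \<open>x\<close>.
\<close>

lemma psd_kernel_diag_0:
  assumes K: "psd_kernel K" and n: "K n n = 0"
  shows "K i n = 0"
proof (rule ccontr)
  assume ne: "K i n \<noteq> 0"
  then have i: "i \<noteq> n" using n by auto
  define c where "c = (\<lambda>k. if k = i then 1 else - (K i i + 1) / (2 * K i n))"
  have sym: "K n i = K i n" by (rule psd_kernel_sym[OF K])
  have "0 \<le> (\<Sum>k\<in>{i, n}. \<Sum>l\<in>{i, n}. c k * c l * K k l)"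
    by (rule psd_kernel_nonneg[OF K]) simp
  also have "\<dots> = K i i + 2 * (c n * K i n)" using i n sym by (simp add: c_def)
  also have "\<dots> = - 1" using i ne by (simp add: c_def field_simps)
  finally show False by simp
qed

text \<open>
  The quadratic form of the Schur complement at \<open>c\<close> is the minimum of the original form over all
  changes of the coordinate \<open>n\<close>.
\<close>

lemma psd_kernel_schur_complement:
  assumes K: "psd_kernel K"
  shows "psd_kernel (\<lambda>i j. K i j - K i n * K n j / K n n)"
proof (cases "K n n = 0")
  case True
  then show ?thesis using K by simp
next
  case False
  have sym: "K i j = K j i" for i j by (rule psd_kernel_sym[OF K])
  show ?thesis
    unfolding psd_kernel_def
  proof (intro conjI allI impI)
    show "K i j - K i n * K n j / K n n = K j i - K j n * K n i / K n n" for i j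
      using sym[of i j] sym[of i n] sym[of n j] by simp
    fix I :: "nat set" and c :: "nat \<Rightarrow> real" assume I: "finite I"
    define s where "s = (\<Sum>i\<in>I. c i * K i n)"
    define t where "t = s / K n n"
    define J where "J = insert n I"
    have J: "finite J" "I \<subseteq> J" "n \<in> J" using I by (auto simp: J_def)
    define a where "a = (\<lambda>i. if i \<in> I then c i else 0)"
    define b where "b = (\<lambda>i. if i = n then - t else 0)"
    have suma: "(\<Sum>i\<in>J. a i * f i) = (\<Sum>i\<in>I. c i * f i)" for f
      using J by (intro sum.mono_neutral_cong_right) (auto simp: a_def)
    have sumb: "(\<Sum>i\<in>J. b i * f i) = - t * f n" for f
      using J by (simp add: b_def if_distrib[of "\<lambda>x. x * _"] cong: if_cong)
    have "0 \<le> (\<Sum>i\<in>J. \<Sum>j\<in>J. (a i + b i) * (a j + b j) * K i j)"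
      by (rule psd_kernel_nonneg[OF K J(1)])
    also have "\<dots> = (\<Sum>i\<in>J. (a i + b i) * (\<Sum>j\<in>J. (a j + b j) * K i j))"
      by (simp add: sum_distrib_left mult_ac)
    also have "\<dots> = (\<Sum>i\<in>J. (a i + b i) * ((\<Sum>j\<in>I. c j * K i j) - t * K i n))"
      by (simp add: distrib_right sum.distrib suma sumb)
    also have "\<dots> = (\<Sum>i\<in>I. c i * ((\<Sum>j\<in>I. c j * K i j) - t * K i n)) - t * ((\<Sum>j\<in>I. c j * K n j) - t * K n n)"
      by (simp add: distrib_right sum.distrib suma sumb)
    also have "(\<Sum>j\<in>I. c j * K n j) = s" unfolding s_def by (simp only: sym[of n])
    also have "(\<Sum>i\<in>I. c i * ((\<Sum>j\<in>I. c j * K i j) - t * K i n))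
        = (\<Sum>i\<in>I. \<Sum>j\<in>I. c i * c j * K i j) - t * s"
      by (simp add: right_diff_distrib sum_subtractf sum_distrib_left s_def mult_ac)
    also have "\<dots> - t * (s - t * K n n) = (\<Sum>i\<in>I. \<Sum>j\<in>I. c i * c j * K i j) - s * s / K n n"
      using False by (simp add: t_def)
    also have "s * s = (\<Sum>i\<in>I. \<Sum>j\<in>I. c i * c j * (K i n * K n j))"
      unfolding s_def sum_product by (simp add: sym[of n] mult_ac)
    also have "(\<Sum>i\<in>I. \<Sum>j\<in>I. c i * c j * K i j) - (\<Sum>i\<in>I. \<Sum>j\<in>I. c i * c j * (K i n * K n j)) / K n n
        = (\<Sum>i\<in>I. \<Sum>j\<in>I. c i * c j * (K i j - K i n * K n j / K n n))"
      by (simp add: right_diff_distrib sum_subtractf sum_divide_distrib)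
    finally show "0 \<le> (\<Sum>i\<in>I. \<Sum>j\<in>I. c i * c j * (K i j - K i n * K n j / K n n))" .
  qed
qed

text \<open>
  Eliminating the indices one after the other gives the Cholesky factor of the kernel, column by
  column. At a zero pivot the whole row and column vanish, and since division by zero yields zero the
  step then leaves the kernel unchanged.
\<close>

fun residual_kernel :: "(nat \<Rightarrow> nat \<Rightarrow> real) \<Rightarrow> nat \<Rightarrow> nat \<Rightarrow> nat \<Rightarrow> real" where
  "residual_kernel K 0 i j = K i j"
| "residual_kernel K (Suc n) i j = residual_kernel K n i j
     - residual_kernel K n i n * residual_kernel K n n j / residual_kernel K n n n"

definition cholesky :: "(nat \<Rightarrow> nat \<Rightarrow> real) \<Rightarrow> nat \<Rightarrow> nat \<Rightarrow> real" where
  "cholesky K i n = residual_kernel K n i n / sqrt (residual_kernel K n n n)"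

lemma psd_residual_kernel: "psd_kernel K \<Longrightarrow> psd_kernel (residual_kernel K n)"
proof (induction n)
  case 0
  have "residual_kernel K 0 = K" by (intro ext) simp
  with 0 show ?case by simp
next
  case (Suc n)
  have "residual_kernel K (Suc n) = (\<lambda>i j. residual_kernel K n i j
     - residual_kernel K n i n * residual_kernel K n n j / residual_kernel K n n n)"
    by (intro ext) simp
  then show ?case using psd_kernel_schur_complement[OF Suc.IH[OF Suc.prems], of n] by simp
qed

lemma residual_kernel_sym: "psd_kernel K \<Longrightarrow> residual_kernel K n i j = residual_kernel K n j i"
  by (rule psd_kernel_sym[OF psd_residual_kernel])

lemma residual_kernel_eliminated:
  assumes "psd_kernel K" "i < n"
  shows "residual_kernel K n i j = 0"
  using assms(2)
proof (induction n arbitrary: j)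
  case (Suc n)
  show ?case
  proof (cases "i = n")
    case True
    show ?thesis
    proof (cases "residual_kernel K n n n = 0")
      case 0: True
      then have "residual_kernel K n j n = 0"
        by (rule psd_kernel_diag_0[OF psd_residual_kernel[OF assms(1)]])
      then show ?thesis using True 0 residual_kernel_sym[OF assms(1), of n n j] by simp
    qed (simp add: True)
  next
    case False
    then show ?thesis using Suc by simp
  qed
qed simp

lemma cholesky_factorization:
  assumes K: "psd_kernel K" and i: "i < m"
  shows "(\<Sum>n<m. cholesky K i n * cholesky K j n) = K i j"
proof -
  have "K i j = (\<Sum>n<m. cholesky K i n * cholesky K j n) + residual_kernel K m i j" for m
  proof (induction m)
    case (Suc m)
    have "cholesky K i m * cholesky K j m
        = residual_kernel K m i m * residual_kernel K m m j / residual_kernel K m m m"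
      using psd_kernel_diag[OF psd_residual_kernel[OF K], of m m] residual_kernel_sym[OF K, of m m j]
      by (simp add: cholesky_def)
    then show ?case using Suc by simp
  qed simp
  from this[of m] show ?thesis using residual_kernel_eliminated[OF K i] by simp
qed

text \<open>
  A sequence of independent standard normal variables, carried by the type of vector-valued functions
  on the real line so that the limit process is defined on a space of this type. The variable with
  number \<open>k\<close> is the value at \<open>k\<close>, all of whose coordinates coincide.
\<close>

definition noise_space :: "(real \<Rightarrow> real^'d) measure" where
  "noise_space = distr (Pi\<^sub>M UNIV (\<lambda>_::nat. std_normal_distribution)) (Pi\<^sub>M UNIV (\<lambda>_. borel))
     (\<lambda>\<omega> x. \<chi> j. \<omega> (nat \<lfloor>x\<rfloor>))"

definition noise :: "nat \<Rightarrow> (real \<Rightarrow> real^'d) \<Rightarrow> real" where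
  "noise k \<omega> = \<omega> (real k) $ undefined"

definition gaussian_field :: "(nat \<Rightarrow> nat \<Rightarrow> real) \<Rightarrow> nat \<Rightarrow> (real \<Rightarrow> real^'d) \<Rightarrow> real" where
  "gaussian_field K i \<omega> = (\<Sum>n\<le>i. cholesky K i n * noise n \<omega>)"

lemma prob_space_std_normal: "prob_space std_normal_distribution"
  by (rule prob_space_normal_density) simp

lemma noise_embedding_measurable:
  "(\<lambda>\<omega> x. \<chi> j. \<omega> (nat \<lfloor>x\<rfloor>) :: real^'d)
    \<in> Pi\<^sub>M UNIV (\<lambda>_::nat. std_normal_distribution) \<rightarrow>\<^sub>M Pi\<^sub>M UNIV (\<lambda>_::real. borel)"
proof (rule measurable_PiM_single')
  fix x :: real
  have 1: "(\<lambda>\<omega>. \<omega> (nat \<lfloor>x\<rfloor>)) \<in> Pi\<^sub>M UNIV (\<lambda>_::nat. std_normal_distribution) \<rightarrow>\<^sub>M borel"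
    using measurable_component_singleton[of "nat \<lfloor>x\<rfloor>" UNIV "\<lambda>_. std_normal_distribution"] by simp
  have 2: "(\<lambda>r. \<chi> j. r :: real^'d) \<in> borel_measurable borel"
    by (intro borel_measurable_continuous_onI continuous_intros)
  show "(\<lambda>\<omega>. \<chi> j. \<omega> (nat \<lfloor>x\<rfloor>) :: real^'d) \<in> Pi\<^sub>M UNIV (\<lambda>_::nat. std_normal_distribution) \<rightarrow>\<^sub>M borel"
    by (rule measurable_compose[OF 1 2])
qed auto

lemma prob_space_noise_space: "prob_space noise_space"
  unfolding noise_space_def
  by (intro prob_space.prob_space_distr noise_embedding_measurable prob_space_PiM prob_space_std_normal)

lemma measurable_vec_nth_compose:
  assumes "f \<in> borel_measurable M"
  shows "(\<lambda>\<omega>. (f \<omega> :: real^'d) $ j) \<in> borel_measurable M"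
  by (rule measurable_compose[OF assms])
     (intro borel_measurable_continuous_onI continuous_on_component continuous_on_id)

lemma noise_measurable[measurable]: "noise k \<in> borel_measurable (noise_space :: (real \<Rightarrow> real^'d) measure)"
proof -
  have "(\<lambda>\<omega>. \<omega> (real k)) \<in> (noise_space :: (real \<Rightarrow> real^'d) measure) \<rightarrow>\<^sub>M borel"
    using measurable_component_singleton[of "real k" UNIV "\<lambda>_. borel"] by (simp add: noise_space_def)
  then show ?thesis unfolding noise_def[abs_def] by (rule measurable_vec_nth_compose)
qed

lemma gaussian_field_measurable[measurable]: "gaussian_field K i \<in> borel_measurable noise_space"
  unfolding gaussian_field_def[abs_def] by measurable

lemma noise_characteristic_function:
  "(\<integral>\<omega>. iexp (\<Sum>k<m. b k * noise k \<omega>) \<partial>(noise_space :: (real \<Rightarrow> real^'d) measure))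
    = of_real (exp (- ((\<Sum>k<m. (b k)\<^sup>2) / 2)))"
proof -
  let ?P = "Pi\<^sub>M UNIV (\<lambda>_::nat. std_normal_distribution)"
  interpret P: prob_space ?P by (intro prob_space_PiM prob_space_std_normal)
  have coord: "(\<lambda>\<omega>. \<omega> k) \<in> borel_measurable ?P" for k :: nat
    using measurable_component_singleton[of k UNIV "\<lambda>_. std_normal_distribution"] by simp
  have law: "distr ?P borel (\<lambda>\<omega>. \<omega> k) = std_normal_distribution" for k :: nat
  proof -
    have "distr ?P borel (\<lambda>\<omega>. \<omega> k) = distr ?P std_normal_distribution (\<lambda>\<omega>. \<omega> k)"
      by (rule distr_cong) auto
    also have "\<dots> = std_normal_distribution"
      by (rule distr_PiM_component[OF prob_space_std_normal]) simp
    finally show ?thesis .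
  qed
  have indep: "P.indep_vars (\<lambda>_. borel) (\<lambda>k \<omega>. \<omega> k) (UNIV :: nat set)"
  proof (subst P.indep_vars_iff_distr_eq_PiM)
    have "distr ?P (Pi\<^sub>M UNIV (\<lambda>_. borel)) (\<lambda>\<omega>. \<lambda>i\<in>UNIV. \<omega> i) = distr ?P ?P (\<lambda>\<omega>. \<omega>)"
      by (rule distr_cong) (auto intro!: sets_PiM_cong)
    also have "\<dots> = Pi\<^sub>M UNIV (\<lambda>i. distr ?P borel (\<lambda>\<omega>. \<omega> i))" by (simp add: law)
    finally show "distr ?P (Pi\<^sub>M UNIV (\<lambda>_. borel)) (\<lambda>\<omega>. \<lambda>i\<in>UNIV. \<omega> i)
        = Pi\<^sub>M UNIV (\<lambda>i. distr ?P borel (\<lambda>\<omega>. \<omega> i))" .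
  qed (auto intro: coord)
  have single: "(\<integral>\<omega>. iexp (c * \<omega> k) \<partial>?P) = of_real (exp (- (c\<^sup>2) / 2))" for c :: real and k :: nat
  proof -
    have "char (distr ?P borel (\<lambda>\<omega>. \<omega> k)) c = (\<integral>\<omega>. iexp (c * \<omega> k) \<partial>?P)"
      unfolding char_def using coord[of k] by (subst integral_distr) auto
    then show ?thesis by (simp add: law char_std_normal_distribution)
  qed
  have "(\<integral>\<omega>. iexp (\<Sum>k<m. b k * noise k \<omega>) \<partial>(noise_space :: (real \<Rightarrow> real^'d) measure))
      = (\<integral>\<omega>. iexp (\<Sum>k<m. b k * \<omega> k) \<partial>?P)"
  proof -
    have "(\<lambda>\<omega>. iexp (\<Sum>k<m. b k * noise k \<omega>)) \<in> borel_measurable (Pi\<^sub>M UNIV (\<lambda>_. borel) :: (real \<Rightarrow> real^'d) measure)"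
      using noise_measurable[where 'd = 'd] unfolding noise_space_def by simp
    then show ?thesis
      unfolding noise_space_def
      by (subst integral_distr[OF noise_embedding_measurable]) (auto simp: noise_def)
  qed
  also have "\<dots> = (\<integral>\<omega>. (\<Prod>k<m. iexp (b k * \<omega> k)) \<partial>?P)"
    by (simp add: sum_distrib_left exp_sum)
  also have "\<dots> = (\<Prod>k<m. \<integral>\<omega>. iexp (b k * \<omega> k) \<partial>?P)"
  proof (rule P.indep_vars_lebesgue_integral)
    show "P.indep_vars (\<lambda>_. borel) (\<lambda>k \<omega>. iexp (b k * \<omega> k)) {..<m}"
      using P.indep_vars_subset[OF indep, of "{..<m}"]
      by (rule P.indep_vars_compose2[where Y = "\<lambda>k x. iexp (b k * x)"]) auto
    show "integrable ?P (\<lambda>\<omega>. iexp (b k * \<omega> k))" for k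
      using coord[of k] by (intro P.integrable_iexp) auto
  qed simp
  also have "\<dots> = of_real (exp (- ((\<Sum>k<m. (b k)\<^sup>2) / 2)))"
    unfolding single by (simp add: exp_sum[symmetric] sum_negf sum_divide_distrib flip: of_real_prod)
  finally show ?thesis .
qed

text \<open>
  Every linear combination of the field is a linear combination of the independent normal variables, and the sum of
  the squares of its coefficients is the quadratic form of the kernel.
\<close>

theorem gaussian_field_characteristic_function:
  fixes p :: "'k \<Rightarrow> nat"
  assumes K: "psd_kernel K" and I: "finite I"
  shows "(\<integral>\<omega>. iexp (\<Sum>k\<in>I. c k * gaussian_field K (p k) \<omega>) \<partial>(noise_space :: (real \<Rightarrow> real^'d) measure))
    = of_real (exp (- ((\<Sum>k\<in>I. \<Sum>l\<in>I. c k * c l * K (p k) (p l)) / 2)))"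
proof -
  define m where "m = Suc (\<Sum>k\<in>I. p k)"
  have m: "p k < m" if "k \<in> I" for k
    using member_le_sum[OF that, of p] I by (simp add: m_def)
  have field: "gaussian_field K (p k) \<omega> = (\<Sum>n<m. cholesky K (p k) n * noise n \<omega>)" if "k \<in> I"
    for k and \<omega> :: "real \<Rightarrow> real^'d"
    unfolding gaussian_field_def
  proof (rule sum.mono_neutral_left)
    show "{..p k} \<subseteq> {..<m}" using m[OF that] by auto
    show "\<forall>n\<in>{..<m} - {..p k}. cholesky K (p k) n * noise n \<omega> = 0"
      using residual_kernel_eliminated[OF K, of "p k"] by (auto simp: cholesky_def)
  qed simp
  have "(\<Sum>k\<in>I. c k * gaussian_field K (p k) \<omega>) = (\<Sum>n<m. (\<Sum>k\<in>I. c k * cholesky K (p k) n) * noise n \<omega>)"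
    for \<omega> :: "real \<Rightarrow> real^'d"
  proof -
    have "(\<Sum>k\<in>I. c k * gaussian_field K (p k) \<omega>) = (\<Sum>k\<in>I. \<Sum>n<m. c k * (cholesky K (p k) n * noise n \<omega>))"
      by (intro sum.cong refl) (simp add: field sum_distrib_left)
    also have "\<dots> = (\<Sum>n<m. \<Sum>k\<in>I. c k * (cholesky K (p k) n * noise n \<omega>))" by (rule sum.swap)
    finally show ?thesis by (simp add: sum_distrib_right mult.assoc)
  qed
  then have "(\<integral>\<omega>. iexp (\<Sum>k\<in>I. c k * gaussian_field K (p k) \<omega>) \<partial>(noise_space :: (real \<Rightarrow> real^'d) measure))
      = of_real (exp (- ((\<Sum>n<m. (\<Sum>k\<in>I. c k * cholesky K (p k) n)\<^sup>2) / 2)))"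
    by (simp only: noise_characteristic_function)
  also have "(\<Sum>n<m. (\<Sum>k\<in>I. c k * cholesky K (p k) n)\<^sup>2)
      = (\<Sum>k\<in>I. \<Sum>l\<in>I. c k * c l * (\<Sum>n<m. cholesky K (p k) n * cholesky K (p l) n))"
  proof -
    have "(\<Sum>n<m. (\<Sum>k\<in>I. c k * cholesky K (p k) n)\<^sup>2)
        = (\<Sum>n<m. \<Sum>k\<in>I. \<Sum>l\<in>I. c k * c l * (cholesky K (p k) n * cholesky K (p l) n))"
      by (simp add: power2_eq_square sum_product mult_ac)
    also have "\<dots> = (\<Sum>k\<in>I. \<Sum>l\<in>I. \<Sum>n<m. c k * c l * (cholesky K (p k) n * cholesky K (p l) n))"
      by (subst sum.swap, rule sum.cong[OF refl], rule sum.swap)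
    finally show ?thesis by (simp add: sum_distrib_left)
  qed
  also have "\<dots> = (\<Sum>k\<in>I. \<Sum>l\<in>I. c k * c l * K (p k) (p l))"
    by (intro sum.cong refl) (simp add: cholesky_factorization[OF K m])
  finally show ?thesis .
qed

section \<open>Weak convergence in metric spaces\<close>

lemma topspace_measurable:
  assumes "continuous_map T euclideanreal \<phi>"
  shows "\<phi> \<in> borel_measurable (borel_of_topology T)"
proof (rule borel_measurableI)
  fix U :: "real set" assume "open U"
  then have "openin T {x \<in> topspace T. \<phi> x \<in> U}"
    using assms by (simp add: continuous_map_def)
  also have "{x \<in> topspace T. \<phi> x \<in> U} = \<phi> -` U \<inter> space (borel_of_topology T)"
    by (auto simp: borel_of_topology_def space_measure_of_conv)
  finally have "openin T (\<phi> -` U \<inter> space (borel_of_topology T))" .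
  then show "\<phi> -` U \<inter> space (borel_of_topology T) \<in> sets (borel_of_topology T)"
  proof -
    have "{A. openin T A} \<subseteq> Pow (topspace T)" by (auto dest: openin_subset)
    then have "A \<in> sets (borel_of_topology T)" if "openin T A" for A
      using that by (simp add: borel_of_topology_def sigma_sets.Basic)
    then show ?thesis using \<open>openin T (\<phi> -` U \<inter> space (borel_of_topology T))\<close> by simp
  qed
qed

context Metric_space
begin

lemma lipschitz_continuous_map:
  assumes k: "0 \<le> k" and f: "\<And>x y. x \<in> M \<Longrightarrow> y \<in> M \<Longrightarrow> \<bar>f x - f y\<bar> \<le> k * d x y"
  shows "continuous_map mtopology euclideanreal f"
  unfolding continuous_map_def
proof (intro conjI allI impI)
  fix U :: "real set" assume U: "openin euclideanreal U"
  show "openin mtopology {x \<in> topspace mtopology. f x \<in> U}"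
    unfolding openin_mtopology
  proof (intro conjI allI impI)
    fix x assume x: "x \<in> {x \<in> topspace mtopology. f x \<in> U}"
    then obtain e where e: "e > 0" "\<And>y. dist y (f x) < e \<Longrightarrow> y \<in> U"
      using U by (auto simp: open_dist)
    have "mball x (e / (k + 1)) \<subseteq> {x \<in> topspace mtopology. f x \<in> U}"
    proof
      fix y assume y: "y \<in> mball x (e / (k + 1))"
      then have y': "y \<in> M" "x \<in> M" "d x y < e / (k + 1)" by (auto simp: in_mball)
      have "\<bar>f x - f y\<bar> \<le> k * d x y" using y' by (intro f)
      also have "\<dots> \<le> k * (e / (k + 1))" using y' k by (intro mult_left_mono) auto
      also have "\<dots> < e" using e k by (simp add: field_simps)
      finally have "dist (f y) (f x) < e" by (simp add: dist_real_def abs_minus_commute)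
      then show "y \<in> {x \<in> topspace mtopology. f x \<in> U}" using e y' by simp
    qed
    then show "\<exists>r>0. mball x r \<subseteq> {x \<in> topspace mtopology. f x \<in> U}"
      using e k by (intro exI[of _ "e / (k + 1)"]) auto
  qed auto
qed auto

text \<open>
  Distance functions to closed sets detect open sets, so measurability may be tested on bounded
  Lipschitz functions, for which pointwise limits are available.
\<close>

lemma measurable_borel_of_mtopologyI:
  assumes Y: "Y \<in> space \<Omega> \<rightarrow> M"
    and f: "\<And>f. (\<And>x. x \<in> M \<Longrightarrow> \<bar>f x\<bar> \<le> 1) \<Longrightarrow> (\<And>x y. x \<in> M \<Longrightarrow> y \<in> M \<Longrightarrow> \<bar>f x - f y\<bar> \<le> 1 * d x y) \<Longrightarrow>
      (\<lambda>\<omega>. f (Y \<omega>)) \<in> borel_measurable \<Omega>"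
  shows "Y \<in> \<Omega> \<rightarrow>\<^sub>M borel_of_topology mtopology"
  unfolding borel_of_topology_def
proof (rule measurable_measure_of)
  show "{A. openin mtopology A} \<subseteq> Pow (topspace mtopology)" by (auto dest!: openin_subset)
  show "Y \<in> space \<Omega> \<rightarrow> topspace mtopology" using Y by simp
  fix U assume "U \<in> {A. openin mtopology A}"
  then have U: "U \<subseteq> M" "\<And>x. x \<in> U \<Longrightarrow> \<exists>r>0. mball x r \<subseteq> U" by (auto simp: openin_mtopology)
  show "Y -` U \<inter> space \<Omega> \<in> sets \<Omega>"
  proof (cases "M - U = {}")
    case True
    then have "Y -` U \<inter> space \<Omega> = space \<Omega>" using Y U by auto
    then show ?thesis by simp
  next
    case False
    define g where "g = (\<lambda>x. INF y\<in>M - U. d x y)"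
    have bdd: "bdd_below (d x ` (M - U))" for x by (intro bdd_belowI[of _ 0]) auto
    have g0: "0 \<le> g x" for x unfolding g_def using False by (intro cINF_greatest) auto
    have lip: "g x \<le> g x' + d x x'" if "x \<in> M" "x' \<in> M" for x x'
    proof -
      have "g x - d x x' \<le> d x' y" if y: "y \<in> M - U" for y
      proof -
        have "g x \<le> d x y" unfolding g_def using y by (intro cINF_lower bdd)
        also have "\<dots> \<le> d x x' + d x' y" using y that \<open>x \<in> M\<close> \<open>x' \<in> M\<close> by (intro triangle) auto
        finally show ?thesis by simp
      qed
      then have "g x - d x x' \<le> g x'" unfolding g_def using False by (intro cINF_greatest) (auto simp: g_def)
      then show ?thesis by simp
    qed
    have pos: "x \<in> U \<longleftrightarrow> 0 < g x" if x: "x \<in> M" for x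
    proof
      assume "x \<in> U"
      then obtain r where r: "r > 0" "mball x r \<subseteq> U" using U by blast
      have "r \<le> g x" unfolding g_def
      proof (intro cINF_greatest False)
        fix y assume "y \<in> M - U"
        then show "r \<le> d x y" using r x by (force simp: in_mball)
      qed
      then show "0 < g x" using r by simp
    next
      assume *: "0 < g x"
      show "x \<in> U"
      proof (rule ccontr)
        assume "x \<notin> U"
        then have "g x \<le> d x x" unfolding g_def using x by (intro cINF_lower bdd) auto
        then show False using * x by simp
      qed
    qed
    have [measurable]: "(\<lambda>\<omega>. min 1 (g (Y \<omega>))) \<in> borel_measurable \<Omega>"
    proof (rule f)
      show "\<bar>min 1 (g x)\<bar> \<le> 1" for x using g0[of x] by auto
      show "\<bar>min 1 (g x) - min 1 (g y)\<bar> \<le> 1 * d x y" if "x \<in> M" "y \<in> M" for x y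
        using lip[OF that] lip[OF that(2,1)] commute[of x y] by (auto simp: min_def abs_if)
    qed
    have "Y -` U \<inter> space \<Omega> = {\<omega> \<in> space \<Omega>. 0 < min 1 (g (Y \<omega>))}"
      using pos Y by (auto simp: Pi_iff)
    also have "\<dots> \<in> sets \<Omega>" by measurable
    finally show ?thesis .
  qed
qed

text \<open>
  The largest function with Lipschitz constant \<open>k\<close> below \<open>\<phi>\<close>.
\<close>

definition lipschitz_envelope :: "('a \<Rightarrow> real) \<Rightarrow> real \<Rightarrow> 'a \<Rightarrow> real" where
  "lipschitz_envelope \<phi> k x = (INF y\<in>M. \<phi> y + k * d x y)"

lemma lipschitz_envelope_properties:
  assumes \<phi>: "\<And>x. x \<in> M \<Longrightarrow> \<bar>\<phi> x\<bar> \<le> B" and k: "0 \<le> k"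
  shows "\<And>x. x \<in> M \<Longrightarrow> lipschitz_envelope \<phi> k x \<le> \<phi> x"
    and "\<And>x. x \<in> M \<Longrightarrow> \<bar>lipschitz_envelope \<phi> k x\<bar> \<le> B"
    and "\<And>x y. x \<in> M \<Longrightarrow> y \<in> M \<Longrightarrow> \<bar>lipschitz_envelope \<phi> k x - lipschitz_envelope \<phi> k y\<bar> \<le> k * d x y"
proof -
  have lower: "- B \<le> \<phi> y + k * d x y" if "x \<in> M" "y \<in> M" for x y
  proof -
    have "0 \<le> k * d x y" using k by simp
    then show ?thesis using \<phi>[OF that(2)] by linarith
  qed
  have bdd: "bdd_below ((\<lambda>y. \<phi> y + k * d x y) ` M)" if "x \<in> M" for x
    using lower[OF that] by (intro bdd_belowI[of _ "- B"]) auto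
  show le: "lipschitz_envelope \<phi> k x \<le> \<phi> x" if x: "x \<in> M" for x
    unfolding lipschitz_envelope_def using cINF_lower[OF bdd[OF x] x] x by simp
  show "\<bar>lipschitz_envelope \<phi> k x\<bar> \<le> B" if x: "x \<in> M" for x
  proof -
    have "- B \<le> lipschitz_envelope \<phi> k x"
      unfolding lipschitz_envelope_def using x lower[OF x] by (intro cINF_greatest) auto
    then show ?thesis using le[OF x] \<phi>[OF x] by linarith
  qed
  have half: "lipschitz_envelope \<phi> k x - k * d x y \<le> lipschitz_envelope \<phi> k y" if xy: "x \<in> M" "y \<in> M" for x y
    unfolding lipschitz_envelope_def[of _ _ y]
  proof (rule cINF_greatest)
    fix w assume w: "w \<in> M"
    have "lipschitz_envelope \<phi> k x \<le> \<phi> w + k * d x w"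
      unfolding lipschitz_envelope_def by (rule cINF_lower[OF bdd[OF xy(1)] w])
    also have "k * d x w \<le> k * (d x y + d y w)" using triangle[OF xy w] k by (rule mult_left_mono)
    finally show "lipschitz_envelope \<phi> k x - k * d x y \<le> \<phi> w + k * d y w" by (simp add: distrib_left)
  qed (use xy in auto)
  show "\<bar>lipschitz_envelope \<phi> k x - lipschitz_envelope \<phi> k y\<bar> \<le> k * d x y" if "x \<in> M" "y \<in> M" for x y
    using half[OF that] half[OF that(2,1)] commute[of x y] by simp
qed

text \<open>
  For large \<open>k\<close> only points close to \<open>x\<close> compete in the infimum, since the others pay more than the range of
  \<open>\<phi>\<close>; close to \<open>x\<close>, continuity bounds \<open>\<phi>\<close> from below.
\<close>

lemma lipschitz_envelope_tendsto:
  assumes \<phi>: "\<And>x. x \<in> M \<Longrightarrow> \<bar>\<phi> x\<bar> \<le> B" and cont: "continuous_map mtopology euclideanreal \<phi>"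
    and x: "x \<in> M"
  shows "(\<lambda>k. lipschitz_envelope \<phi> (real k) x) \<longlonglongrightarrow> \<phi> x"
proof (rule LIMSEQ_I)
  fix e :: real assume e: "e > 0"
  have "openin mtopology {y \<in> topspace mtopology. \<phi> y \<in> {\<phi> x - e / 2<..}}"
    using cont unfolding continuous_map_def by (metis open_greaterThan open_openin)
  moreover have "x \<in> {y \<in> topspace mtopology. \<phi> y \<in> {\<phi> x - e / 2<..}}" using x e by simp
  ultimately obtain r where r: "r > 0" "mball x r \<subseteq> {y \<in> topspace mtopology. \<phi> y \<in> {\<phi> x - e / 2<..}}"
    unfolding openin_mtopology by blast
  obtain k0 where k0: "2 * B / r \<le> real k0" using real_arch_simple by blast
  have "norm (lipschitz_envelope \<phi> (real k) x - \<phi> x) < e" if "k0 \<le> k" for k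
  proof -
    have k: "2 * B \<le> real k * r" using k0 r that by (simp add: pos_divide_le_eq) (smt (verit) mult_right_mono of_nat_le_iff)
    have "\<phi> x - e / 2 \<le> lipschitz_envelope \<phi> (real k) x"
      unfolding lipschitz_envelope_def
    proof (rule cINF_greatest)
      fix y assume y: "y \<in> M"
      show "\<phi> x - e / 2 \<le> \<phi> y + real k * d x y"
      proof (cases "d x y < r")
        case True
        then have "\<phi> x - e / 2 < \<phi> y" using r x y by (auto simp: in_mball)
        moreover have "0 \<le> real k * d x y" by simp
        ultimately show ?thesis by linarith
      next
        case False
        then have "real k * r \<le> real k * d x y" by (intro mult_left_mono) auto
        then show ?thesis using k \<phi>[OF x] \<phi>[OF y] e by linarith
      qed
    qed (use x in auto)
    moreover have "lipschitz_envelope \<phi> (real k) x \<le> \<phi> x"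
      by (rule lipschitz_envelope_properties(1)[OF \<phi> _ x]) auto
    ultimately show ?thesis using e by simp
  qed
  then show "\<exists>k0. \<forall>k\<ge>k0. norm (lipschitz_envelope \<phi> (real k) x - \<phi> x) < e" by blast
qed

text \<open>
  A bounded continuous function is the pointwise limit of Lipschitz functions below it, which gives the
  lower bound for the limit inferior; the upper bound is the lower bound for the negative function.
\<close>

theorem weak_convergence_from_lipschitz:
  assumes P: "prob_space P" and Q: "prob_space Q"
    and Y: "\<And>n. Y n \<in> P \<rightarrow>\<^sub>M borel_of_topology mtopology" and Z: "Z \<in> Q \<rightarrow>\<^sub>M borel_of_topology mtopology"
    and lip: "\<And>f B k. (\<And>x. x \<in> M \<Longrightarrow> \<bar>f x\<bar> \<le> B) \<Longrightarrow> 0 \<le> k \<Longrightarrow>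
      (\<And>x y. x \<in> M \<Longrightarrow> y \<in> M \<Longrightarrow> \<bar>f x - f y\<bar> \<le> k * d x y) \<Longrightarrow>
      (\<lambda>n. \<integral>\<omega>. f (Y n \<omega>) \<partial>P) \<longlonglongrightarrow> (\<integral>\<omega>. f (Z \<omega>) \<partial>Q)"
    and cont: "continuous_map mtopology euclideanreal \<phi>" and bdd: "bounded (\<phi> ` M)"
  shows "(\<lambda>n. \<integral>\<omega>. \<phi> (Y n \<omega>) \<partial>P) \<longlonglongrightarrow> (\<integral>\<omega>. \<phi> (Z \<omega>) \<partial>Q)"
proof -
  interpret P: prob_space P by (rule P)
  interpret Q: prob_space Q by (rule Q)
  obtain B where B: "\<And>x. x \<in> M \<Longrightarrow> \<bar>\<phi> x\<bar> \<le> B" using bdd by (auto simp: bounded_iff)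
  have YM: "Y n \<omega> \<in> M" if "\<omega> \<in> space P" for n \<omega>
    using measurable_space[OF Y that] by (simp add: borel_of_topology_def space_measure_of_conv)
  have ZM: "Z \<omega> \<in> M" if "\<omega> \<in> space Q" for \<omega>
    using measurable_space[OF Z that] by (simp add: borel_of_topology_def space_measure_of_conv)
  have intY: "integrable P (\<lambda>\<omega>. f (Y n \<omega>))"
    if "continuous_map mtopology euclideanreal f" "\<And>x. x \<in> M \<Longrightarrow> \<bar>f x\<bar> \<le> B" for f n
    using that YM measurable_compose[OF Y topspace_measurable[OF that(1)]]
    by (intro P.integrable_const_bound[of _ B]) auto
  have intZ: "integrable Q (\<lambda>\<omega>. f (Z \<omega>))"
    if "continuous_map mtopology euclideanreal f" "\<And>x. x \<in> M \<Longrightarrow> \<bar>f x\<bar> \<le> B" for f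
    using that ZM measurable_compose[OF Z topspace_measurable[OF that(1)]]
    by (intro Q.integrable_const_bound[of _ B]) auto
  have lower: "\<forall>\<^sub>F n in sequentially. (\<integral>\<omega>. \<psi> (Z \<omega>) \<partial>Q) - e < (\<integral>\<omega>. \<psi> (Y n \<omega>) \<partial>P)"
    if \<psi>: "continuous_map mtopology euclideanreal \<psi>" and \<psi>B: "\<And>x. x \<in> M \<Longrightarrow> \<bar>\<psi> x\<bar> \<le> B" and e: "e > 0"
    for \<psi> and e :: real
  proof -
    define E where "E = (\<lambda>k::nat. lipschitz_envelope \<psi> (real k))"
    have E_le: "E k x \<le> \<psi> x" if "x \<in> M" for k x
      unfolding E_def by (rule lipschitz_envelope_properties(1)[OF \<psi>B _ that]) auto
    have E_B: "\<bar>E k x\<bar> \<le> B" if "x \<in> M" for k x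
      unfolding E_def by (rule lipschitz_envelope_properties(2)[OF \<psi>B _ that]) auto
    have E_lip: "\<bar>E k x - E k y\<bar> \<le> real k * d x y" if "x \<in> M" "y \<in> M" for k x y
      unfolding E_def by (rule lipschitz_envelope_properties(3)[OF \<psi>B _ that]) auto
    have E_cont: "continuous_map mtopology euclideanreal (E k)" for k
      by (rule lipschitz_continuous_map[OF _ E_lip]) auto
    have "(\<lambda>k. \<integral>\<omega>. E k (Z \<omega>) \<partial>Q) \<longlonglongrightarrow> (\<integral>\<omega>. \<psi> (Z \<omega>) \<partial>Q)"
    proof (rule integral_dominated_convergence[where w = "\<lambda>_. B"])
      show "(\<lambda>\<omega>. \<psi> (Z \<omega>)) \<in> borel_measurable Q" using intZ[OF \<psi> \<psi>B] by auto
      show "(\<lambda>\<omega>. E k (Z \<omega>)) \<in> borel_measurable Q" for k using intZ[OF E_cont E_B] by auto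
      show "AE \<omega> in Q. (\<lambda>k. E k (Z \<omega>)) \<longlonglongrightarrow> \<psi> (Z \<omega>)"
        unfolding E_def using lipschitz_envelope_tendsto[OF \<psi>B \<psi>] ZM by auto
      show "AE \<omega> in Q. norm (E k (Z \<omega>)) \<le> B" for k using E_B ZM by auto
    qed simp
    then have "\<forall>\<^sub>F k in sequentially. (\<integral>\<omega>. \<psi> (Z \<omega>) \<partial>Q) - e < (\<integral>\<omega>. E k (Z \<omega>) \<partial>Q)"
      using e by (intro order_tendstoD) auto
    then obtain k where k: "(\<integral>\<omega>. \<psi> (Z \<omega>) \<partial>Q) - e < (\<integral>\<omega>. E k (Z \<omega>) \<partial>Q)"
      by (auto simp: eventually_sequentially)
    have "(\<lambda>n. \<integral>\<omega>. E k (Y n \<omega>) \<partial>P) \<longlonglongrightarrow> (\<integral>\<omega>. E k (Z \<omega>) \<partial>Q)"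
      by (rule lip[OF E_B _ E_lip]) auto
    then have "\<forall>\<^sub>F n in sequentially. (\<integral>\<omega>. \<psi> (Z \<omega>) \<partial>Q) - e < (\<integral>\<omega>. E k (Y n \<omega>) \<partial>P)"
      using k by (rule order_tendstoD)
    then show ?thesis
    proof eventually_elim
      case (elim n)
      have "(\<integral>\<omega>. E k (Y n \<omega>) \<partial>P) \<le> (\<integral>\<omega>. \<psi> (Y n \<omega>) \<partial>P)"
        by (intro integral_mono intY E_cont E_B \<psi> \<psi>B E_le YM)
      with elim show ?case by linarith
    qed
  qed
  have neg: "continuous_map mtopology euclideanreal (\<lambda>x. - \<phi> x)"
    using cont by (intro continuous_map_minus)
  show ?thesis
  proof (rule order_tendstoI)
    fix a assume "a < (\<integral>\<omega>. \<phi> (Z \<omega>) \<partial>Q)"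
    then show "\<forall>\<^sub>F n in sequentially. a < (\<integral>\<omega>. \<phi> (Y n \<omega>) \<partial>P)"
      using lower[OF cont B, of "(\<integral>\<omega>. \<phi> (Z \<omega>) \<partial>Q) - a"] by simp
  next
    fix a assume "(\<integral>\<omega>. \<phi> (Z \<omega>) \<partial>Q) < a"
    then show "\<forall>\<^sub>F n in sequentially. (\<integral>\<omega>. \<phi> (Y n \<omega>) \<partial>P) < a"
      using lower[OF neg, of "a - (\<integral>\<omega>. \<phi> (Z \<omega>) \<partial>Q)"] B by simp
  qed
qed

end

section \<open>Weak convergence of continuous processes\<close>

lemma cpath_dist_le:
  assumes close: "\<And>t. 0 \<le> t \<Longrightarrow> t \<le> real K \<Longrightarrow> norm (f t - g t) \<le> \<delta>" and \<delta>: "0 \<le> \<delta>"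
  shows "cpath_dist f g \<le> \<delta> + (1/2)^K"
proof -
  define h :: "nat \<Rightarrow> real" where "h = (\<lambda>k. if k < K then 0 else (1/2)^(Suc k))"
  have geom: "(\<lambda>k. (1/2::real)^(Suc k)) sums 1" using power_half_series by simp
  have "(\<lambda>k. (1/2::real)^(Suc (k + K))) sums ((1/2)^K)"
    using sums_mult[OF geom, of "(1/2)^K"] by (simp add: power_add mult_ac)
  then have "(\<lambda>k. h (k + K)) sums ((1/2)^K)" by (simp add: h_def)
  then have h: "h sums ((1/2)^K)" by (subst (asm) sums_zero_iff_shift) (auto simp: h_def)
  have sum: "(\<lambda>k. (1/2)^(Suc k) * \<delta> + h k) sums (1 * \<delta> + (1/2)^K)"
    by (intro sums_add sums_mult2 geom h)
  have "cpath_dist f g \<le> (\<Sum>k. (1/2)^(Suc k) * \<delta> + h k)"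
    unfolding cpath_dist_eq
  proof (rule suminf_le[OF _ cpath_dist_summable sums_summable[OF sum]])
    fix k
    let ?S = "SUP t\<in>{0..real (Suc k)}. min (norm (f t - g t)) 1"
    show "(1/2)^(Suc k) * ?S \<le> (1/2)^(Suc k) * \<delta> + h k"
    proof (cases "k < K")
      case True
      have "?S \<le> \<delta>"
        using True by (intro cpath_sup_least min.coboundedI1 close) auto
      then show ?thesis using True by (simp add: h_def)
    next
      case False
      have "?S \<le> 1" by (rule cpath_sup_bounds)
      then have "(1/2)^(Suc k) * ?S \<le> (1/2)^(Suc k) * 1" by (intro mult_left_mono) auto
      moreover have "0 \<le> (1/2)^(Suc k) * \<delta>" using \<delta> by simp
      moreover have "h k = (1/2)^(Suc k)" using False by (simp add: h_def)
      ultimately show ?thesis by linarith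
    qed
  qed
  then show ?thesis using sums_unique[OF sum] by simp
qed

lemma cpath_dist_le_sup:
  assumes "\<And>t. 0 \<le> t \<Longrightarrow> norm (f t - g t) \<le> \<delta>" and "0 \<le> \<delta>"
  shows "cpath_dist f g \<le> \<delta>"
proof (rule LIMSEQ_le_const)
  have "(\<lambda>K. \<delta> + (1/2::real)^K) \<longlonglongrightarrow> \<delta> + 0" by (intro tendsto_intros LIMSEQ_power_zero) simp
  then show "(\<lambda>K. \<delta> + (1/2::real)^K) \<longlonglongrightarrow> \<delta>" by simp
  show "\<exists>N. \<forall>K\<ge>N. cpath_dist f g \<le> \<delta> + (1/2)^K" using assms by (intro exI[of _ 0] allI impI cpath_dist_le)
qed

lemma cpath_dist_le_1: "cpath_dist f g \<le> 1"
proof -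
  have geom: "(\<lambda>k. (1/2::real)^(Suc k)) sums 1" using power_half_series by simp
  have "cpath_dist f g \<le> (\<Sum>k. (1/2)^(Suc k))"
    unfolding cpath_dist_eq
  proof (rule suminf_le[OF _ cpath_dist_summable sums_summable[OF geom]])
    show "(1/2)^(Suc k) * (SUP t\<in>{0..real (Suc k)}. min (norm (f t - g t)) 1) \<le> (1/2)^(Suc k)" for k
      using cpath_sup_bounds(2)[of f g k] by (simp add: mult_left_le)
  qed
  then show ?thesis using sums_unique[OF geom] by simp
qed

text \<open>
  Sampling a path on a rational grid. Negative arguments are moved to zero, where continuity is
  available.
\<close>

definition rational_values :: "(real \<Rightarrow> real^'d) \<Rightarrow> rat \<Rightarrow> real^'d" where
  "rational_values f q = f (max 0 (real_of_rat q))"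

text \<open>
  The interpolation from the grid of mesh \<open>1 / m\<close>, constant after time \<open>m\<close>: it depends on finitely many values
  for each \<open>m\<close> and determines the path as \<open>m\<close> grows.
\<close>

definition grid_path :: "nat \<Rightarrow> (rat \<Rightarrow> real^'d) \<Rightarrow> real \<Rightarrow> real^'d" where
  "grid_path m x = (\<lambda>t\<in>{0..}. lin_interp (\<lambda>k. x (of_nat (min k (m * m)) / of_nat m)) (real m * t))"

definition grid_points :: "nat \<Rightarrow> rat set" where
  "grid_points m = (\<lambda>k. of_nat k / of_nat m) ` {..m * m}"

definition small_blocks :: "(real \<Rightarrow> real^'d) \<Rightarrow> nat \<Rightarrow> nat \<Rightarrow> real \<Rightarrow> bool" where
  "small_blocks f m T e \<longleftrightarrow> (\<forall>k<m * T. \<forall>t. real k / real m \<le> t \<and> t \<le> real (Suc k) / real m \<longrightarrow>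
     norm (f t - f (real k / real m)) \<le> e)"

lemma grid_path_in_cpaths: "grid_path m x \<in> cpaths"
proof -
  have "continuous_on {0..} (\<lambda>t. lin_interp (\<lambda>k. x (of_nat (min k (m * m)) / of_nat m)) (real m * t))"
    by (rule continuous_on_compose2[OF continuous_on_lin_interp]) (auto intro!: continuous_intros)
  then have "continuous_on {0..} (grid_path m x)"
    by (rule continuous_on_eq) (simp add: grid_path_def)
  then show ?thesis by (simp add: cpaths_def grid_path_def)
qed

lemma finite_grid_points: "finite (grid_points m)"
  by (simp add: grid_points_def)

lemma grid_path_lipschitz:
  "cpath_dist (grid_path m x) (grid_path m y) \<le> (\<Sum>q\<in>grid_points m. norm (x q - y q))"
proof (rule cpath_dist_le_sup)
  fix t :: real assume t: "0 \<le> t"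
  let ?q = "\<lambda>k. of_nat (min k (m * m)) / of_nat m :: rat"
  have "norm (x (?q k) - y (?q k)) \<le> (\<Sum>q\<in>grid_points m. norm (x q - y q))" for k
    by (rule member_le_sum[of "?q k" "grid_points m" "\<lambda>q. norm (x q - y q)"])
       (auto simp: grid_points_def)
  then have "norm (lin_interp (\<lambda>k. x (?q k) - y (?q k)) (real m * t) - 0) \<le> (\<Sum>q\<in>grid_points m. norm (x q - y q))"
    using t by (intro lin_interp_norm_le) auto
  then show "norm (grid_path m x t - grid_path m y t) \<le> (\<Sum>q\<in>grid_points m. norm (x q - y q))"
    using t by (simp add: grid_path_def lin_interp_diff)
qed (auto intro: sum_nonneg)

lemma block_index:
  assumes m: "0 < m" and t: "0 \<le> t" "t < real T"
  obtains k where "k < m * T" "real k / real m \<le> t" "t \<le> real (Suc k) / real m"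
    "nat \<lfloor>real m * t\<rfloor> = k"
proof (rule that[of "nat \<lfloor>real m * t\<rfloor>"])
  let ?k = "nat \<lfloor>real m * t\<rfloor>"
  have k: "real ?k \<le> real m * t" "real m * t < real ?k + 1" using t by (auto simp: of_nat_nat)
  then show "real ?k / real m \<le> t" "t \<le> real (Suc ?k) / real m"
    using m by (auto simp: field_simps)
  have "real ?k < real m * real T"
    using k(1) t m by (intro order.strict_trans1[OF k(1)]) simp
  then have "real ?k < real (m * T)" by simp
  then show "?k < m * T" by (simp only: of_nat_less_iff)
qed simp

text \<open>
  A time before \<open>T\<close> lies in a block whose two end points are grid points before the cut-off at time \<open>m\<close>. The bound
  is used up to time \<open>T - 1\<close>, and later times contribute at most \<open>(1/2) ^ (T - 1)\<close> to the distance.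
\<close>

lemma grid_path_close:
  assumes m: "0 < m" and T: "T \<le> m" and small: "small_blocks f m T e" and e: "0 \<le> e"
  shows "cpath_dist (grid_path m (rational_values f)) f \<le> 2 * e + (1/2)^(T - 1)"
proof (rule cpath_dist_le)
  fix t :: real assume t: "0 \<le> t" "t \<le> real (T - 1)"
  show "norm (grid_path m (rational_values f) t - f t) \<le> 2 * e"
  proof (cases "T = 0")
    case True
    have "grid_path m (rational_values f) 0 = f 0"
      by (simp add: grid_path_def lin_interp_def rational_values_def)
    then show ?thesis using t True e by simp
  next
    case False
    then have "t < real T" using t by linarith
    then obtain k where k: "k < m * T" "real k / real m \<le> t" "t \<le> real (Suc k) / real m"
        "nat \<lfloor>real m * t\<rfloor> = k"
      using block_index[OF m t(1)] by blast
    have "m * T \<le> m * m" using T by simp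
    then have kk: "k \<le> m * m" "Suc k \<le> m * m" using k(1) by linarith+
    have val: "rational_values f (of_nat j / of_nat m) = f (real j / real m)" for j
      by (simp add: rational_values_def of_rat_divide)
    have 1: "norm (f s - f (real k / real m)) \<le> e" if "real k / real m \<le> s" "s \<le> real (Suc k) / real m" for s
      using small k(1) that unfolding small_blocks_def by blast
    have "norm (f (real k / real m) - f t) \<le> e" using 1[OF k(2,3)] by (simp add: norm_minus_commute)
    moreover have "norm (f (real (Suc k) / real m) - f t) \<le> 2 * e"
    proof -
      have "norm (f (real (Suc k) / real m) - f (real k / real m)) \<le> e"
        by (rule 1) (auto intro!: divide_right_mono)
      from norm_diff_triangle_le[OF this] calculation show ?thesis by fastforce
    qed
    ultimately have "norm (lin_interp (\<lambda>k. rational_values f (of_nat (min k (m * m)) / of_nat m)) (real m * t) - f t) \<le> 2 * e"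
      using e t kk by (intro lin_interp_norm_le) (auto simp: k(4) val min_absorb1 simp del: of_nat_Suc)
    then show ?thesis using t by (simp add: grid_path_def)
  qed
qed (use e in simp)

lemma continuous_path_small_blocks:
  assumes f: "continuous_on {0..} f" and e: "0 < e"
  shows "\<exists>m0\<ge>1. \<forall>m\<ge>m0. small_blocks f m T e"
proof -
  have "uniformly_continuous_on {0..real T} f"
    by (intro compact_uniformly_continuous continuous_on_subset[OF f]) auto
  then obtain \<delta> where \<delta>: "\<delta> > 0"
    "\<And>s t. s \<in> {0..real T} \<Longrightarrow> t \<in> {0..real T} \<Longrightarrow> dist s t < \<delta> \<Longrightarrow> dist (f s) (f t) < e"
    unfolding uniformly_continuous_on_def using e by meson
  obtain m0 :: nat where m0: "m0 > 0" "1 / real m0 < \<delta>"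
    using nat_approx_posE[OF \<delta>(1)] by (metis zero_less_Suc)
  have "small_blocks f m T e" if m: "m0 \<le> m" for m
    unfolding small_blocks_def
  proof (intro allI impI)
    fix k t assume k: "k < m * T" and t: "real k / real m \<le> t \<and> t \<le> real (Suc k) / real m"
    have m': "0 < m" "1 / real m \<le> 1 / real m0" using m m0 by (auto simp: frac_le)
    have "real (Suc k) \<le> real (m * T)" using k by (simp only: of_nat_le_iff)
    then have "real (Suc k) / real m \<le> real T" using m' by (simp add: field_simps)
    moreover have "0 \<le> real k / real m" by simp
    ultimately have "t \<in> {0..real T}" "real k / real m \<in> {0..real T}"
      using t unfolding atLeastAtMost_iff by linarith+
    moreover have "dist t (real k / real m) < \<delta>"
      using t m0 m' by (auto simp: dist_real_def add_divide_distrib)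
    ultimately have "dist (f t) (f (real k / real m)) < e" by (intro \<delta>(2))
    then show "norm (f t - f (real k / real m)) \<le> e" by (simp add: dist_norm)
  qed
  then show ?thesis using m0 by (intro exI[of _ m0]) auto
qed

lemma grid_path_tendsto:
  assumes f: "f \<in> cpaths"
  shows "(\<lambda>m. cpath_dist (grid_path m (rational_values f)) f) \<longlonglongrightarrow> 0"
proof (rule LIMSEQ_I)
  fix e :: real assume e: "e > 0"
  obtain T where T: "(1/2::real)^T < e / 2" using real_arch_pow_inv[of "e / 2" "1/2"] e by auto
  obtain m0 where m0: "m0 \<ge> 1" "\<And>m. m \<ge> m0 \<Longrightarrow> small_blocks f m (Suc T) (e / 8)"
    using continuous_path_small_blocks[of f "e / 8" "Suc T"] f e by (auto simp: cpaths_def)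
  have "norm (cpath_dist (grid_path m (rational_values f)) f - 0) < e" if m: "m \<ge> max m0 (Suc T)" for m
  proof -
    have "cpath_dist (grid_path m (rational_values f)) f \<le> 2 * (e / 8) + (1/2)^(Suc T - 1)"
      using m m0 e by (intro grid_path_close) auto
    moreover have "0 \<le> cpath_dist (grid_path m (rational_values f)) f"
      using Metric_space_cpaths by (rule Metric_space.nonneg)
    ultimately show ?thesis using T e by simp
  qed
  then show "\<exists>m0. \<forall>m\<ge>m0. norm (cpath_dist (grid_path m (rational_values f)) f - 0) < e" by blast
qed

lemma rational_values_measurable:
  assumes "\<And>t. 0 \<le> t \<Longrightarrow> (\<lambda>\<omega>. Y \<omega> t) \<in> borel_measurable \<Omega>"
  shows "(\<lambda>\<omega>. rational_values (Y \<omega>) q) \<in> borel_measurable \<Omega>"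
  unfolding rational_values_def using assms by simp

lemma grid_functional_finitely_lipschitz:
  assumes B: "\<And>f. f \<in> cpaths \<Longrightarrow> \<bar>\<phi> f\<bar> \<le> B" and k: "0 \<le> k"
    and lip: "\<And>f g. f \<in> cpaths \<Longrightarrow> g \<in> cpaths \<Longrightarrow> \<bar>\<phi> f - \<phi> g\<bar> \<le> k * cpath_dist f g"
  shows "finitely_lipschitz (grid_points m) B k (\<lambda>x. \<phi> (grid_path m x))"
proof -
  have "0 \<le> B" using B[OF grid_path_in_cpaths] abs_ge_zero order_trans by blast
  moreover have "\<bar>\<phi> (grid_path m x) - \<phi> (grid_path m y)\<bar> \<le> k * (\<Sum>q\<in>grid_points m. norm (x q - y q))" for x y
    by (rule order_trans[OF lip[OF grid_path_in_cpaths grid_path_in_cpaths]])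
       (intro mult_left_mono grid_path_lipschitz k)
  ultimately show ?thesis
    unfolding finitely_lipschitz_def using finite_grid_points B[OF grid_path_in_cpaths] k by blast
qed

lemma grid_functional_tendsto:
  assumes f: "f \<in> cpaths"
    and lip: "\<And>f g. f \<in> cpaths \<Longrightarrow> g \<in> cpaths \<Longrightarrow> \<bar>\<phi> f - \<phi> g\<bar> \<le> k * cpath_dist f g"
  shows "(\<lambda>m. \<phi> (grid_path m (rational_values f))) \<longlonglongrightarrow> \<phi> f"
proof -
  have "(\<lambda>m. \<phi> (grid_path m (rational_values f)) - \<phi> f) \<longlonglongrightarrow> 0"
  proof (rule Lim_null_comparison)
    show "(\<lambda>m. k * cpath_dist (grid_path m (rational_values f)) f) \<longlonglongrightarrow> 0"
      by (rule tendsto_mult_right_zero[OF grid_path_tendsto[OF f]])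
    show "\<forall>\<^sub>F m in sequentially. norm (\<phi> (grid_path m (rational_values f)) - \<phi> f)
        \<le> k * cpath_dist (grid_path m (rational_values f)) f"
      using lip[OF grid_path_in_cpaths f] by simp
  qed
  then show ?thesis by (simp add: LIM_zero_iff)
qed

text \<open>
  A Lipschitz functional of a path is the limit of its values at grid interpolations, which are functions of
  finitely many coordinates.
\<close>

lemma measurable_cpathsI:
  assumes paths: "\<And>\<omega>. \<omega> \<in> space \<Omega> \<Longrightarrow> Y \<omega> \<in> cpaths"
    and coord: "\<And>t. 0 \<le> t \<Longrightarrow> (\<lambda>\<omega>. Y \<omega> t) \<in> borel_measurable \<Omega>"
  shows "Y \<in> \<Omega> \<rightarrow>\<^sub>M borel_of_topology cpath_topology"
proof (rule Metric_space.measurable_borel_of_mtopologyI[OF Metric_space_cpaths])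
  show "Y \<in> space \<Omega> \<rightarrow> cpaths" using paths by auto
  fix \<phi> :: "(real \<Rightarrow> real^'b) \<Rightarrow> real"
  assume B: "\<And>f. f \<in> cpaths \<Longrightarrow> \<bar>\<phi> f\<bar> \<le> 1"
    and lip: "\<And>f g. f \<in> cpaths \<Longrightarrow> g \<in> cpaths \<Longrightarrow> \<bar>\<phi> f - \<phi> g\<bar> \<le> 1 * cpath_dist f g"
  show "(\<lambda>\<omega>. \<phi> (Y \<omega>)) \<in> borel_measurable \<Omega>"
  proof (rule borel_measurable_LIMSEQ_real)
    show "(\<lambda>m. \<phi> (grid_path m (rational_values (Y \<omega>)))) \<longlonglongrightarrow> \<phi> (Y \<omega>)" if "\<omega> \<in> space \<Omega>" for \<omega>
      by (rule grid_functional_tendsto[OF paths[OF that] lip])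
    show "(\<lambda>\<omega>. \<phi> (grid_path m (rational_values (Y \<omega>)))) \<in> borel_measurable \<Omega>" for m
      by (rule finitely_lipschitz_measurable[OF grid_functional_finitely_lipschitz[OF B _ lip]])
         (auto intro: rational_values_measurable[OF coord])
  qed
qed

text \<open>
  Each block adds at most one to the norm. Small blocks thus also bound the marginal laws.
\<close>

lemma small_blocks_bound:
  assumes m: "0 < m" and f0: "f 0 = 0" and small: "small_blocks f m T 1" and t: "0 \<le> t" "t < real T"
  shows "norm (f t) \<le> real (m * T) + 1"
proof -
  have grid: "norm (f (real k / real m)) \<le> real k" if "k \<le> m * T" for k
    using that
  proof (induction k)
    case (Suc k)
    have "norm (f (real (Suc k) / real m) - f (real k / real m)) \<le> 1"
      using small Suc.prems unfolding small_blocks_def by (auto simp: divide_right_mono)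
    moreover have "norm (f (real k / real m)) \<le> real k" using Suc by simp
    ultimately show ?case using norm_triangle_sub[of "f (real (Suc k) / real m)" "f (real k / real m)"] by simp
  qed (simp add: f0)
  obtain k where k: "k < m * T" "real k / real m \<le> t" "t \<le> real (Suc k) / real m"
    using block_index[OF m t] by blast
  have "norm (f t - f (real k / real m)) \<le> 1" using small k unfolding small_blocks_def by blast
  moreover have "real k \<le> real (m * T)" using k(1) by (simp only: of_nat_le_iff)
  then have "norm (f (real k / real m)) \<le> real (m * T)" using grid[of k] k(1) by linarith
  ultimately show ?thesis using norm_triangle_sub[of "f t" "f (real k / real m)"] by simp
qed

text \<open>
  Tightness in the space of continuous paths, for processes that start at zero. An exceptional
  measurable set appears instead of the event that the blocks are not small, because the latter
  involves uncountably many times.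
\<close>

definition uniformly_small_blocks :: "'a measure \<Rightarrow> (nat \<Rightarrow> 'a \<Rightarrow> real \<Rightarrow> real^'d) \<Rightarrow> bool" where
  "uniformly_small_blocks M Y \<longleftrightarrow> (\<forall>T e \<eta>. 0 < e \<longrightarrow> 0 < \<eta> \<longrightarrow> (\<exists>m0\<ge>1. \<forall>m\<ge>m0. \<forall>\<^sub>F n in sequentially.
     \<exists>B\<in>sets M. measure M B \<le> \<eta> \<and> (\<forall>\<omega>\<in>space M - B. small_blocks (Y n \<omega>) m T e)))"

lemma uniformly_small_blocksE:
  assumes "uniformly_small_blocks M Y" "0 < e" "0 < \<eta>"
  obtains m0 where "m0 \<ge> 1" "\<And>m. m \<ge> m0 \<Longrightarrow> \<forall>\<^sub>F n in sequentially.
     \<exists>B\<in>sets M. measure M B \<le> \<eta> \<and> (\<forall>\<omega>\<in>space M - B. small_blocks (Y n \<omega>) m T e)"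
proof -
  have "\<exists>m0\<ge>1. \<forall>m\<ge>m0. \<forall>\<^sub>F n in sequentially.
     \<exists>B\<in>sets M. measure M B \<le> \<eta> \<and> (\<forall>\<omega>\<in>space M - B. small_blocks (Y n \<omega>) m T e)"
    by (rule assms(1)[unfolded uniformly_small_blocks_def, rule_format, OF assms(2,3)])
  then show ?thesis using that by (elim exE conjE) blast
qed

lemma cos_expectation_eq:
  assumes "prob_space M" and [measurable]: "h \<in> borel_measurable M"
  shows "(\<integral>\<omega>. cos (h \<omega> + \<theta>) \<partial>M) = Re (iexp \<theta> * (\<integral>\<omega>. iexp (h \<omega>) \<partial>M))"
proof -
  interpret prob_space M by fact
  have int: "integrable M (\<lambda>\<omega>. iexp (h \<omega>))"
    by (rule integrable_iexp) auto
  have "Re (iexp \<theta> * (\<integral>\<omega>. iexp (h \<omega>) \<partial>M)) = (\<integral>\<omega>. Re (iexp \<theta> * iexp (h \<omega>)) \<partial>M)"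
    using int by (subst integral_mult_right_zero[symmetric], subst integral_Re) auto
  also have "\<dots> = (\<integral>\<omega>. cos (h \<omega> + \<theta>) \<partial>M)"
    by (intro Bochner_Integration.integral_cong refl)
       (simp add: exp_add[symmetric] distrib_left[symmetric] Re_exp add.commute flip: of_real_add)
  finally show ?thesis by simp
qed

lemma uniformly_small_blocks_marginals:
  assumes M: "prob_space M"
    and tight: "uniformly_small_blocks M Y" and zero: "\<And>n \<omega>. \<omega> \<in> space M \<Longrightarrow> Y n \<omega> 0 = 0"
    and t: "0 \<le> t" and \<eta>: "0 < \<eta>"
  shows "\<exists>A. \<forall>\<^sub>F n in sequentially. measure M {\<omega> \<in> space M. norm (Y n \<omega> t) > A} \<le> \<eta>"
proof -
  interpret prob_space M by (rule M)
  obtain T where T: "t < real T" using reals_Archimedean2 by blast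
  obtain m where m: "m \<ge> 1" and ev: "\<forall>\<^sub>F n in sequentially.
      \<exists>B\<in>sets M. prob B \<le> \<eta> \<and> (\<forall>\<omega>\<in>space M - B. small_blocks (Y n \<omega>) m T 1)"
    by (rule uniformly_small_blocksE[OF tight zero_less_one \<eta>, of T]) (rule that, assumption, simp)
  show ?thesis
  proof (intro exI[of _ "real (m * T) + 1"])
    show "\<forall>\<^sub>F n in sequentially. prob {\<omega> \<in> space M. norm (Y n \<omega> t) > real (m * T) + 1} \<le> \<eta>"
      using ev
    proof eventually_elim
      case (elim n)
      then obtain B where B: "B \<in> sets M" "prob B \<le> \<eta>"
        "\<And>\<omega>. \<omega> \<in> space M - B \<Longrightarrow> small_blocks (Y n \<omega>) m T 1" by blast
      have "{\<omega> \<in> space M. norm (Y n \<omega> t) > real (m * T) + 1} \<subseteq> B"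
      proof
        fix \<omega> assume \<omega>: "\<omega> \<in> {\<omega> \<in> space M. norm (Y n \<omega> t) > real (m * T) + 1}"
        show "\<omega> \<in> B"
        proof (rule ccontr)
          assume "\<omega> \<notin> B"
          then have "norm (Y n \<omega> t) \<le> real (m * T) + 1"
            using \<omega> m by (intro small_blocks_bound[OF _ zero B(3) t T]) auto
          then show False using \<omega> by simp
        qed
      qed
      then have "prob {\<omega> \<in> space M. norm (Y n \<omega> t) > real (m * T) + 1} \<le> prob B"
        by (intro finite_measure_mono B)
      then show ?case using B by simp
    qed
  qed
qed

text \<open>
  Convergence of joint characteristic functions at rational times gives convergence of the expectations
  of functionals of the values on a finite grid.
\<close>

lemma rational_values_converge:
  fixes Y :: "nat \<Rightarrow> 'a \<Rightarrow> real \<Rightarrow> real^'d" and Z :: "'b \<Rightarrow> rat \<Rightarrow> real^'d"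
  assumes M: "prob_space M" and N: "prob_space N"
    and Y: "\<And>n t. 0 \<le> t \<Longrightarrow> (\<lambda>\<omega>. Y n \<omega> t) \<in> borel_measurable M"
    and Z: "\<And>q. (\<lambda>\<omega>. Z \<omega> q) \<in> borel_measurable N"
    and zero: "\<And>n \<omega>. \<omega> \<in> space M \<Longrightarrow> Y n \<omega> 0 = 0"
    and cf: "\<And>K c q. (\<lambda>n. \<integral>\<omega>. iexp (\<Sum>k<K. c k \<bullet> rational_values (Y n \<omega>) (q k)) \<partial>M)
      \<longlonglongrightarrow> (\<integral>\<omega>. iexp (\<Sum>k<K::nat. c k \<bullet> Z \<omega> (q k)) \<partial>N)"
    and tight: "uniformly_small_blocks M Y"
    and G: "finitely_lipschitz I B L G"
  shows "(\<lambda>n. \<integral>\<omega>. G (rational_values (Y n \<omega>)) \<partial>M) \<longlonglongrightarrow> (\<integral>\<omega>. G (Z \<omega>) \<partial>N)"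
proof (rule finite_dimensional_weak_convergence[OF M N _ Z _ _ G])
  show meas: "(\<lambda>\<omega>. rational_values (Y n \<omega>) q) \<in> borel_measurable M" for n q
    by (rule rational_values_measurable[OF Y])
  show "\<exists>A. \<forall>\<^sub>F n in sequentially. measure M {\<omega> \<in> space M. norm (rational_values (Y n \<omega>) q) > A} \<le> \<eta>"
    if "\<eta> > 0" for q \<eta>
    unfolding rational_values_def using that
    by (intro uniformly_small_blocks_marginals[OF M tight zero]) auto
  fix a :: "(rat \<Rightarrow> real^'d) \<Rightarrow> real" and \<theta> :: real
  assume a: "finite_functional a"
  then obtain J c where J: "finite J" "a = (\<lambda>x. \<Sum>q\<in>J. c q \<bullet> x q)" by (auto simp: finite_functional_def)
  obtain q where "bij_betw q {0..<card J} J" using ex_bij_betw_nat_finite[OF J(1)] by blast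
  then have a_eq: "a x = (\<Sum>k<card J. c (q k) \<bullet> x (q k))" for x
    unfolding J(2) by (subst sum.reindex_bij_betw[symmetric, of q "{0..<card J}" J]) (auto simp: lessThan_atLeast0)
  have "(\<lambda>n. Re (iexp \<theta> * (\<integral>\<omega>. iexp (a (rational_values (Y n \<omega>))) \<partial>M)))
      \<longlonglongrightarrow> Re (iexp \<theta> * (\<integral>\<omega>. iexp (a (Z \<omega>)) \<partial>N))"
    unfolding a_eq by (intro tendsto_Re tendsto_mult tendsto_const cf)
  then show "(\<lambda>n. \<integral>\<omega>. cos (a (rational_values (Y n \<omega>)) + \<theta>) \<partial>M) \<longlonglongrightarrow> (\<integral>\<omega>. cos (a (Z \<omega>) + \<theta>) \<partial>N)"
    by (simp add: cos_expectation_eq[OF M finite_functional_measurable[OF a meas]]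
        cos_expectation_eq[OF N finite_functional_measurable[OF a Z]])
qed

text \<open>
  For a Lipschitz functional, both the processes and their limit are replaced by grid interpolations: for the
  processes this costs little by tightness, uniformly in \<open>n\<close>, and for the limit by continuity of its
  paths. Between the interpolations the finite-dimensional convergence applies.
\<close>

theorem cpath_weak_convergence:
  fixes Y :: "nat \<Rightarrow> 'a \<Rightarrow> real \<Rightarrow> real^'d" and W :: "'b \<Rightarrow> real \<Rightarrow> real^'d"
  assumes M: "prob_space M" and N: "prob_space N"
    and Y_path: "\<And>n \<omega>. \<omega> \<in> space M \<Longrightarrow> Y n \<omega> \<in> cpaths" and W_path: "\<And>\<omega>. \<omega> \<in> space N \<Longrightarrow> W \<omega> \<in> cpaths"
    and Y: "\<And>n t. 0 \<le> t \<Longrightarrow> (\<lambda>\<omega>. Y n \<omega> t) \<in> borel_measurable M"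
    and W: "\<And>t. 0 \<le> t \<Longrightarrow> (\<lambda>\<omega>. W \<omega> t) \<in> borel_measurable N"
    and zero: "\<And>n \<omega>. \<omega> \<in> space M \<Longrightarrow> Y n \<omega> 0 = 0"
    and cf: "\<And>K c q. (\<lambda>n. \<integral>\<omega>. iexp (\<Sum>k<K. c k \<bullet> rational_values (Y n \<omega>) (q k)) \<partial>M)
      \<longlonglongrightarrow> (\<integral>\<omega>. iexp (\<Sum>k<K::nat. c k \<bullet> rational_values (W \<omega>) (q k)) \<partial>N)"
    and tight: "uniformly_small_blocks M Y"
  shows "tendsto_in_distribution cpath_topology M Y N W"
proof -
  interpret M: prob_space M by (rule M)
  interpret N: prob_space N by (rule N)
  interpret C: Metric_space "cpaths :: (real \<Rightarrow> real^'d) set" cpath_dist by (rule Metric_space_cpaths)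
  have Ym: "Y n \<in> M \<rightarrow>\<^sub>M borel_of_topology cpath_topology" for n by (rule measurable_cpathsI[OF Y_path Y])
  have Wm: "W \<in> N \<rightarrow>\<^sub>M borel_of_topology cpath_topology" by (rule measurable_cpathsI[OF W_path W])
  have lipschitz_case: "(\<lambda>n. \<integral>\<omega>. f (Y n \<omega>) \<partial>M) \<longlonglongrightarrow> (\<integral>\<omega>. f (W \<omega>) \<partial>N)"
    if fB: "\<And>x. x \<in> cpaths \<Longrightarrow> \<bar>f x\<bar> \<le> B" and L: "0 \<le> L"
      and lip: "\<And>x y. x \<in> cpaths \<Longrightarrow> y \<in> cpaths \<Longrightarrow> \<bar>f x - f y\<bar> \<le> L * cpath_dist x y"
    for f :: "(real \<Rightarrow> real^'d) \<Rightarrow> real" and B L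
  proof (rule tendstoI)
    fix e :: real assume e: "e > 0"
    have f_cont: "continuous_map cpath_topology euclideanreal f" by (rule C.lipschitz_continuous_map[OF L lip])
    have fm: "f \<in> borel_measurable (borel_of_topology cpath_topology)" by (rule topspace_measurable[OF f_cont])
    have fY[measurable]: "(\<lambda>\<omega>. f (Y n \<omega>)) \<in> borel_measurable M" for n by (rule measurable_compose[OF Ym fm])
    have fW[measurable]: "(\<lambda>\<omega>. f (W \<omega>)) \<in> borel_measurable N" by (rule measurable_compose[OF Wm fm])
    have FL: "finitely_lipschitz (grid_points m) B L (\<lambda>x. f (grid_path m x))" for m
      by (rule grid_functional_finitely_lipschitz[OF fB L lip])
    have gY[measurable]: "(\<lambda>\<omega>. f (grid_path m (rational_values (Y n \<omega>)))) \<in> borel_measurable M" for m n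
      by (rule finitely_lipschitz_measurable[OF FL]) (rule rational_values_measurable[OF Y])
    have gW[measurable]: "(\<lambda>\<omega>. f (grid_path m (rational_values (W \<omega>)))) \<in> borel_measurable N" for m
      by (rule finitely_lipschitz_measurable[OF FL]) (rule rational_values_measurable[OF W])
    \<comment> \<open>The single tolerance \<open>h\<close> serves as oscillation bound, exceptional probability and truncation error in time;
      the interpolation error of the processes is then at most \<open>4 L h\<close>.\<close>
    define h where "h = e / (32 * (L + 1))"
    have h: "h > 0" using e L by (simp add: h_def)
    have Lh: "8 * (L * h) \<le> e / 4"
    proof -
      have "L * h \<le> (L + 1) * h" using h by (intro mult_right_mono) auto
      also have "\<dots> = e / 32"
      proof -
        have "x * (e / (32 * x)) = e / 32" if "x > 0" for x :: real using that by simp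
        from this[of "L + 1"] show ?thesis using L by (simp add: h_def)
      qed
      finally show ?thesis by simp
    qed
    obtain T' where T': "(1/2::real)^T' < h" using real_arch_pow_inv[of h "1/2"] h by auto
    define T where "T = Suc T'"
    obtain m0 where m0: "\<And>m. m \<ge> m0 \<Longrightarrow> \<forall>\<^sub>F n in sequentially.
        \<exists>B\<in>sets M. M.prob B \<le> h \<and> (\<forall>\<omega>\<in>space M - B. small_blocks (Y n \<omega>) m T h)"
      by (rule uniformly_small_blocksE[OF tight h h, of T]) (rule that)
    have "(\<lambda>m. \<integral>\<omega>. f (grid_path m (rational_values (W \<omega>))) \<partial>N) \<longlonglongrightarrow> (\<integral>\<omega>. f (W \<omega>) \<partial>N)"
    proof (rule integral_dominated_convergence[where w = "\<lambda>_. B"])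
      show "AE \<omega> in N. (\<lambda>m. f (grid_path m (rational_values (W \<omega>)))) \<longlonglongrightarrow> f (W \<omega>)"
        using grid_functional_tendsto[OF W_path lip] by (intro AE_I2) blast
      show "AE \<omega> in N. norm (f (grid_path m (rational_values (W \<omega>)))) \<le> B" for m
        using fB[OF grid_path_in_cpaths] by simp
    qed auto
    then have "\<forall>\<^sub>F m in sequentially. dist (\<integral>\<omega>. f (grid_path m (rational_values (W \<omega>))) \<partial>N) (\<integral>\<omega>. f (W \<omega>) \<partial>N) < e / 4"
      using e by (intro tendstoD) auto
    then have "\<forall>\<^sub>F m in sequentially. m \<ge> m0 \<and> m \<ge> T \<and> m \<ge> 1 \<and>
        dist (\<integral>\<omega>. f (grid_path m (rational_values (W \<omega>))) \<partial>N) (\<integral>\<omega>. f (W \<omega>) \<partial>N) < e / 4"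
      by (intro eventually_conj eventually_ge_at_top)
    then obtain m where m: "m \<ge> m0" "m \<ge> T" "m \<ge> 1"
      and W_close: "dist (\<integral>\<omega>. f (grid_path m (rational_values (W \<omega>))) \<partial>N) (\<integral>\<omega>. f (W \<omega>) \<partial>N) < e / 4"
      by (auto simp: eventually_sequentially)
    have "(\<lambda>n. \<integral>\<omega>. f (grid_path m (rational_values (Y n \<omega>))) \<partial>M) \<longlonglongrightarrow> (\<integral>\<omega>. f (grid_path m (rational_values (W \<omega>))) \<partial>N)"
      by (rule rational_values_converge[OF M N Y rational_values_measurable[OF W] zero cf tight FL])
    then have "\<forall>\<^sub>F n in sequentially. dist (\<integral>\<omega>. f (grid_path m (rational_values (Y n \<omega>))) \<partial>M)
        (\<integral>\<omega>. f (grid_path m (rational_values (W \<omega>))) \<partial>N) < e / 4"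
      using e by (intro tendstoD) auto
    then show "\<forall>\<^sub>F n in sequentially. dist (\<integral>\<omega>. f (Y n \<omega>) \<partial>M) (\<integral>\<omega>. f (W \<omega>) \<partial>N) < e"
      using m0[OF m(1)]
    proof eventually_elim
      case (elim n)
      then obtain Bad where Bad: "Bad \<in> sets M" "M.prob Bad \<le> h"
        "\<And>\<omega>. \<omega> \<in> space M - Bad \<Longrightarrow> small_blocks (Y n \<omega>) m T h" by blast
      have intY: "integrable M (\<lambda>\<omega>. f (Y n \<omega>))"
        using fB[OF Y_path] by (intro M.integrable_const_bound[of _ B]) auto
      have intg: "integrable M (\<lambda>\<omega>. f (grid_path m (rational_values (Y n \<omega>))))"
        using fB[OF grid_path_in_cpaths] by (intro M.integrable_const_bound[of _ B]) auto
      have "\<bar>(\<integral>\<omega>. f (grid_path m (rational_values (Y n \<omega>))) \<partial>M) - (\<integral>\<omega>. f (Y n \<omega>) \<partial>M)\<bar>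
          = \<bar>\<integral>\<omega>. f (grid_path m (rational_values (Y n \<omega>))) - f (Y n \<omega>) \<partial>M\<bar>"
        using intY intg by simp
      also have "\<dots> \<le> (\<integral>\<omega>. \<bar>f (grid_path m (rational_values (Y n \<omega>))) - f (Y n \<omega>)\<bar> \<partial>M)"
        by (rule integral_abs_bound)
      also have "\<dots> \<le> (\<integral>\<omega>. L * (3 * h) + L * indicator Bad \<omega> \<partial>M)"
      proof (rule integral_mono)
        show "integrable M (\<lambda>\<omega>. \<bar>f (grid_path m (rational_values (Y n \<omega>))) - f (Y n \<omega>)\<bar>)"
          using intY intg by simp
        show "integrable M (\<lambda>\<omega>. L * (3 * h) + L * indicator Bad \<omega>)"
          using Bad(1) by (auto simp: M.emeasure_eq_measure)
        fix \<omega> assume \<omega>: "\<omega> \<in> space M"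
        have 1: "\<bar>f (grid_path m (rational_values (Y n \<omega>))) - f (Y n \<omega>)\<bar>
            \<le> L * cpath_dist (grid_path m (rational_values (Y n \<omega>))) (Y n \<omega>)"
          by (rule lip[OF grid_path_in_cpaths Y_path[OF \<omega>]])
        show "\<bar>f (grid_path m (rational_values (Y n \<omega>))) - f (Y n \<omega>)\<bar> \<le> L * (3 * h) + L * indicator Bad \<omega>"
        proof (cases "\<omega> \<in> Bad")
          case True
          have "L * cpath_dist (grid_path m (rational_values (Y n \<omega>))) (Y n \<omega>) \<le> L * 1"
            by (intro mult_left_mono cpath_dist_le_1 L)
          moreover have "0 \<le> L * (3 * h)" using L h by simp
          ultimately show ?thesis using 1 True by simp
        next
          case False
          have "cpath_dist (grid_path m (rational_values (Y n \<omega>))) (Y n \<omega>) \<le> 2 * h + (1/2)^(T - 1)"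
            using Bad(3) False \<omega> m h by (intro grid_path_close) auto
          also have "\<dots> \<le> 3 * h" using T' by (simp add: T_def)
          finally have "L * cpath_dist (grid_path m (rational_values (Y n \<omega>))) (Y n \<omega>) \<le> L * (3 * h)"
            using L by (rule mult_left_mono)
          then show ?thesis using 1 False by simp
        qed
      qed
      also have "\<dots> = L * (3 * h) + L * M.prob Bad"
        using Bad(1) by (simp add: M.emeasure_eq_measure M.prob_space)
      also have "\<dots> \<le> L * (3 * h) + L * h" using Bad(2) L by (intro add_left_mono mult_left_mono)
      also have "\<dots> \<le> e / 4" using Lh L h mult_nonneg_nonneg[of L h] by linarith
      finally show ?case using elim(1) W_close e unfolding dist_real_def by linarith
    qed
  qed
  show ?thesis
    unfolding tendsto_in_distribution_def
  proof (intro conjI allI impI)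
    fix \<phi> :: "(real \<Rightarrow> real^'d) \<Rightarrow> real"
    assume \<phi>: "continuous_map cpath_topology euclideanreal \<phi> \<and> bounded (\<phi> ` topspace cpath_topology)"
    show "(\<lambda>n. \<integral>\<omega>. \<phi> (Y n \<omega>) \<partial>M) \<longlonglongrightarrow> (\<integral>\<omega>. \<phi> (W \<omega>) \<partial>N)"
      using \<phi> by (intro C.weak_convergence_from_lipschitz[OF M N Ym Wm lipschitz_case]) auto
  qed (rule Ym Wm)+
qed

section \<open>Continuous modification of a limit process\<close>

definition rational_block :: "nat \<Rightarrow> nat \<Rightarrow> rat \<Rightarrow> bool" where
  "rational_block m k q \<longleftrightarrow> of_nat k / of_nat m \<le> q \<and> q \<le> of_nat (Suc k) / of_nat m"

definition rational_small_blocks :: "(rat \<Rightarrow> real^'d) \<Rightarrow> nat \<Rightarrow> nat \<Rightarrow> real \<Rightarrow> bool" where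
  "rational_small_blocks z m T e \<longleftrightarrow>
     (\<forall>k<m * T. \<forall>q. rational_block m k q \<longrightarrow> norm (z q - z (of_nat k / of_nat m)) \<le> e)"

definition locally_uniformly_continuous :: "(rat \<Rightarrow> real^'d) \<Rightarrow> bool" where
  "locally_uniformly_continuous z \<longleftrightarrow>
     (\<forall>T r. \<exists>m\<ge>1. rational_small_blocks z m T (1 / real (Suc r)))"

lemma rational_block_of_rat:
  assumes "rational_block m k q"
  shows "real k / real m \<le> real_of_rat q" "real_of_rat q \<le> real (Suc k) / real m"
proof -
  have "real_of_rat (of_nat k / of_nat m) \<le> real_of_rat q"
    using assms unfolding rational_block_def of_rat_less_eq by blast
  then show "real k / real m \<le> real_of_rat q" by (simp add: of_rat_divide)
  have "real_of_rat q \<le> real_of_rat (of_nat (Suc k) / of_nat m)"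
    using assms unfolding rational_block_def of_rat_less_eq by blast
  then show "real_of_rat q \<le> real (Suc k) / real m" by (simp only: of_rat_divide of_rat_of_nat_eq)
qed

lemma small_blocks_rational_values:
  assumes "small_blocks f m T e"
  shows "rational_small_blocks (rational_values f) m T e"
  unfolding rational_small_blocks_def
proof (intro allI impI)
  fix k q assume k: "k < m * T" and q: "rational_block m k q"
  note b = rational_block_of_rat[OF q]
  have "0 \<le> real k / real m" by simp
  then have "0 \<le> real_of_rat q" using b by linarith
  then have "rational_values f q = f (real_of_rat q)" by (simp add: rational_values_def max_absorb2)
  moreover have "rational_values f (of_nat k / of_nat m) = f (real k / real m)"
    by (simp add: rational_values_def of_rat_divide)
  moreover have "norm (f (real_of_rat q) - f (real k / real m)) \<le> e"
    using assms k b unfolding small_blocks_def by blast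
  ultimately show "norm (rational_values f q - rational_values f (of_nat k / of_nat m)) \<le> e" by simp
qed

text \<open>
  Two points at distance at most \<open>1 / m\<close> lie in the same or in adjacent blocks; in the second case the path from
  one to the other passes two grid points, which gives three increments.
\<close>

lemma rational_small_blocks_modulus:
  assumes m: "1 \<le> m" and small: "rational_small_blocks z m T e"
    and p: "0 \<le> p" "p < of_nat T" and q: "0 \<le> q" "q < of_nat T" and pq: "\<bar>p - q\<bar> \<le> 1 / of_nat m"
  shows "norm (z p - z q) \<le> 3 * e"
  using p q pq
proof (induction p q rule: linorder_wlog)
  case (sym p q)
  then show ?case by (simp add: norm_minus_commute abs_minus_commute)
next
  case (le p q)
  define k where "k = nat \<lfloor>of_nat m * p\<rfloor>"
  have kf: "of_nat k \<le> of_nat m * p" "of_nat m * p < of_nat k + 1"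
    using le(2) floor_correct[of "of_nat m * p"] unfolding k_def by (auto simp: of_nat_nat)
  have m0: "0 < (of_nat m :: rat)" using m by simp
  have block_p: "rational_block m k p"
    using kf m0 by (auto simp: rational_block_def field_simps)
  have "of_nat k < (of_nat m * of_nat T :: rat)"
    using kf(1) le(3) m0 by (intro order.strict_trans1[OF kf(1)]) simp
  then have "(of_nat k :: rat) < of_nat (m * T)" by simp
  then have kT: "k < m * T" by (simp only: of_nat_less_iff)
  have zp: "norm (z p - z (of_nat k / of_nat m)) \<le> e"
    using small kT block_p unfolding rational_small_blocks_def by blast
  have e: "0 \<le> e" using zp norm_ge_zero order_trans by blast
  show ?case
  proof (cases "q \<le> of_nat (Suc k) / of_nat m")
    case True
    have "rational_block m k q"
      using True block_p le(1) by (auto simp: rational_block_def)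
    then have "norm (z q - z (of_nat k / of_nat m)) \<le> e"
      using small kT unfolding rational_small_blocks_def by blast
    then have "norm (z p - z q) \<le> e + e"
      by (intro norm_diff_triangle_le[OF zp]) (simp add: norm_minus_commute)
    then show ?thesis using e by simp
  next
    case False
    have "q \<le> p + 1 / of_nat m" using le(6) le(1) by simp
    also have "\<dots> \<le> of_nat (Suc k) / of_nat m + 1 / of_nat m"
      using block_p by (simp add: rational_block_def)
    finally have "rational_block m (Suc k) q"
      using False by (simp add: rational_block_def add_divide_distrib)
    moreover have "Suc k < m * T"
    proof -
      have "(of_nat (Suc k) :: rat) < of_nat m * q" using False m0 by (simp add: field_simps)
      also have "\<dots> < of_nat m * of_nat T" using le(5) m0 by simp
      finally have "(of_nat (Suc k) :: rat) < of_nat (m * T)" by simp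
      then show ?thesis by (simp only: of_nat_less_iff)
    qed
    ultimately have zq: "norm (z q - z (of_nat (Suc k) / of_nat m)) \<le> e"
      using small unfolding rational_small_blocks_def by blast
    have "rational_block m k (of_nat (Suc k) / of_nat m)"
      using m0 by (simp add: rational_block_def divide_right_mono)
    then have mid: "norm (z (of_nat (Suc k) / of_nat m) - z (of_nat k / of_nat m)) \<le> e"
      using small kT unfolding rational_small_blocks_def by blast
    have "norm (z p - z (of_nat (Suc k) / of_nat m)) \<le> e + e"
      by (rule norm_diff_triangle_le[OF zp]) (use mid in \<open>simp only: norm_minus_commute\<close>)
    then have "norm (z p - z q) \<le> (e + e) + e"
      by (rule norm_diff_triangle_le) (use zq in \<open>simp only: norm_minus_commute\<close>)
    then show ?thesis by simp
  qed
qed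

definition rational_below :: "nat \<Rightarrow> real \<Rightarrow> rat" where
  "rational_below k t = of_int \<lfloor>real (Suc k) * t\<rfloor> / of_nat (Suc k)"

lemma rational_below_bounds:
  assumes "0 \<le> t"
  shows "0 \<le> rational_below k t" "real_of_rat (rational_below k t) \<le> t"
    "t - 1 / real (Suc k) < real_of_rat (rational_below k t)"
proof -
  let ?f = "\<lfloor>real (Suc k) * t\<rfloor>"
  have f: "0 \<le> ?f" using assms by simp
  then show "0 \<le> rational_below k t"
    unfolding rational_below_def by (intro divide_nonneg_nonneg) (simp_all only: of_int_0_le_iff of_nat_0_le_iff)
  have r: "real_of_rat (rational_below k t) = real_of_int ?f / real (Suc k)"
    unfolding rational_below_def by (simp only: of_rat_divide of_rat_of_int_eq of_rat_of_nat_eq)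
  have "real_of_int ?f \<le> real (Suc k) * t" by (rule of_int_floor_le)
  then show "real_of_rat (rational_below k t) \<le> t" unfolding r by (simp add: divide_le_eq mult.commute)
  have "real (Suc k) * t < real_of_int ?f + 1" by linarith
  then show "t - 1 / real (Suc k) < real_of_rat (rational_below k t)"
  proof -
    have "t - 1 / x < f / x" if "x > 0" "x * t < f + 1" for x f :: real
    proof -
      have "(x * t - 1) / x < f / x" using that by (intro divide_strict_right_mono) auto
      then show ?thesis using that by (simp add: diff_divide_distrib)
    qed
    then show ?thesis unfolding r using \<open>real (Suc k) * t < real_of_int ?f + 1\<close> by simp
  qed
qed

lemma rational_below_tendsto:
  assumes "0 \<le> t"
  shows "(\<lambda>k. real_of_rat (rational_below k t)) \<longlonglongrightarrow> t"
proof (rule tendsto_sandwich)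
  show "(\<lambda>k. t - 1 / real (Suc k)) \<longlonglongrightarrow> t"
    using LIMSEQ_Suc[OF lim_1_over_n] tendsto_diff[OF tendsto_const] by fastforce
  show "\<forall>\<^sub>F k in sequentially. t - 1 / real (Suc k) \<le> real_of_rat (rational_below k t)"
    using rational_below_bounds(3)[OF assms] less_imp_le by (intro always_eventually) blast
  show "\<forall>\<^sub>F k in sequentially. real_of_rat (rational_below k t) \<le> t"
    using rational_below_bounds(2)[OF assms] by (intro always_eventually) blast
qed simp

text \<open>
  Values at real times are limits along rational times from below. Exceptional paths are set to zero, so that every
  path of the extension is continuous.
\<close>

definition path_extension :: "(rat \<Rightarrow> real^'d) \<Rightarrow> real \<Rightarrow> real^'d" where
  "path_extension z = (\<lambda>t\<in>{0..}. if locally_uniformly_continuous z then lim (\<lambda>k. z (rational_below k t)) else 0)"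

lemma locally_uniformly_continuous_modulus:
  assumes z: "locally_uniformly_continuous z" and e: "0 < e"
  shows "\<exists>\<delta>>0. \<forall>p q. 0 \<le> p \<longrightarrow> 0 \<le> q \<longrightarrow> real_of_rat p < real T \<longrightarrow> real_of_rat q < real T \<longrightarrow>
    \<bar>real_of_rat p - real_of_rat q\<bar> < \<delta> \<longrightarrow> norm (z p - z q) \<le> e"
proof -
  obtain r where r: "1 / real (Suc r) < e / 3" using nat_approx_posE[of "e / 3"] e by auto
  obtain m where m: "m \<ge> 1" "rational_small_blocks z m T (1 / real (Suc r))"
    using z unfolding locally_uniformly_continuous_def by blast
  show ?thesis
  proof (intro exI[of _ "1 / real m"] conjI allI impI)
    show "0 < 1 / real m" using m by simp
    fix p q assume *: "0 \<le> p" "0 \<le> q" "real_of_rat p < real T" "real_of_rat q < real T"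
      "\<bar>real_of_rat p - real_of_rat q\<bar> < 1 / real m"
    have T: "p < of_nat T" "q < of_nat T"
      using *(3,4) by (metis of_rat_less of_rat_of_nat_eq)+
    have "real_of_rat \<bar>p - q\<bar> < real_of_rat (1 / of_nat m)"
      using *(5) by (simp only: abs_of_rat[symmetric] of_rat_diff of_rat_divide of_rat_1 of_rat_of_nat_eq)
    then have "\<bar>p - q\<bar> \<le> 1 / of_nat m" by (simp only: of_rat_less less_imp_le)
    then have "norm (z p - z q) \<le> 3 * (1 / real (Suc r))"
      using * T m by (intro rational_small_blocks_modulus[of m z T]) auto
    then show "norm (z p - z q) \<le> e" using r by simp
  qed
qed

lemma path_extension_converges:
  assumes z: "locally_uniformly_continuous z" and t: "0 \<le> t"
  shows "(\<lambda>k. z (rational_below k t)) \<longlonglongrightarrow> path_extension z t"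
proof -
  obtain T where T: "t < real T" using reals_Archimedean2 by blast
  have "Cauchy (\<lambda>k. z (rational_below k t))"
  proof (rule metric_CauchyI)
    fix e :: real assume e: "0 < e"
    obtain \<delta> where \<delta>: "\<delta> > 0" "\<And>p q. 0 \<le> p \<Longrightarrow> 0 \<le> q \<Longrightarrow> real_of_rat p < real T \<Longrightarrow> real_of_rat q < real T \<Longrightarrow>
      \<bar>real_of_rat p - real_of_rat q\<bar> < \<delta> \<Longrightarrow> norm (z p - z q) \<le> e / 2"
      using locally_uniformly_continuous_modulus[OF z, of "e / 2" T] e by (metis half_gt_zero)
    obtain k0 where k0: "\<And>k l. k \<ge> k0 \<Longrightarrow> l \<ge> k0 \<Longrightarrow>
        dist (real_of_rat (rational_below k t)) (real_of_rat (rational_below l t)) < \<delta>"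
      using LIMSEQ_imp_Cauchy[OF rational_below_tendsto[OF t]] \<delta>(1) unfolding Cauchy_def by metis
    show "\<exists>k0. \<forall>k\<ge>k0. \<forall>l\<ge>k0. dist (z (rational_below k t)) (z (rational_below l t)) < e"
    proof (intro exI allI impI)
      fix k l assume kl: "k0 \<le> k" "k0 \<le> l"
      have "norm (z (rational_below k t) - z (rational_below l t)) \<le> e / 2"
        using rational_below_bounds[OF t] T k0[OF kl]
        by (intro \<delta>(2)) (auto simp: dist_real_def intro: le_less_trans)
      then show "dist (z (rational_below k t)) (z (rational_below l t)) < e"
        using e by (simp add: dist_norm)
    qed
  qed
  then have "convergent (\<lambda>k. z (rational_below k t))" by (rule Cauchy_convergent)
  then show ?thesis using z t by (simp add: path_extension_def convergent_LIMSEQ_iff)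
qed

lemma path_extension_in_cpaths: "path_extension z \<in> cpaths"
proof (cases "locally_uniformly_continuous z")
  case z: True
  have "continuous_on {0..} (path_extension z)"
    unfolding continuous_on_iff
  proof (intro ballI allI impI)
    fix t e :: real assume "t \<in> {0..}" and e: "0 < e"
    then have t: "0 \<le> t" by simp
    obtain T where T: "t + 1 < real T" using reals_Archimedean2 by blast
    obtain \<delta> where \<delta>: "\<delta> > 0" "\<And>p q. 0 \<le> p \<Longrightarrow> 0 \<le> q \<Longrightarrow> real_of_rat p < real T \<Longrightarrow> real_of_rat q < real T \<Longrightarrow>
      \<bar>real_of_rat p - real_of_rat q\<bar> < \<delta> \<Longrightarrow> norm (z p - z q) \<le> e / 2"
      using locally_uniformly_continuous_modulus[OF z, of "e / 2" T] e by (metis half_gt_zero)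
    show "\<exists>d>0. \<forall>s\<in>{0..}. dist s t < d \<longrightarrow> dist (path_extension z s) (path_extension z t) < e"
    proof (intro exI[of _ "min 1 \<delta>"] conjI ballI impI)
      show "0 < min 1 \<delta>" using \<delta> by simp
      fix s assume s: "s \<in> {0..}" "dist s t < min 1 \<delta>"
      then have s0: "0 \<le> s" and sT: "s < real T" using T by (auto simp: dist_real_def)
      have "(\<lambda>k. \<bar>real_of_rat (rational_below k s) - real_of_rat (rational_below k t)\<bar>) \<longlonglongrightarrow> \<bar>s - t\<bar>"
        by (intro tendsto_intros rational_below_tendsto s0 t)
      then have "\<forall>\<^sub>F k in sequentially. \<bar>real_of_rat (rational_below k s) - real_of_rat (rational_below k t)\<bar> < \<delta>"
        using s(2) by (intro order_tendstoD) (auto simp: dist_real_def)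
      then have "\<forall>\<^sub>F k in sequentially. norm (z (rational_below k s) - z (rational_below k t)) \<le> e / 2"
      proof eventually_elim
        case (elim k)
        then show ?case
          using rational_below_bounds[OF t, of k] rational_below_bounds[OF s0, of k] T sT by (intro \<delta>(2)) auto
      qed
      moreover have "(\<lambda>k. norm (z (rational_below k s) - z (rational_below k t)))
          \<longlonglongrightarrow> norm (path_extension z s - path_extension z t)"
        by (intro tendsto_intros path_extension_converges z s0 t)
      ultimately have "norm (path_extension z s - path_extension z t) \<le> e / 2"
        by (intro tendsto_upperbound) auto
      then show "dist (path_extension z s) (path_extension z t) < e" using e by (simp add: dist_norm)
    qed
  qed
  then show ?thesis by (simp add: cpaths_def path_extension_def)
next
  case False
  have "continuous_on {0..} (path_extension z)"
    by (rule continuous_on_eq[of _ "\<lambda>_. 0"]) (auto simp: path_extension_def False)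
  then show ?thesis by (simp add: cpaths_def path_extension_def)
qed

lemma path_extension_measurable:
  assumes [measurable]: "\<And>q. (\<lambda>\<omega>. Z \<omega> q) \<in> borel_measurable N" and t: "0 \<le> t"
  shows "{\<omega> \<in> space N. locally_uniformly_continuous (Z \<omega>)} \<in> sets N"
    and "(\<lambda>\<omega>. path_extension (Z \<omega>) t) \<in> borel_measurable N"
proof -
  show S[measurable]: "{\<omega> \<in> space N. locally_uniformly_continuous (Z \<omega>)} \<in> sets N"
    unfolding locally_uniformly_continuous_def rational_small_blocks_def by measurable
  have [measurable]: "Measurable.pred N (\<lambda>\<omega>. locally_uniformly_continuous (Z \<omega>))"
    using S by (simp add: pred_def)
  have [measurable]: "(\<lambda>\<omega>. lim (\<lambda>k. Z \<omega> (rational_below k t))) \<in> borel_measurable N"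
    by (rule borel_measurable_lim_metric) (rule assms(1))
  have "(\<lambda>\<omega>. if locally_uniformly_continuous (Z \<omega>) then lim (\<lambda>k. Z \<omega> (rational_below k t)) else 0)
      \<in> borel_measurable N"
    by measurable
  then show "(\<lambda>\<omega>. path_extension (Z \<omega>) t) \<in> borel_measurable N"
    using t by (simp add: path_extension_def)
qed

text \<open>
  A Lipschitz functional of finitely many values that vanishes if the blocks are small with bound
  \<open>e / 2\<close> and is one if the bound \<open>e\<close> is violated at a point of \<open>D\<close>.
\<close>

definition block_excess :: "rat set \<Rightarrow> nat \<Rightarrow> nat \<Rightarrow> real \<Rightarrow> (rat \<Rightarrow> real^'d) \<Rightarrow> real" where
  "block_excess D m T e x = min 1 (\<Sum>q\<in>D. \<Sum>k<m * T. if rational_block m k q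
     then max 0 (norm (x q - x (of_nat k / of_nat m)) - e / 2) * (2 / e) else 0)"

lemma block_excess_bounds: "0 < e \<Longrightarrow> 0 \<le> block_excess D m T e x" "block_excess D m T e x \<le> 1"
  by (auto simp: block_excess_def intro!: sum_nonneg)

lemma block_excess_0:
  assumes "rational_small_blocks x m T (e / 2)"
  shows "block_excess D m T e x = 0"
proof -
  have "(\<Sum>q\<in>D. \<Sum>k<m * T. if rational_block m k q
     then max 0 (norm (x q - x (of_nat k / of_nat m)) - e / 2) * (2 / e) else 0) = 0"
  proof (intro sum.neutral ballI)
    fix q k assume "k \<in> {..<m * T}"
    then have "norm (x q - x (of_nat k / of_nat m)) \<le> e / 2" if "rational_block m k q"
      using assms that unfolding rational_small_blocks_def by blast
    then show "(if rational_block m k q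
       then max 0 (norm (x q - x (of_nat k / of_nat m)) - e / 2) * (2 / e) else 0) = 0" by simp
  qed
  then show ?thesis by (simp add: block_excess_def)
qed

lemma block_excess_1:
  assumes D: "finite D" "q \<in> D" and k: "k < m * T" "rational_block m k q" and e: "0 < e"
    and big: "e < norm (x q - x (of_nat k / of_nat m))"
  shows "block_excess D m T e x = 1"
proof -
  let ?s = "\<lambda>q k. if rational_block m k q
     then max 0 (norm (x q - x (of_nat k / of_nat m)) - e / 2) * (2 / e) else 0"
  have s0: "0 \<le> ?s q k" for q k using e by auto
  have "1 \<le> ?s q k" using k(2) e big by (simp add: field_simps)
  also have "\<dots> \<le> (\<Sum>k<m * T. ?s q k)"
    by (rule member_le_sum) (use k s0 in auto)
  also have "\<dots> \<le> (\<Sum>q\<in>D. \<Sum>k<m * T. ?s q k)"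
    by (rule member_le_sum) (use D s0 in \<open>auto intro!: sum_nonneg\<close>)
  finally show ?thesis by (simp add: block_excess_def)
qed

lemma block_excess_finitely_lipschitz:
  assumes D: "finite D" and e: "0 < e"
  shows "\<exists>I L. finitely_lipschitz I 1 L (block_excess D m T e :: (rat \<Rightarrow> real^'d) \<Rightarrow> real)"
proof -
  define I where "I = D \<union> (\<lambda>k. of_nat k / of_nat m) ` {..<m * T}"
  define L where "L = real (card D) * (real (m * T) * (4 / e))"
  have I: "finite I" using D by (simp add: I_def)
  let ?s = "\<lambda>x q k. if rational_block m k q
     then max 0 (norm (x q - x (of_nat k / of_nat m)) - e / 2) * (2 / e) else 0"
  have lip: "\<bar>block_excess D m T e x - block_excess D m T e y\<bar> \<le> L * (\<Sum>i\<in>I. norm (x i - y i))"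
    for x y :: "rat \<Rightarrow> real^'d"
  proof -
    let ?\<Sigma> = "\<Sum>i\<in>I. norm (x i - y i)"
    have summand: "\<bar>?s x q k - ?s y q k\<bar> \<le> 4 / e * ?\<Sigma>" if q: "q \<in> D" and k: "k < m * T" for q k
    proof -
      let ?g = "of_nat k / of_nat m :: rat"
      have i: "norm (x i - y i) \<le> ?\<Sigma>" if "i \<in> I" for i
        by (rule member_le_sum[OF that, of "\<lambda>i. norm (x i - y i)"]) (use I in auto)
      have "\<bar>max 0 (norm (x q - x ?g) - e / 2) - max 0 (norm (y q - y ?g) - e / 2)\<bar>
          \<le> \<bar>norm (x q - x ?g) - norm (y q - y ?g)\<bar>" by linarith
      also have "\<dots> \<le> norm ((x q - x ?g) - (y q - y ?g))" by (rule norm_triangle_ineq3)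
      also have "(x q - x ?g) - (y q - y ?g) = (x q - y q) - (x ?g - y ?g)" by simp
      also have "norm \<dots> \<le> norm (x q - y q) + norm (x ?g - y ?g)" by (rule norm_triangle_ineq4)
      also have "\<dots> \<le> ?\<Sigma> + ?\<Sigma>" using q k by (intro add_mono i) (auto simp: I_def)
      finally have *: "\<bar>max 0 (norm (x q - x ?g) - e / 2) - max 0 (norm (y q - y ?g) - e / 2)\<bar> \<le> 2 * ?\<Sigma>" by simp
      have "\<bar>?s x q k - ?s y q k\<bar>
          \<le> \<bar>max 0 (norm (x q - x ?g) - e / 2) - max 0 (norm (y q - y ?g) - e / 2)\<bar> * (2 / e)"
      proof -
        have "\<bar>(if b then u * c else 0) - (if b then v * c else 0)\<bar> \<le> \<bar>u - v\<bar> * c"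
          if "0 < c" for b and u v c :: real
          using that by (cases b) (simp_all add: abs_mult_pos left_diff_distrib)
        note bound = this
        show ?thesis by (rule bound) (use e in simp)
      qed
      also have "\<dots> \<le> 2 * ?\<Sigma> * (2 / e)" using * e by (intro mult_right_mono) auto
      finally show ?thesis by simp
    qed
    have "\<bar>block_excess D m T e x - block_excess D m T e y\<bar>
        \<le> \<bar>(\<Sum>q\<in>D. \<Sum>k<m * T. ?s x q k) - (\<Sum>q\<in>D. \<Sum>k<m * T. ?s y q k)\<bar>"
      unfolding block_excess_def by linarith
    also have "\<dots> = \<bar>\<Sum>q\<in>D. \<Sum>k<m * T. ?s x q k - ?s y q k\<bar>" by (simp only: sum_subtractf)
    also have "\<dots> \<le> (\<Sum>q\<in>D. \<Sum>k<m * T. 4 / e * ?\<Sigma>)"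
      by (intro order_trans[OF sum_abs] sum_mono summand) auto
    also have "\<dots> = L * ?\<Sigma>" by (simp add: L_def)
    finally show ?thesis .
  qed
  have "\<bar>block_excess D m T e x\<bar> \<le> 1" for x :: "rat \<Rightarrow> real^'d"
    using block_excess_bounds(1)[OF e, of D m T x] block_excess_bounds(2)[of D m T e x] by linarith
  then have "finitely_lipschitz I 1 L (block_excess D m T e :: (rat \<Rightarrow> real^'d) \<Rightarrow> real)"
    unfolding finitely_lipschitz_def using I lip e by (simp add: L_def)
  then show ?thesis by blast
qed

text \<open>
  The modulus of continuity of the approximating processes passes to the limit: first to finite sets
  of rational times by convergence of the finite-dimensional distributions, then to all rational times
  by monotone continuity of the measure.
\<close>

lemma limit_locally_uniformly_continuous:
  fixes Y :: "nat \<Rightarrow> 'a \<Rightarrow> real \<Rightarrow> real^'d" and Z :: "'b \<Rightarrow> rat \<Rightarrow> real^'d"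
  assumes M: "prob_space M" and N: "prob_space N"
    and Y: "\<And>n t. 0 \<le> t \<Longrightarrow> (\<lambda>\<omega>. Y n \<omega> t) \<in> borel_measurable M"
    and Z: "\<And>q. (\<lambda>\<omega>. Z \<omega> q) \<in> borel_measurable N"
    and zero: "\<And>n \<omega>. \<omega> \<in> space M \<Longrightarrow> Y n \<omega> 0 = 0"
    and cf: "\<And>K c q. (\<lambda>n. \<integral>\<omega>. iexp (\<Sum>k<K. c k \<bullet> rational_values (Y n \<omega>) (q k)) \<partial>M)
      \<longlonglongrightarrow> (\<integral>\<omega>. iexp (\<Sum>k<K::nat. c k \<bullet> Z \<omega> (q k)) \<partial>N)"
    and tight: "uniformly_small_blocks M Y"
  shows "AE \<omega> in N. locally_uniformly_continuous (Z \<omega>)"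
proof -
  interpret M: prob_space M by (rule M)
  interpret N: prob_space N by (rule N)
  note [measurable] = Z
  have small: "\<exists>m\<ge>1. N.prob {\<omega> \<in> space N. \<not> rational_small_blocks (Z \<omega>) m T e} \<le> \<eta>"
    if e: "0 < e" and \<eta>: "0 < \<eta>" for T e \<eta>
  proof -
    have e2: "0 < e / 2" using e by simp
    obtain m where m: "m \<ge> 1" and ev: "\<forall>\<^sub>F n in sequentially.
        \<exists>B\<in>sets M. M.prob B \<le> \<eta> \<and> (\<forall>\<omega>\<in>space M - B. small_blocks (Y n \<omega>) m T (e / 2))"
      by (rule uniformly_small_blocksE[OF tight e2 \<eta>, of T]) (rule that, assumption, simp)
    define A where "A = (\<lambda>q. {\<omega> \<in> space N. \<exists>k<m * T. rational_block m k q \<and>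
        e < norm (Z \<omega> q - Z \<omega> (of_nat k / of_nat m))})"
    have A[measurable]: "A q \<in> sets N" for q unfolding A_def by measurable
    have finite_bound: "N.prob (\<Union>q\<in>D. A q) \<le> \<eta>" if D: "finite D" for D
    proof -
      obtain I L where FL: "finitely_lipschitz I 1 L (block_excess D m T e :: (rat \<Rightarrow> real^'d) \<Rightarrow> real)"
        using block_excess_finitely_lipschitz[OF D e] by blast
      have int: "integrable N (\<lambda>\<omega>. block_excess D m T e (Z \<omega>))"
        by (rule N.integrable_finitely_lipschitz[OF FL Z])
      have U: "(\<Union>q\<in>D. A q) \<in> sets N" using D by auto
      have "N.prob (\<Union>q\<in>D. A q) = (\<integral>\<omega>. indicator (\<Union>q\<in>D. A q) \<omega> \<partial>N)" using U by simp
      also have "\<dots> \<le> (\<integral>\<omega>. block_excess D m T e (Z \<omega>) \<partial>N)"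
      proof (rule integral_mono[OF _ int])
        show "integrable N (indicat_real (\<Union>q\<in>D. A q))" using U by (simp add: N.emeasure_eq_measure)
        fix \<omega>
        show "indicat_real (\<Union>q\<in>D. A q) \<omega> \<le> block_excess D m T e (Z \<omega>)"
        proof (cases "\<omega> \<in> (\<Union>q\<in>D. A q)")
          case True
          then obtain q k where "q \<in> D" "k < m * T" "rational_block m k q"
            "e < norm (Z \<omega> q - Z \<omega> (of_nat k / of_nat m))" by (auto simp: A_def)
          then have "block_excess D m T e (Z \<omega>) = 1" using D e by (intro block_excess_1)
          then show ?thesis by (simp add: indicator_def)
        qed (use block_excess_bounds(1)[OF e] in simp)
      qed
      also have "\<dots> \<le> \<eta>"
      proof (rule tendsto_upperbound[OF rational_values_converge[OF M N Y Z zero cf tight FL]])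
        show "\<forall>\<^sub>F n in sequentially. (\<integral>\<omega>. block_excess D m T e (rational_values (Y n \<omega>)) \<partial>M) \<le> \<eta>"
          using ev
        proof eventually_elim
          case (elim n)
          then obtain B where B: "B \<in> sets M" "M.prob B \<le> \<eta>"
            "\<And>\<omega>. \<omega> \<in> space M - B \<Longrightarrow> small_blocks (Y n \<omega>) m T (e / 2)" by blast
          have "(\<integral>\<omega>. block_excess D m T e (rational_values (Y n \<omega>)) \<partial>M) \<le> (\<integral>\<omega>. indicator B \<omega> \<partial>M)"
          proof (rule integral_mono)
            show "integrable M (\<lambda>\<omega>. block_excess D m T e (rational_values (Y n \<omega>)))"
              by (rule M.integrable_finitely_lipschitz[OF FL rational_values_measurable[OF Y]])
            show "integrable M (indicat_real B)" using B(1) by (simp add: M.emeasure_eq_measure)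
            fix \<omega> assume "\<omega> \<in> space M"
            then show "block_excess D m T e (rational_values (Y n \<omega>)) \<le> indicat_real B \<omega>"
              using block_excess_0[OF small_blocks_rational_values[OF B(3)]]
                block_excess_bounds(2)[of D m T e "rational_values (Y n \<omega>)"]
              by (cases "\<omega> \<in> B") auto
          qed
          then show ?case using B by simp
        qed
      qed (assumption | rule sequentially_bot)+
      finally show ?thesis .
    qed
    define U where "U = (\<lambda>n::nat. \<Union>q\<in>from_nat ` {..n}. A q)"
    have "(\<lambda>n. N.prob (U n)) \<longlonglongrightarrow> N.prob (\<Union>n. U n)"
    proof (rule N.finite_Lim_measure_incseq)
      show "range U \<subseteq> sets N" unfolding U_def by auto
      show "incseq U" unfolding U_def incseq_def by fastforce
    qed
    then have "N.prob (\<Union>n. U n) \<le> \<eta>"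
    proof (rule LIMSEQ_le_const2, intro exI[of _ 0] allI impI)
      show "N.prob (U n) \<le> \<eta>" for n unfolding U_def by (rule finite_bound) simp
    qed
    moreover have "(\<Union>n. U n) = {\<omega> \<in> space N. \<not> rational_small_blocks (Z \<omega>) m T e}"
    proof -
      have "(\<Union>n. U n) = (\<Union>q. A q)"
      proof (intro equalityI subsetI)
        fix \<omega> assume "\<omega> \<in> (\<Union>q. A q)"
        then obtain q where q: "\<omega> \<in> A q" by blast
        have "q \<in> from_nat ` {..to_nat q}" by (rule image_eqI[of _ _ "to_nat q"]) simp_all
        then show "\<omega> \<in> (\<Union>n. U n)" using q unfolding U_def by blast
      qed (auto simp: U_def)
      also have "\<dots> = {\<omega> \<in> space N. \<not> rational_small_blocks (Z \<omega>) m T e}"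
        by (auto simp: A_def rational_small_blocks_def not_le)
      finally show ?thesis .
    qed
    ultimately show ?thesis using m by auto
  qed
  have "AE \<omega> in N. \<exists>m\<ge>1. rational_small_blocks (Z \<omega>) m T (1 / real (Suc r))" for T r
  proof -
    let ?S = "{\<omega> \<in> space N. \<not> (\<exists>m\<ge>1. rational_small_blocks (Z \<omega>) m T (1 / real (Suc r)))}"
    have [measurable]: "{\<omega> \<in> space N. \<not> rational_small_blocks (Z \<omega>) m T e} \<in> sets N" for m e
      unfolding rational_small_blocks_def by measurable
    have S: "?S \<in> sets N" unfolding rational_small_blocks_def by measurable
    have "N.prob ?S \<le> 0 + \<eta>" if \<eta>: "0 < \<eta>" for \<eta>
    proof -
      obtain m where m: "m \<ge> 1" "N.prob {\<omega> \<in> space N. \<not> rational_small_blocks (Z \<omega>) m T (1 / real (Suc r))} \<le> \<eta>"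
        using small[OF _ \<eta>, of "1 / real (Suc r)" T] by auto
      have "N.prob ?S \<le> N.prob {\<omega> \<in> space N. \<not> rational_small_blocks (Z \<omega>) m T (1 / real (Suc r))}"
        using m(1) by (intro N.finite_measure_mono) auto
      then show ?thesis using m(2) by simp
    qed
    then have "N.prob ?S \<le> 0" by (rule field_le_epsilon)
    then have "N.prob ?S = 0" using measure_nonneg[of N ?S] by linarith
    then have "?S \<in> null_sets N" using S by (simp add: null_sets_def N.emeasure_eq_measure)
    then show ?thesis by (rule AE_I') auto
  qed
  then have "AE \<omega> in N. \<forall>T r. \<exists>m\<ge>1. rational_small_blocks (Z \<omega>) m T (1 / real (Suc r))"
    by (simp add: AE_all_countable)
  then show ?thesis unfolding locally_uniformly_continuous_def .
qed

section \<open>Independent Gaussian increments\<close>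

text \<open>
  The joint characteristic functions of a centered Gaussian process with covariance \<open>C (min s t)\<close>.
\<close>

definition has_gaussian_transform :: "'b measure \<Rightarrow> ('b \<Rightarrow> real \<Rightarrow> real^'d) \<Rightarrow> (real \<Rightarrow> real^'d^'d) \<Rightarrow> bool" where
  "has_gaussian_transform N W C \<longleftrightarrow> (\<forall>K c t. (\<forall>k<K. 0 \<le> t k) \<longrightarrow>
     (\<integral>\<omega>. iexp (\<Sum>k<K. c k \<bullet> W \<omega> (t k)) \<partial>N) = of_real (exp (- (covariance_form C c t K / 2))))"

lemma sum_double: "(\<Sum>l<2 * k. f l) = (\<Sum>i<k. f (2 * i) + f (Suc (2 * i)))" for f :: "nat \<Rightarrow> 'c::comm_monoid_add"
  by (induction k) (simp_all add: add.assoc)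

lemma matrix_vector_mult_uminus: "A *v (- x) = - (A *v x)" for A :: "real^'n^'m"
  by (simp add: matrix_vector_mult_def vec_eq_iff sum_negf)

text \<open>
  A combination of \<open>k\<close> increments is a combination of \<open>2 k\<close> values: even indices carry the right end points of
  the increments, odd indices the left ones. The mixed terms of different increments cancel.
\<close>

lemma increments_covariance_form:
  fixes b :: "nat \<Rightarrow> real^'d"
  assumes mono: "\<And>i. i < k \<Longrightarrow> \<tau> i < \<tau> (Suc i)"
  defines "c \<equiv> \<lambda>l. if even l then b (l div 2) else - b (l div 2)"
    and "t \<equiv> \<lambda>l. if even l then \<tau> (Suc (l div 2)) else \<tau> (l div 2)"
  shows "covariance_form C c t (2 * k) = (\<Sum>i<k. b i \<bullet> ((C (\<tau> (Suc i)) - C (\<tau> i)) *v b i))"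
proof -
  have le: "\<tau> i \<le> \<tau> j" if "i \<le> j" "j \<le> k" for i j
    using that
  proof (induction j)
    case (Suc j)
    then show ?case using mono[of j] by (cases "i = Suc j") auto
  qed simp
  let ?d = "\<lambda>i j. b i \<bullet> (C (min (\<tau> (Suc i)) (\<tau> (Suc j))) *v b j) - b i \<bullet> (C (min (\<tau> (Suc i)) (\<tau> j)) *v b j)
      + (b i \<bullet> (C (min (\<tau> i) (\<tau> j)) *v b j) - b i \<bullet> (C (min (\<tau> i) (\<tau> (Suc j))) *v b j))"
  have "covariance_form C c t (2 * k) = (\<Sum>i<k. \<Sum>j<k. ?d i j)"
    unfolding covariance_form_def sum_double sum.distrib[symmetric]
    by (intro sum.cong refl) (simp add: c_def t_def matrix_vector_mult_uminus)
  also have "\<dots> = (\<Sum>i<k. \<Sum>j<k. if j = i then b i \<bullet> ((C (\<tau> (Suc i)) - C (\<tau> i)) *v b i) else 0)"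
  proof (intro sum.cong refl)
    fix i j assume ij: "i \<in> {..<k}" "j \<in> {..<k}"
    consider "i = j" | "i < j" | "j < i" by linarith
    then show "?d i j = (if j = i then b i \<bullet> ((C (\<tau> (Suc i)) - C (\<tau> i)) *v b i) else 0)"
    proof cases
      case 1
      then show ?thesis using le[of i "Suc i"] ij
        by (simp add: min_absorb1 min_absorb2 matrix_vector_mult_diff_rdistrib inner_diff_right)
    next
      case 2
      then have "\<tau> (Suc i) \<le> \<tau> j" "\<tau> i \<le> \<tau> j" "\<tau> i \<le> \<tau> (Suc j)" "\<tau> (Suc i) \<le> \<tau> (Suc j)"
        using ij by (auto intro!: le)
      then show ?thesis using 2 by (simp add: min_absorb1)
    next
      case 3
      then have "\<tau> (Suc j) \<le> \<tau> i" "\<tau> j \<le> \<tau> i" "\<tau> j \<le> \<tau> (Suc i)" "\<tau> (Suc j) \<le> \<tau> (Suc i)"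
        using ij by (auto intro!: le)
      then show ?thesis using 3 by (simp add: min_absorb2)
    qed
  qed
  finally show ?thesis by simp
qed

lemma increments_transform:
  fixes W :: "'b \<Rightarrow> real \<Rightarrow> real^'d"
  assumes W: "has_gaussian_transform N W C" and \<tau>: "0 \<le> \<tau> 0" "\<And>i. i < k \<Longrightarrow> \<tau> i < \<tau> (Suc i)"
  shows "(\<integral>\<omega>. iexp (\<Sum>i<k. b i \<bullet> (W \<omega> (\<tau> (Suc i)) - W \<omega> (\<tau> i))) \<partial>N)
    = of_real (exp (- ((\<Sum>i<k. b i \<bullet> ((C (\<tau> (Suc i)) - C (\<tau> i)) *v b i)) / 2)))"
proof -
  define c where "c = (\<lambda>l. if even l then b (l div 2) else - b (l div 2))"
  define t where "t = (\<lambda>l. if even l then \<tau> (Suc (l div 2)) else \<tau> (l div 2))"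
  have pos: "0 \<le> \<tau> i" if "i \<le> k" for i
    using that
  proof (induction i)
    case (Suc i)
    then show ?case using \<tau>(2)[of i] by simp
  qed (rule \<tau>(1))
  have "0 \<le> t l" if "l < 2 * k" for l
    using that unfolding t_def by (auto intro!: pos)
  then have "(\<integral>\<omega>. iexp (\<Sum>l<2 * k. c l \<bullet> W \<omega> (t l)) \<partial>N) = of_real (exp (- (covariance_form C c t (2 * k) / 2)))"
    using W unfolding has_gaussian_transform_def by blast
  also have "covariance_form C c t (2 * k) = (\<Sum>i<k. b i \<bullet> ((C (\<tau> (Suc i)) - C (\<tau> i)) *v b i))"
    unfolding c_def t_def by (rule increments_covariance_form) (rule \<tau>(2))
  finally have *: "(\<integral>\<omega>. iexp (\<Sum>l<2 * k. c l \<bullet> W \<omega> (t l)) \<partial>N)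
      = of_real (exp (- ((\<Sum>i<k. b i \<bullet> ((C (\<tau> (Suc i)) - C (\<tau> i)) *v b i)) / 2)))" .
  have "(\<Sum>l<2 * k. c l \<bullet> W \<omega> (t l)) = (\<Sum>i<k. b i \<bullet> (W \<omega> (\<tau> (Suc i)) - W \<omega> (\<tau> i)))" for \<omega>
    unfolding sum_double by (intro sum.cong refl) (simp add: c_def t_def inner_diff_right)
  with * show ?thesis by (simp only:)
qed

lemma char_normal:
  assumes "0 < \<sigma>"
  shows "char (density lborel (normal_density 0 \<sigma>)) u = of_real (exp (- (u\<^sup>2 * \<sigma>\<^sup>2 / 2)))"
proof -
  interpret S: prob_space std_normal_distribution by (rule prob_space_normal_density) simp
  have "distributed std_normal_distribution lborel (\<lambda>x. x) std_normal_density"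
    by (auto simp: distributed_def distr_id2)
  then have "distributed std_normal_distribution lborel (\<lambda>x. 0 + \<sigma> * x) (normal_density (0 + \<sigma> * 0) (\<bar>\<sigma>\<bar> * 1))"
    using assms by (intro S.normal_density_affine) auto
  then have d: "distr std_normal_distribution lborel (\<lambda>x. \<sigma> * x) = density lborel (normal_density 0 \<sigma>)"
    using assms by (auto simp: distributed_def)
  have "char (density lborel (normal_density 0 \<sigma>)) u = (\<integral>x. iexp (u * (\<sigma> * x)) \<partial>std_normal_distribution)"
    unfolding d[symmetric] char_def by (subst integral_distr) auto
  also have "\<dots> = char std_normal_distribution (u * \<sigma>)" by (simp add: char_def mult.assoc)
  finally show ?thesis by (simp add: char_std_normal_distribution power_mult_distrib)
qed

text \<open>
  A characteristic function is bounded by one, which makes \<open>v\<close> nonnegative; then the law is identified by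
  uniqueness, with a point mass for \<open>v = 0\<close>.
\<close>

lemma gaussian_law_if_transform:
  assumes "prob_space N" and h[measurable]: "h \<in> borel_measurable N"
    and cf: "\<And>u. (\<integral>\<omega>. iexp (u * h \<omega>) \<partial>N) = of_real (exp (- (u\<^sup>2 * v / 2)))"
  shows "gaussian_law (distr N borel h)"
proof -
  interpret N: prob_space N by fact
  have ch: "char (distr N borel h) = (\<lambda>u. of_real (exp (- (u\<^sup>2 * v / 2))))"
    unfolding char_def by (rule ext, subst integral_distr) (auto simp: cf simp del: of_real_mult)
  interpret D: real_distribution "distr N borel h" by (rule N.real_distribution_distr) simp
  have "cmod (char (distr N borel h) 1) \<le> 1" by (rule D.cmod_char_le_1)
  then have v: "0 \<le> v" by (simp add: ch)
  show ?thesis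
  proof (cases "v = 0")
    case True
    have r: "real_distribution (return borel (0::real))"
      by (intro real_distribution.intro prob_space_return real_distribution_axioms.intro) auto
    have "char (return borel 0) u = 1" for u by (simp add: char_def integral_return)
    then have "distr N borel h = return borel 0"
      using True by (intro Levy_uniqueness D.real_distribution_axioms r) (auto simp: ch)
    then show ?thesis unfolding gaussian_law_def by blast
  next
    case False
    then have v0: "0 < v" using v by simp
    have "distr N borel h = density lborel (normal_density 0 (sqrt v))"
    proof (rule Levy_uniqueness[OF D.real_distribution_axioms])
      show "real_distribution (density lborel (normal_density 0 (sqrt v)))"
        using v0 by (intro real_distribution.intro prob_space_normal_density real_distribution_axioms.intro) auto
      show "char (distr N borel h) = char (density lborel (normal_density 0 (sqrt v)))"
        using v0 by (intro ext) (simp add: ch char_normal)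
    qed
    moreover have "0 < sqrt v" using v0 by simp
    ultimately show ?thesis unfolding gaussian_law_def by blast
  qed
qed

lemma gaussian_vector_increment:
  fixes W :: "'b \<Rightarrow> real \<Rightarrow> real^'d"
  assumes N: "prob_space N" and meas: "\<And>t. 0 \<le> t \<Longrightarrow> (\<lambda>\<omega>. W \<omega> t) \<in> borel_measurable N"
    and W: "has_gaussian_transform N W C" and st: "0 \<le> s" "s < t"
  shows "gaussian_vector N (\<lambda>\<omega>. W \<omega> t - W \<omega> s)"
  unfolding gaussian_vector_def
proof (intro conjI allI)
  have [measurable]: "(\<lambda>\<omega>. W \<omega> t) \<in> borel_measurable N" "(\<lambda>\<omega>. W \<omega> s) \<in> borel_measurable N"
    using meas st by auto
  show "(\<lambda>\<omega>. W \<omega> t - W \<omega> s) \<in> borel_measurable N" by measurable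
  fix a :: "real^'d"
  show "gaussian_law (distr N borel (\<lambda>\<omega>. a \<bullet> (W \<omega> t - W \<omega> s)))"
  proof (rule gaussian_law_if_transform[OF N])
    fix u :: real
    define \<tau> where "\<tau> = (\<lambda>i::nat. if i = 0 then s else t)"
    have "(\<integral>\<omega>. iexp (\<Sum>i<1. (u *\<^sub>R a) \<bullet> (W \<omega> (\<tau> (Suc i)) - W \<omega> (\<tau> i))) \<partial>N)
      = of_real (exp (- ((\<Sum>i<1::nat. (u *\<^sub>R a) \<bullet> ((C (\<tau> (Suc i)) - C (\<tau> i)) *v (u *\<^sub>R a))) / 2)))"
      using st by (intro increments_transform[OF W]) (auto simp: \<tau>_def)
    then show "(\<integral>\<omega>. iexp (u * (a \<bullet> (W \<omega> t - W \<omega> s))) \<partial>N)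
        = of_real (exp (- (u\<^sup>2 * (a \<bullet> ((C t - C s) *v a)) / 2)))"
      by (simp add: \<tau>_def matrix_vector_mult_scaleR power2_eq_square mult.assoc)
  qed measurable
qed

text \<open>
  The joint law of the increments and the product of their laws have the same characteristic function,
  hence the same expectations of products of Lipschitz functions, hence the same values on products of
  open sets.
\<close>

lemma indep_vars_if_transform_factors:
  fixes V :: "nat \<Rightarrow> 'b \<Rightarrow> 'e::euclidean_space"
  assumes N: "prob_space N" and V[measurable]: "\<And>i. i < k \<Longrightarrow> V i \<in> borel_measurable N"
    and factor: "\<And>b. (\<integral>\<omega>. iexp (\<Sum>i<k. b i \<bullet> V i \<omega>) \<partial>N) = (\<Prod>i<k. \<integral>\<omega>. iexp (b i \<bullet> V i \<omega>) \<partial>N)"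
  shows "prob_space.indep_vars N (\<lambda>_. borel) V {..<k}"
proof -
  interpret N: prob_space N by (rule N)
  define P where "P = Pi\<^sub>M {..<k} (\<lambda>i. distr N borel (V i))"
  have law: "prob_space (distr N borel (V i))" if "i < k" for i
    using that by (intro N.prob_space_distr V)
  define \<mu> where "\<mu> = (\<lambda>i. if i < k then distr N borel (V i) else return borel 0)"
  have \<mu>: "prob_space (\<mu> i)" "sets (\<mu> i) = sets borel" for i
    using law by (auto simp: \<mu>_def intro: prob_space_return)
  interpret \<mu>: product_prob_space \<mu> "{..<k}"
    by (intro product_prob_spaceI \<mu>)
  have P: "P = Pi\<^sub>M {..<k} \<mu>" unfolding P_def by (rule PiM_cong) (auto simp: \<mu>_def)
  have P_prob: "prob_space P" unfolding P by (rule prob_space_PiM) (rule \<mu>)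
  define Y where "Y = (\<lambda>\<omega> i. if i < k then V i \<omega> else 0)"
  define Z where "Z = (\<lambda>\<omega> i. if i < k then \<omega> i else (0::'e))"
  have Ym: "(\<lambda>\<omega>. Y \<omega> i) \<in> borel_measurable N" for i
    by (cases "i < k") (simp_all add: Y_def V)
  have Zm: "(\<lambda>\<omega>. Z \<omega> i) \<in> borel_measurable P" for i
  proof (cases "i < k")
    case True
    then have "(\<lambda>\<omega>. \<omega> i) \<in> P \<rightarrow>\<^sub>M \<mu> i" unfolding P by (intro measurable_component_singleton) auto
    then have "(\<lambda>\<omega>. \<omega> i) \<in> borel_measurable P" using \<mu>(2)[of i] measurable_cong_sets by blast
    then show ?thesis using True by (simp add: Z_def)
  qed (simp add: Z_def)
  have prod_int: "(\<integral>x. (\<Prod>i<k. f i (x i)) \<partial>P) = (\<Prod>i<k. \<integral>\<omega>. f i (V i \<omega>) \<partial>N)"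
    if f: "\<And>i. f i \<in> borel_measurable borel" "\<And>i x. norm (f i x) \<le> 1"
    for f :: "nat \<Rightarrow> 'e \<Rightarrow> 'f::{real_normed_field, banach, second_countable_topology}"
  proof -
    have "(\<integral>x. (\<Prod>i<k. f i (x i)) \<partial>P) = (\<Prod>i<k. \<integral>x. f i x \<partial>\<mu> i)"
      unfolding P
    proof (rule \<mu>.product_integral_prod)
      fix i assume "i \<in> {..<k}"
      have "f i \<in> borel_measurable (\<mu> i)" using f(1)[of i] \<mu>(2)[of i] measurable_cong_sets by blast
      then show "integrable (\<mu> i) (f i)" using f(2) 
        by (intro finite_measure.integrable_const_bound[OF prob_space.finite_measure[OF \<mu>(1)], of _ 1]) auto
    qed simp
    also have "\<dots> = (\<Prod>i<k. \<integral>\<omega>. f i (V i \<omega>) \<partial>N)"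
      by (intro prod.cong refl) (simp add: \<mu>_def integral_distr f)
    finally show ?thesis .
  qed
  have cos_eq: "(\<integral>\<omega>. cos (a (Y \<omega>) + \<theta>) \<partial>N) = (\<integral>\<omega>. cos (a (Z \<omega>) + \<theta>) \<partial>P)"
    if a: "finite_functional a" for a \<theta>
  proof -
    obtain I c where I: "finite I" "a = (\<lambda>x. \<Sum>i\<in>I. c i \<bullet> x i)" using a by (auto simp: finite_functional_def)
    define b where "b = (\<lambda>i. if i \<in> I then c i else 0)"
    have red: "(\<Sum>i\<in>I. c i \<bullet> (if i < k then x i else 0)) = (\<Sum>i<k. b i \<bullet> x i)" for x :: "nat \<Rightarrow> 'e"
    proof -
      have "(\<Sum>i\<in>I. c i \<bullet> (if i < k then x i else 0)) = (\<Sum>i\<in>I \<inter> {..<k}. c i \<bullet> x i)"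
        using I(1) by (intro sum.mono_neutral_cong_right) auto
      also have "\<dots> = (\<Sum>i<k. b i \<bullet> x i)"
        by (intro sum.mono_neutral_cong_left) (auto simp: b_def)
      finally show ?thesis .
    qed
    have aY: "a (Y \<omega>) = (\<Sum>i<k. b i \<bullet> V i \<omega>)" for \<omega> unfolding I(2) Y_def by (rule red)
    have aZ: "a (Z x) = (\<Sum>i<k. b i \<bullet> x i)" for x unfolding I(2) Z_def by (rule red)
    have "(\<integral>x. iexp (a (Z x)) \<partial>P) = (\<integral>x. (\<Prod>i<k. iexp (b i \<bullet> x i)) \<partial>P)"
      by (simp add: aZ sum_distrib_left exp_sum)
    also have "\<dots> = (\<integral>\<omega>. iexp (a (Y \<omega>)) \<partial>N)"
      unfolding aY factor by (rule prod_int) auto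
    finally have *: "(\<integral>x. iexp (a (Z x)) \<partial>P) = (\<integral>\<omega>. iexp (a (Y \<omega>)) \<partial>N)" .
    show ?thesis
      unfolding cos_expectation_eq[OF N finite_functional_measurable[OF a Ym]] cos_expectation_eq[OF P_prob finite_functional_measurable[OF a Zm]] *
      by (rule refl)
  qed
  have lip_eq: "(\<integral>\<omega>. (\<Prod>i<k. g i (V i \<omega>)) \<partial>N) = (\<Prod>i<k. \<integral>\<omega>. g i (V i \<omega>) \<partial>N)"
    if g: "\<And>i x. 0 \<le> g i x" "\<And>i x. g i x \<le> 1" "\<And>i x y. \<bar>g i x - g i y\<bar> \<le> L * norm (x - y)" and L: "0 \<le> L"
    for g :: "nat \<Rightarrow> 'e \<Rightarrow> real" and L
  proof -
    have diff: "\<bar>(\<Prod>i<k. g i (x i)) - (\<Prod>i<k. g i (y i))\<bar> \<le> L * (\<Sum>i<k. norm (x i - y i))" for x y :: "nat \<Rightarrow> 'e"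
    proof -
      have "norm ((\<Prod>i<k. g i (x i)) - (\<Prod>i<k. g i (y i))) \<le> (\<Sum>i<k. norm (g i (x i) - g i (y i)))"
        using g by (intro norm_prod_diff) auto
      also have "\<dots> \<le> (\<Sum>i<k. L * norm (x i - y i))" using g(3) by (intro sum_mono) auto
      finally show ?thesis by (simp add: sum_distrib_left)
    qed
    have "\<bar>\<Prod>i<k. g i (x i)\<bar> \<le> 1" for x
      using g by (simp add: abs_prod prod_le_1)
    then have FL: "finitely_lipschitz {..<k} 1 L (\<lambda>x. \<Prod>i<k. g i (x i))"
      unfolding finitely_lipschitz_def using diff L by auto
    have gm: "g i \<in> borel_measurable borel" for i
    proof (intro borel_measurable_continuous_onI)
      have "L-lipschitz_on UNIV (g i)" using g(3) L by (auto simp: lipschitz_on_def dist_norm)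
      then show "continuous_on UNIV (g i)" by (rule lipschitz_on_continuous_on)
    qed
    have "(\<lambda>n::nat. \<integral>\<omega>. (\<Prod>i<k. g i (Y \<omega> i)) \<partial>N) \<longlonglongrightarrow> (\<integral>x. (\<Prod>i<k. g i (Z x i)) \<partial>P)"
    proof (rule finite_dimensional_weak_convergence[OF N P_prob Ym Zm _ _ FL])
      show "(\<lambda>n. \<integral>\<omega>. cos (a (Y \<omega>) + \<theta>) \<partial>N) \<longlonglongrightarrow> (\<integral>\<omega>. cos (a (Z \<omega>) + \<theta>) \<partial>P)"
        if "finite_functional a" for a \<theta>
        unfolding cos_eq[OF that] by (rule tendsto_const)
      show "\<exists>A. \<forall>\<^sub>F n in sequentially. N.prob {\<omega> \<in> space N. norm (Y \<omega> i) > A} \<le> \<eta>" if "\<eta> > 0" for i \<eta>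
        using N.norm_tail_small[OF Ym that] by simp
    qed
    then have "(\<integral>\<omega>. (\<Prod>i<k. g i (Y \<omega> i)) \<partial>N) = (\<integral>x. (\<Prod>i<k. g i (Z x i)) \<partial>P)"
      by (simp add: LIMSEQ_const_iff)
    moreover have "(\<Prod>i<k. g i (Y \<omega> i)) = (\<Prod>i<k. g i (V i \<omega>))" for \<omega> by (intro prod.cong) (auto simp: Y_def)
    moreover have "(\<Prod>i<k. g i (Z x i)) = (\<Prod>i<k. g i (x i))" for x by (intro prod.cong) (auto simp: Z_def)
    moreover have "(\<integral>x. (\<Prod>i<k. g i (x i)) \<partial>P) = (\<Prod>i<k. \<integral>\<omega>. g i (V i \<omega>) \<partial>N)"
      using g by (intro prod_int gm) auto
    ultimately show ?thesis by simp
  qed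
  have open_eq: "N.prob (\<Inter>i<k. V i -` U i \<inter> space N) = (\<Prod>i<k. N.prob (V i -` U i \<inter> space N))"
    if k: "0 < k" and U: "\<And>i. open (U i)" for U :: "nat \<Rightarrow> 'e set"
  proof -
    \<comment> \<open>The distance to the empty set is zero by convention, so the full space is treated apart.\<close>
    define g where "g = (\<lambda>n i x. if U i = UNIV then 1 else min 1 (real n * infdist x (- U i)))"
    have g01: "0 \<le> g n i x" "g n i x \<le> 1" for n i x by (auto simp: g_def infdist_nonneg)
    have g_lip: "\<bar>g n i x - g n i y\<bar> \<le> real n * norm (x - y)" for n i x y
    proof -
      have "\<bar>infdist x (- U i) - infdist y (- U i)\<bar> \<le> norm (x - y)"
        using infdist_triangle[of x "- U i" y] infdist_triangle[of y "- U i" x] by (auto simp: dist_norm norm_minus_commute abs_le_iff)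
      then have "real n * \<bar>infdist x (- U i) - infdist y (- U i)\<bar> \<le> real n * norm (x - y)" by (rule mult_left_mono) simp
      then have *: "\<bar>real n * infdist x (- U i) - real n * infdist y (- U i)\<bar> \<le> real n * norm (x - y)"
        by (simp add: abs_mult flip: right_diff_distrib)
      have "\<bar>min 1 u - min 1 v\<bar> \<le> \<bar>u - v\<bar>" for u v :: real by linarith
      with * show ?thesis by (auto simp: g_def intro: order_trans)
    qed
    have g_lim: "(\<lambda>n. g n i x) \<longlonglongrightarrow> indicator (U i) x" for i x
    proof (cases "x \<in> U i \<and> U i \<noteq> UNIV")
      case True
      then have "infdist x (- U i) \<noteq> 0"
        using U[of i] in_closed_iff_infdist_zero[of "- U i" x] by (auto simp: closed_Compl)
      then have d: "0 < infdist x (- U i)" using infdist_nonneg[of x "- U i"] by linarith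
      obtain n0 where n0: "1 / infdist x (- U i) \<le> real n0" using real_arch_simple by blast
      have "g n i x = 1" if "n0 \<le> n" for n
      proof -
        have "1 / infdist x (- U i) \<le> real n" using n0 that by linarith
        then show ?thesis using d by (simp add: g_def pos_divide_le_eq)
      qed
      then have "(\<lambda>n. g n i x) \<longlonglongrightarrow> 1" by (intro tendsto_eventually) (auto simp: eventually_sequentially)
      then show ?thesis using True by simp
    next
      case False
      then have "g n i x = indicator (U i) x" for n by (auto simp: g_def indicator_def)
      then show ?thesis by simp
    qed
    have gV[measurable]: "(\<lambda>\<omega>. g n i (V i \<omega>)) \<in> borel_measurable N" if "i < k" for n i
    proof -
      have "(real n)-lipschitz_on UNIV (g n i)" using g_lip by (auto simp: lipschitz_on_def dist_norm)
      then have "g n i \<in> borel_measurable borel"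
        by (intro borel_measurable_continuous_onI lipschitz_on_continuous_on)
      then show ?thesis by (rule measurable_compose[OF V[OF that]])
    qed
    have UV[measurable]: "V i -` U i \<inter> space N \<in> sets N" if "i < k" for i
      using V[OF that] U[of i] by (auto intro!: measurable_sets)
    have "(\<lambda>n. \<integral>\<omega>. (\<Prod>i<k. g n i (V i \<omega>)) \<partial>N) \<longlonglongrightarrow> (\<integral>\<omega>. (\<Prod>i<k. indicator (V i -` U i \<inter> space N) \<omega>) \<partial>N)"
    proof (rule integral_dominated_convergence[where w = "\<lambda>_. 1"])
      show "AE \<omega> in N. (\<lambda>n. \<Prod>i<k. g n i (V i \<omega>)) \<longlonglongrightarrow> (\<Prod>i<k. indicator (V i -` U i \<inter> space N) \<omega>)"
      proof (intro AE_I2 tendsto_prod)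
        fix \<omega> i assume "\<omega> \<in> space N"
        then show "(\<lambda>n. g n i (V i \<omega>)) \<longlonglongrightarrow> indicator (V i -` U i \<inter> space N) \<omega>"
          using g_lim[of i "V i \<omega>"] by (simp add: indicator_def)
      qed
      show "AE \<omega> in N. norm (\<Prod>i<k. g n i (V i \<omega>)) \<le> 1" for n
        using g01 by (intro AE_I2) (simp add: abs_prod prod_le_1)
    qed (auto intro!: borel_measurable_prod)
    moreover have "(\<lambda>n. \<Prod>i<k. \<integral>\<omega>. g n i (V i \<omega>) \<partial>N) \<longlonglongrightarrow> (\<Prod>i<k. \<integral>\<omega>. indicator (V i -` U i \<inter> space N) \<omega> \<partial>N)"
    proof (rule tendsto_prod)
      fix i assume "i \<in> {..<k}"
      then have i: "i < k" by simp
      show "(\<lambda>n. \<integral>\<omega>. g n i (V i \<omega>) \<partial>N) \<longlonglongrightarrow> (\<integral>\<omega>. indicator (V i -` U i \<inter> space N) \<omega> \<partial>N)"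
      proof (rule integral_dominated_convergence[where w = "\<lambda>_. 1"])
        show "AE \<omega> in N. (\<lambda>n. g n i (V i \<omega>)) \<longlonglongrightarrow> indicator (V i -` U i \<inter> space N) \<omega>"
        proof (intro AE_I2)
          fix \<omega> assume "\<omega> \<in> space N"
          then show "(\<lambda>n. g n i (V i \<omega>)) \<longlonglongrightarrow> indicator (V i -` U i \<inter> space N) \<omega>"
            using g_lim[of i "V i \<omega>"] by (simp add: indicator_def)
        qed
        show "AE \<omega> in N. norm (g n i (V i \<omega>)) \<le> 1" for n using g01 by simp
      qed (use i in auto)
    qed
    moreover have "(\<integral>\<omega>. (\<Prod>i<k. g n i (V i \<omega>)) \<partial>N) = (\<Prod>i<k. \<integral>\<omega>. g n i (V i \<omega>) \<partial>N)" for n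
      by (rule lip_eq[OF g01 g_lip]) simp
    ultimately have "(\<integral>\<omega>. (\<Prod>i<k. indicat_real (V i -` U i \<inter> space N) \<omega>) \<partial>N)
        = (\<Prod>i<k. \<integral>\<omega>. indicat_real (V i -` U i \<inter> space N) \<omega> \<partial>N)"
      using LIMSEQ_unique by simp
    moreover have "(\<Prod>i<k. indicat_real (V i -` U i \<inter> space N) \<omega>) = indicat_real (\<Inter>i<k. V i -` U i \<inter> space N) \<omega>" for \<omega>
      by (auto simp: indicator_def prod_zero_iff)
    moreover have "(\<Inter>i<k. V i -` U i \<inter> space N) \<in> sets N" using k by (intro sets.finite_INT) auto
    ultimately show ?thesis by simp
  qed
  have indep: "N.indep_sets (\<lambda>i. {V i -` U \<inter> space N | U. open U}) {..<k}"
  proof (rule N.indep_setsI)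
    show "{V i -` U \<inter> space N | U. open U} \<subseteq> N.events" if "i \<in> {..<k}" for i
      using measurable_sets[OF V borel_open] that by auto
    fix A J assume J: "J \<noteq> {}" "J \<subseteq> {..<k}" "finite J" and A: "\<forall>j\<in>J. A j \<in> {V j -` U \<inter> space N | U. open U}"
    then have k: "0 < k" by auto
    have "\<forall>j\<in>J. \<exists>U. open U \<and> A j = V j -` U \<inter> space N" using A by auto
    then obtain U where U: "\<And>j. j \<in> J \<Longrightarrow> open (U j) \<and> A j = V j -` U j \<inter> space N"
      by (metis (no_types, lifting))
    define U' where "U' = (\<lambda>j. if j \<in> J then U j else UNIV)"
    have "open (U' j)" for j using U by (simp add: U'_def)
    then have "N.prob (\<Inter>i<k. V i -` U' i \<inter> space N) = (\<Prod>i<k. N.prob (V i -` U' i \<inter> space N))"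
      by (rule open_eq[OF k])
    moreover have "(\<Inter>i<k. V i -` U' i \<inter> space N) = (\<Inter>j\<in>J. A j)"
    proof -
      have "(\<Inter>j\<in>J. A j) = (\<Inter>j\<in>J. V j -` U j \<inter> space N)" using U by (intro INF_cong) auto
      also have "\<dots> = (\<Inter>i<k. V i -` U' i \<inter> space N)"
        using J k by (auto simp: U'_def split: if_splits)
      finally show ?thesis by simp
    qed
    moreover have "(\<Prod>i<k. N.prob (V i -` U' i \<inter> space N)) = (\<Prod>j\<in>J. N.prob (A j))"
      using J U by (intro prod.mono_neutral_cong_right) (auto simp: U'_def N.prob_space)
    ultimately show "N.prob (\<Inter>j\<in>J. A j) = (\<Prod>j\<in>J. N.prob (A j))" by simp
  qed
  have stable: "Int_stable {V i -` U \<inter> space N | U. open U}" for i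
  proof (rule Int_stableI)
    fix A B assume "A \<in> {V i -` U \<inter> space N | U. open U}" "B \<in> {V i -` U \<inter> space N | U. open U}"
    then obtain U U' where "open U" "open U'" "A = V i -` U \<inter> space N" "B = V i -` U' \<inter> space N" by auto
    then have "open (U \<inter> U')" "A \<inter> B = V i -` (U \<inter> U') \<inter> space N" by auto
    then show "A \<inter> B \<in> {V i -` U \<inter> space N | U. open U}" by blast
  qed
  have gen: "sigma_sets (space N) {V i -` U \<inter> space N | U. open U} = {V i -` A \<inter> space N | A. A \<in> sets borel}" for i
    using sigma_sets_vimage_commute[of "V i" "space N" UNIV "{U. open U}"] by (simp add: sets_borel)
  show ?thesis
    unfolding N.indep_vars_def2
    using N.indep_sets_sigma[OF indep stable] V by (simp add: gen)
qed

theorem indep_gaussian_increments_if_transform: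
  fixes W :: "'b \<Rightarrow> real \<Rightarrow> real^'d"
  assumes N: "prob_space N" and meas: "\<And>t. 0 \<le> t \<Longrightarrow> (\<lambda>\<omega>. W \<omega> t) \<in> borel_measurable N"
    and W: "has_gaussian_transform N W C"
  shows "indep_gaussian_increments N W"
  unfolding indep_gaussian_increments_def
proof (intro conjI allI impI)
  fix s t :: real assume "0 \<le> s \<and> s < t"
  then show "gaussian_vector N (\<lambda>\<omega>. W \<omega> t - W \<omega> s)"
    by (intro gaussian_vector_increment[OF N meas W]) auto
next
  fix k and \<tau> :: "nat \<Rightarrow> real" assume \<tau>: "0 \<le> \<tau> 0 \<and> strict_mono_on {..k} \<tau>"
  have mono: "\<tau> i < \<tau> (Suc i)" if "i < k" for i
    using \<tau> that by (intro strict_mono_onD[of "{..k}" \<tau>]) auto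
  have pos: "0 \<le> \<tau> i" if "i \<le> k" for i
    using that
  proof (induction i)
    case (Suc i)
    then show ?case using mono[of i] by simp
  qed (use \<tau> in simp)
  show "prob_space.indep_vars N (\<lambda>_. borel) (\<lambda>i \<omega>. W \<omega> (\<tau> (Suc i)) - W \<omega> (\<tau> i)) {..<k}"
  proof (rule indep_vars_if_transform_factors[OF N])
    show "(\<lambda>\<omega>. W \<omega> (\<tau> (Suc i)) - W \<omega> (\<tau> i)) \<in> borel_measurable N" if "i < k" for i
      using that by (intro borel_measurable_diff meas pos) auto
    fix b :: "nat \<Rightarrow> real^'d"
    have one: "(\<integral>\<omega>. iexp (b i \<bullet> (W \<omega> (\<tau> (Suc i)) - W \<omega> (\<tau> i))) \<partial>N)
        = of_real (exp (- ((b i \<bullet> ((C (\<tau> (Suc i)) - C (\<tau> i)) *v b i)) / 2)))" if i: "i < k" for i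
      using increments_transform[OF W, of "\<lambda>j. \<tau> (i + j)" 1 "\<lambda>_. b i"] mono[OF i] pos[of i] i by simp
    show "(\<integral>\<omega>. iexp (\<Sum>i<k. b i \<bullet> (W \<omega> (\<tau> (Suc i)) - W \<omega> (\<tau> i))) \<partial>N)
        = (\<Prod>i<k. \<integral>\<omega>. iexp (b i \<bullet> (W \<omega> (\<tau> (Suc i)) - W \<omega> (\<tau> i))) \<partial>N)"
      using \<tau> mono
      by (subst increments_transform[OF W]) (auto simp: one exp_sum[symmetric] sum_negf sum_divide_distrib simp flip: of_real_prod)
  qed
qed

section \<open>The functional central limit theorem\<close>

lemma matrix_form_expand:
  "x \<bullet> ((A::real^'d^'d) *v y) = (\<Sum>j\<in>UNIV. \<Sum>i\<in>UNIV. x $ j * y $ i * A $ j $ i)"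
  by (simp add: inner_vec_def matrix_vector_mult_def sum_distrib_left mult_ac)

context near_martingale
begin

text \<open>
  The approximating matrices are symmetric.
\<close>

lemma C_symmetric:
  assumes t: "0 \<le> t"
  shows "C t $ j $ k = C t $ k $ j"
proof -
  have le: "0 \<le> C t $ j $ k - C t $ k $ j" for j k
  proof (rule tendsto_in_prob_nonneg)
    have "tendsto_in_prob M (\<lambda>n \<omega>. axis j 1 \<bullet> (qv t n \<omega> *v axis k 1) + (- axis k 1) \<bullet> (qv t n \<omega> *v axis j 1))
       (axis j 1 \<bullet> (C t *v axis k 1) + (- axis k 1) \<bullet> (C t *v axis j 1))"
      using t by (intro tendsto_in_prob_add qv_form_tendsto) auto
    then show "tendsto_in_prob M (\<lambda>n \<omega>. axis j 1 \<bullet> (qv t n \<omega> *v axis k 1) + (- axis k 1) \<bullet> (qv t n \<omega> *v axis j 1))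
       (C t $ j $ k - C t $ k $ j)" by (simp add: matrix_form_axis)
    show "0 \<le> axis j 1 \<bullet> (qv t n \<omega> *v axis k 1) + (- axis k 1) \<bullet> (qv t n \<omega> *v axis j 1)" for n \<omega>
      unfolding qv_form by (simp add: mult.commute sum_negf)
  qed
  show ?thesis using le[of j k] le[of k j] by linarith
qed

definition time :: "rat \<Rightarrow> real" where "time q = max 0 (real_of_rat q)"

text \<open>
  The covariance \<open>C (min s t)\<close> of the limit, with pairs of a rational time and a coordinate encoded as natural
  numbers.
\<close>

definition limit_kernel :: "nat \<Rightarrow> nat \<Rightarrow> real" where
  "limit_kernel n m = (case from_nat n :: rat \<times> 'd of (q, j) \<Rightarrow> case from_nat m :: rat \<times> 'd of (r, k) \<Rightarrow>
     C (min (time q) (time r)) $ j $ k)"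

lemma time_nonneg: "0 \<le> time q" by (simp add: time_def)

lemma limit_kernel_to_nat: "limit_kernel (to_nat (q, j)) (to_nat (r, k)) = C (min (time q) (time r)) $ j $ k"
  by (simp add: limit_kernel_def)

text \<open>
  As a limit of rescaled sums of squares the kernel is positive semidefinite.
\<close>

lemma psd_limit_kernel: "psd_kernel limit_kernel"
  unfolding psd_kernel_def
proof (intro conjI allI impI)
  show "limit_kernel n m = limit_kernel m n" for n m
    unfolding limit_kernel_def by (auto split: prod.split simp: min.commute intro!: C_symmetric time_nonneg)
  fix I :: "nat set" and c :: "nat \<Rightarrow> real" assume I: "finite I"
  obtain h where h: "bij_betw h {0..<card I} I" using ex_bij_betw_nat_finite[OF I] by blast
  define q where "q = (\<lambda>a. fst (from_nat (h a) :: rat \<times> 'd))"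
  define j where "j = (\<lambda>a. snd (from_nat (h a) :: rat \<times> 'd))"
  have K: "limit_kernel (h a) (h b) = C (min (time (q a)) (time (q b))) $ j a $ j b" for a b
    by (simp add: limit_kernel_def q_def j_def case_prod_unfold)
  have "0 \<le> covariance_form C (\<lambda>a. c (h a) *\<^sub>R axis (j a) 1) (\<lambda>a. time (q a)) (card I)"
    by (rule covariance_form_nonneg) (rule time_nonneg)
  also have "\<dots> = (\<Sum>a<card I. \<Sum>b<card I. c (h a) * c (h b) * limit_kernel (h a) (h b))"
    unfolding covariance_form_def
    by (simp add: matrix_vector_mult_scaleR matrix_form_axis K mult_ac)
  also have "\<dots> = (\<Sum>i\<in>I. \<Sum>k\<in>I. c i * c k * limit_kernel i k)"
    unfolding lessThan_atLeast0
    by (simp add: sum.reindex_bij_betw[OF h, of "\<lambda>k. c _ * c k * limit_kernel _ k"]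
        sum.reindex_bij_betw[OF h, of "\<lambda>i. \<Sum>k\<in>I. c i * c k * limit_kernel i k"])
  finally show "0 \<le> (\<Sum>i\<in>I. \<Sum>k\<in>I. c i * c k * limit_kernel i k)" .
qed

definition limit_field :: "(real \<Rightarrow> real^'d) \<Rightarrow> rat \<Rightarrow> real^'d" where
  "limit_field \<omega> q = (\<chi> j. gaussian_field limit_kernel (to_nat (q, j)) \<omega>)"

lemma limit_field_measurable[measurable]: "(\<lambda>\<omega>. limit_field \<omega> q) \<in> borel_measurable noise_space"
proof -
  have eq: "limit_field \<omega> q = (\<Sum>j\<in>UNIV. gaussian_field limit_kernel (to_nat (q, j)) \<omega> *\<^sub>R axis j 1)" for \<omega>
    by (simp add: limit_field_def vec_eq_iff axis_def if_distrib[of "\<lambda>x. _ * x"] cong: if_cong)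
  show ?thesis unfolding eq by measurable
qed

lemma limit_field_transform:
  "(\<integral>\<omega>. iexp (\<Sum>k<K. c k \<bullet> limit_field \<omega> (q k)) \<partial>noise_space)
    = of_real (exp (- (covariance_form C c (\<lambda>k. time (q k)) K / 2)))"
proof -
  let ?I = "{..<K} \<times> (UNIV :: 'd set)"
  have 1: "(\<Sum>k<K. c k \<bullet> limit_field \<omega> (q k))
      = (\<Sum>p\<in>?I. c (fst p) $ snd p * gaussian_field limit_kernel (to_nat (q (fst p), snd p)) \<omega>)" for \<omega>
    by (simp add: limit_field_def inner_vec_def sum.cartesian_product case_prod_unfold)
  have 2: "(\<Sum>p\<in>?I. \<Sum>p'\<in>?I. c (fst p) $ snd p * c (fst p') $ snd p' *
        limit_kernel (to_nat (q (fst p), snd p)) (to_nat (q (fst p'), snd p')))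
      = covariance_form C c (\<lambda>k. time (q k)) K"
  proof -
    have "covariance_form C c (\<lambda>k. time (q k)) K = (\<Sum>k<K. \<Sum>l<K. \<Sum>j\<in>UNIV. \<Sum>i\<in>UNIV.
        c k $ j * c l $ i * C (min (time (q k)) (time (q l))) $ j $ i)"
      unfolding covariance_form_def matrix_form_expand ..
    also have "\<dots> = (\<Sum>k<K. \<Sum>j\<in>UNIV. \<Sum>l<K. \<Sum>i\<in>UNIV.
        c k $ j * c l $ i * C (min (time (q k)) (time (q l))) $ j $ i)"
      by (rule sum.cong[OF refl], rule sum.swap)
    finally show ?thesis by (simp only: sum.cartesian_product' fst_conv snd_conv limit_kernel_to_nat)
  qed
  show ?thesis
    unfolding 1 by (subst gaussian_field_characteristic_function[OF psd_limit_kernel]) (simp_all only: 2 finite_cartesian_product finite_lessThan finite_class.finite_UNIV)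
qed

definition path_process :: "nat \<Rightarrow> 'a \<Rightarrow> real \<Rightarrow> real^'d" where
  "path_process n \<omega> = (\<lambda>t\<in>{0..}. scaled_walk X (Suc n) t \<omega>)"

definition limit_process :: "(real \<Rightarrow> real^'d) \<Rightarrow> real \<Rightarrow> real^'d" where
  "limit_process \<omega> = path_extension (limit_field \<omega>)"

lemma path_process_measurable: "0 \<le> t \<Longrightarrow> (\<lambda>\<omega>. path_process n \<omega> t) \<in> borel_measurable M"
  using scaled_walk_measurable by (simp add: path_process_def)

lemma limit_process_measurable: "0 \<le> t \<Longrightarrow> (\<lambda>\<omega>. limit_process \<omega> t) \<in> borel_measurable noise_space"
  unfolding limit_process_def by (rule path_extension_measurable(2)[OF limit_field_measurable])

lemma path_process_in_cpaths: "path_process n \<omega> \<in> cpaths"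
proof -
  have "continuous_on {0..} (\<lambda>t. scaled_walk X (Suc n) t \<omega>)"
    unfolding scaled_walk_eq_lin_interp
    by (rule continuous_on_compose2[OF continuous_on_lin_interp]) (auto intro!: continuous_intros)
  then have "continuous_on {0..} (path_process n \<omega>)"
    by (rule continuous_on_eq) (simp add: path_process_def)
  then show ?thesis by (simp add: cpaths_def path_process_def)
qed

lemma rational_values_path_process: "rational_values (path_process n \<omega>) q = scaled_walk X (Suc n) (time q) \<omega>"
  by (simp add: rational_values_def path_process_def time_def)

lemma path_process_transform:
  "(\<lambda>n. \<integral>\<omega>. iexp (\<Sum>k<K. c k \<bullet> rational_values (path_process n \<omega>) (q k)) \<partial>M)
    \<longlonglongrightarrow> of_real (exp (- (covariance_form C c (\<lambda>k. time (q k)) K / 2)))"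
  unfolding rational_values_path_process by (rule finite_dimensional_limit) (rule time_nonneg)

lemma path_process_tight: "uniformly_small_blocks M path_process"
  unfolding uniformly_small_blocks_def
proof (intro allI impI)
  fix T and e \<eta> :: real assume "0 < e" "0 < \<eta>"
  have "small_blocks (path_process n \<omega>) m T e" if "\<forall>k<m * T. \<forall>t. real k / real m \<le> t \<and> t \<le> real (Suc k) / real m \<longrightarrow>
       norm (scaled_walk X (Suc n) t \<omega> - scaled_walk X (Suc n) (real k / real m) \<omega>) \<le> e" for n \<omega> m
    unfolding small_blocks_def
  proof (intro allI impI)
    fix k t assume k: "k < m * T" and t: "real k / real m \<le> t \<and> t \<le> real (Suc k) / real m"
    have "0 \<le> real k / real m" by simp
    then have "0 \<le> t" using t by linarith
    then show "norm (path_process n \<omega> t - path_process n \<omega> (real k / real m)) \<le> e"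
      using that k t by (simp add: path_process_def)
  qed
  then have imp: "(\<forall>\<omega>\<in>S. \<forall>k<m * T. \<forall>t. real k / real m \<le> t \<and> t \<le> real (Suc k) / real m \<longrightarrow>
       norm (scaled_walk X (Suc n) t \<omega> - scaled_walk X (Suc n) (real k / real m) \<omega>) \<le> e)
       \<Longrightarrow> \<forall>\<omega>\<in>S. small_blocks (path_process n \<omega>) m T e" for S n m by blast
  obtain m0 where m0: "m0 \<ge> 1" "\<And>m. m \<ge> m0 \<Longrightarrow> \<forall>\<^sub>F n in sequentially. \<exists>B\<in>sets M. prob B \<le> \<eta> \<and>
    (\<forall>\<omega>\<in>space M - B. \<forall>k<m * T. \<forall>t. real k / real m \<le> t \<and> t \<le> real (Suc k) / real m \<longrightarrow>
       norm (scaled_walk X (Suc n) t \<omega> - scaled_walk X (Suc n) (real k / real m) \<omega>) \<le> e)"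
    using oscillation_tight[OF \<open>0 < e\<close> \<open>0 < \<eta>\<close>, of T] by (elim exE conjE) (rule that, assumption, simp)
  show "\<exists>m0\<ge>1. \<forall>m\<ge>m0. \<forall>\<^sub>F n in sequentially.
     \<exists>B\<in>sets M. prob B \<le> \<eta> \<and> (\<forall>\<omega>\<in>space M - B. small_blocks (path_process n \<omega>) m T e)"
  proof (intro exI[of _ m0] conjI allI impI)
    fix m assume "m0 \<le> m"
    from m0(2)[OF this] show "\<forall>\<^sub>F n in sequentially.
     \<exists>B\<in>sets M. prob B \<le> \<eta> \<and> (\<forall>\<omega>\<in>space M - B. small_blocks (path_process n \<omega>) m T e)"
    proof eventually_elim
      case (elim n)
      then obtain B where "B \<in> sets M" "prob B \<le> \<eta>" and *: "\<forall>\<omega>\<in>space M - B. \<forall>k<m * T. \<forall>t. real k / real m \<le> t \<and> t \<le> real (Suc k) / real m \<longrightarrow>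
       norm (scaled_walk X (Suc n) t \<omega> - scaled_walk X (Suc n) (real k / real m) \<omega>) \<le> e"
        by (elim bexE conjE)
      with imp[OF *] show ?case by (intro bexI[of _ B] conjI)
    qed
  qed (rule m0)
qed

lemma covariance_form_tendsto:
  assumes t: "\<And>k. k < K \<Longrightarrow> 0 \<le> t k" and s: "\<And>k r. k < K \<Longrightarrow> 0 \<le> s r k"
    and lim: "\<And>k. k < K \<Longrightarrow> (\<lambda>r. s r k) \<longlonglongrightarrow> t k"
  shows "(\<lambda>r. covariance_form C c (s r) K) \<longlonglongrightarrow> covariance_form C c t K"
  unfolding covariance_form_def
proof (intro tendsto_sum)
  fix k k' assume k: "k \<in> {..<K}" "k' \<in> {..<K}"
  have "(\<lambda>r. C (min (s r k) (s r k'))) \<longlonglongrightarrow> C (min (t k) (t k'))"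
  proof (rule continuous_on_tendsto_compose[OF C_continuous])
    show "(\<lambda>r. min (s r k) (s r k')) \<longlonglongrightarrow> min (t k) (t k')" using k by (intro tendsto_min lim) auto
  qed (use k t s in auto)
  from bounded_linear.tendsto[OF bounded_linear_matrix_form this]
  show "(\<lambda>r. c k \<bullet> (C (min (s r k) (s r k')) *v c k')) \<longlonglongrightarrow> c k \<bullet> (C (min (t k) (t k')) *v c k')" .
qed

text \<open>
  The characteristic functions of the extension at real times are limits of those of the field at rational
  times, by almost sure convergence and continuity of \<open>C\<close>.
\<close>

theorem functional_limit:
  assumes X_0: "\<And>\<omega>. \<omega> \<in> space M \<Longrightarrow> X 0 \<omega> = 0"
  shows "prob_space (noise_space :: (real \<Rightarrow> real^'d) measure)"
    and "limit_process \<omega> \<in> cpaths"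
    and "indep_gaussian_increments noise_space limit_process"
    and "tendsto_in_distribution cpath_topology M path_process noise_space limit_process"
proof -
  let ?N = "noise_space :: (real \<Rightarrow> real^'d) measure"
  show N: "prob_space ?N" by (rule prob_space_noise_space)
  interpret N: prob_space ?N by (rule N)
  show path: "limit_process \<omega> \<in> cpaths" for \<omega> unfolding limit_process_def by (rule path_extension_in_cpaths)
  have zero: "path_process n \<omega> 0 = 0" if "\<omega> \<in> space M" for n \<omega>
    using X_0[OF that] by (simp add: path_process_def scaled_walk_eq_lin_interp lin_interp_def)
  have luc: "AE \<omega> in ?N. locally_uniformly_continuous (limit_field \<omega>)"
  proof (rule limit_locally_uniformly_continuous[OF prob_space_axioms N path_process_measurable
        limit_field_measurable zero _ path_process_tight])
    show "(\<lambda>n. \<integral>\<omega>. iexp (\<Sum>k<K. c k \<bullet> rational_values (path_process n \<omega>) (q k)) \<partial>M)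
      \<longlonglongrightarrow> (\<integral>\<omega>. iexp (\<Sum>k<K. c k \<bullet> limit_field \<omega> (q k)) \<partial>?N)" for K :: nat and c q
      unfolding limit_field_transform by (rule path_process_transform)
  qed
  have transform: "has_gaussian_transform ?N limit_process C"
    unfolding has_gaussian_transform_def
  proof (intro allI impI)
    fix K c and t :: "nat \<Rightarrow> real" assume t: "\<forall>k<K. 0 \<le> t k"
    have lim1: "(\<lambda>r. \<integral>\<omega>. iexp (\<Sum>k<K. c k \<bullet> limit_field \<omega> (rational_below r (t k))) \<partial>?N)
      \<longlonglongrightarrow> (\<integral>\<omega>. iexp (\<Sum>k<K. c k \<bullet> limit_process \<omega> (t k)) \<partial>?N)"
    proof (rule integral_dominated_convergence[where w = "\<lambda>_. 1"])
      have [measurable]: "(\<lambda>\<omega>. \<Sum>k<K. c k \<bullet> limit_process \<omega> (t k)) \<in> borel_measurable ?N"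
        using t by (intro borel_measurable_sum borel_measurable_inner borel_measurable_const limit_process_measurable) auto
      show "(\<lambda>\<omega>. iexp (\<Sum>k<K. c k \<bullet> limit_process \<omega> (t k))) \<in> borel_measurable ?N" by measurable
      show "(\<lambda>\<omega>. iexp (\<Sum>k<K. c k \<bullet> limit_field \<omega> (rational_below r (t k)))) \<in> borel_measurable ?N" for r
        by measurable
      show "AE \<omega> in ?N. (\<lambda>r. iexp (\<Sum>k<K. c k \<bullet> limit_field \<omega> (rational_below r (t k))))
          \<longlonglongrightarrow> iexp (\<Sum>k<K. c k \<bullet> limit_process \<omega> (t k))"
        using luc
      proof eventually_elim
        case (elim \<omega>)
        show ?case
          unfolding limit_process_def
          using t by (intro tendsto_intros path_extension_converges[OF elim]) auto
      qed
    qed auto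
    have "(\<lambda>r. covariance_form C c (\<lambda>k. time (rational_below r (t k))) K) \<longlonglongrightarrow> covariance_form C c t K"
    proof (rule covariance_form_tendsto)
      fix k assume k: "k < K"
      have "time (rational_below r (t k)) = real_of_rat (rational_below r (t k))" for r
        using rational_below_bounds(1)[of "t k" r] t k by (simp add: time_def max_absorb2)
      then show "(\<lambda>r. time (rational_below r (t k))) \<longlonglongrightarrow> t k"
        using rational_below_tendsto[of "t k"] t k by simp
    qed (use t time_nonneg in auto)
    then have "(\<lambda>r. complex_of_real (exp (- (covariance_form C c (\<lambda>k. time (rational_below r (t k))) K / 2))))
        \<longlonglongrightarrow> of_real (exp (- (covariance_form C c t K / 2)))"
      by (intro tendsto_intros) auto
    then show "(\<integral>\<omega>. iexp (\<Sum>k<K. c k \<bullet> limit_process \<omega> (t k)) \<partial>?N)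
        = of_real (exp (- (covariance_form C c t K / 2)))"
      using lim1 LIMSEQ_unique unfolding limit_field_transform by blast
  qed
  show "indep_gaussian_increments ?N limit_process"
    by (rule indep_gaussian_increments_if_transform[OF N limit_process_measurable transform])
  show "tendsto_in_distribution cpath_topology M path_process ?N limit_process"
  proof (rule cpath_weak_convergence[OF prob_space_axioms N path_process_in_cpaths path
        path_process_measurable limit_process_measurable zero _ path_process_tight])
    fix K :: nat and c and q :: "nat \<Rightarrow> rat"
    have "(\<integral>\<omega>. iexp (\<Sum>k<K. c k \<bullet> rational_values (limit_process \<omega>) (q k)) \<partial>?N)
        = of_real (exp (- (covariance_form C c (\<lambda>k. time (q k)) K / 2)))"
      unfolding rational_values_def time_def[symmetric]
      by (rule transform[unfolded has_gaussian_transform_def, rule_format]) (rule time_nonneg)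
    then show "(\<lambda>n. \<integral>\<omega>. iexp (\<Sum>k<K. c k \<bullet> rational_values (path_process n \<omega>) (q k)) \<partial>M)
      \<longlonglongrightarrow> (\<integral>\<omega>. iexp (\<Sum>k<K. c k \<bullet> rational_values (limit_process \<omega>) (q k)) \<partial>?N)"
      using path_process_transform[where K = K and c = c and q = q] by simp
  qed
qed

end

section \<open>The walk is close to a martingale\<close>

lemma sum_inverse_sqrt_le: "(\<Sum>i=1..k. 1 / sqrt (real i)) \<le> 2 * sqrt (real k)"
proof (induction k)
  case (Suc k)
  let ?a = "sqrt (real k)" and ?b = "sqrt (real (Suc k))"
  have b: "0 < ?b" by simp
  have ab: "?a \<le> ?b" by simp
  have "(?b - ?a) * (?b + ?a) = 1"
    by (simp add: algebra_simps)
  moreover have "(?b - ?a) * (?b + ?a) \<le> (?b - ?a) * (2 * ?b)"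
    using ab by (intro mult_left_mono) auto
  moreover have "(?b - ?a) * (2 * ?b) = 2 * (?b - ?a) * ?b" by (rule mult.left_commute[THEN trans, OF mult.assoc[symmetric]])
  ultimately have "1 \<le> 2 * (?b - ?a) * ?b" by linarith
  then have "1 / ?b \<le> 2 * (?b - ?a)" by (rule pos_divide_le_eq[THEN iffD2, OF b])
  with Suc show ?case by simp
qed simp

text \<open>
  The sum of \<open>1 / sqrt i\<close> over \<open>i \<le> k\<close> has order \<open>sqrt k\<close>, so this is an average of the \<open>a i\<close> up to a constant.
\<close>

lemma weighted_sum_small:
  fixes a :: "nat \<Rightarrow> real"
  assumes a: "a \<longlonglongrightarrow> 0" "\<And>i. 0 \<le> a i"
  shows "(\<lambda>k. (\<Sum>i=1..k. a i / sqrt (real i)) / sqrt (real k)) \<longlonglongrightarrow> 0"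
proof (rule LIMSEQ_I)
  fix e :: real assume e: "0 < e"
  have "\<forall>\<^sub>F i in sequentially. a i < e / 4" using a(1) e by (intro order_tendstoD) auto
  then obtain m where m: "\<And>i. i \<ge> m \<Longrightarrow> a i < e / 4" by (auto simp: eventually_sequentially)
  define A where "A = (\<Sum>i=1..m. a i / sqrt (real i))"
  have A: "0 \<le> A" unfolding A_def using a(2) by (intro sum_nonneg) auto
  have bound: "(\<Sum>i=1..k. a i / sqrt (real i)) \<le> A + e / 2 * sqrt (real k)" for k
  proof -
    have "(\<Sum>i=1..k. a i / sqrt (real i)) \<le> (\<Sum>i=1..k. (if i \<le> m then a i / sqrt (real i) else 0) + e / 4 * (1 / sqrt (real i)))"
    proof (rule sum_mono)
      fix i
      have "a i / sqrt (real i) \<le> e / 4 * (1 / sqrt (real i))" if "\<not> i \<le> m"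
      proof -
        have "a i / sqrt (real i) \<le> e / 4 / sqrt (real i)"
          using m[of i] that by (intro divide_right_mono) auto
        then show ?thesis by simp
      qed
      then show "a i / sqrt (real i) \<le> (if i \<le> m then a i / sqrt (real i) else 0) + e / 4 * (1 / sqrt (real i))"
        using e by auto
    qed
    also have "\<dots> = (\<Sum>i=1..k. if i \<le> m then a i / sqrt (real i) else 0) + e / 4 * (\<Sum>i=1..k. 1 / sqrt (real i))"
      by (simp add: sum.distrib sum_distrib_left)
    also have "(\<Sum>i=1..k. if i \<le> m then a i / sqrt (real i) else 0) \<le> A"
    proof -
      have "(\<Sum>i=1..k. if i \<le> m then a i / sqrt (real i) else 0) = (\<Sum>i\<in>{1..k} \<inter> {..m}. a i / sqrt (real i))"
        by (intro sum.mono_neutral_cong_right) auto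
      also have "\<dots> \<le> A" unfolding A_def using a(2) by (intro sum_mono2) auto
      finally show ?thesis .
    qed
    also have "e / 4 * (\<Sum>i=1..k. 1 / sqrt (real i)) \<le> e / 4 * (2 * sqrt (real k))"
      using e by (intro mult_left_mono sum_inverse_sqrt_le) auto
    finally show ?thesis by simp
  qed
  obtain n where n: "(2 * A / e)\<^sup>2 < real n" using reals_Archimedean2 by blast
  have "norm ((\<Sum>i=1..k. a i / sqrt (real i)) / sqrt (real k) - 0) < e" if k: "k \<ge> max 1 n" for k
  proof -
    have pos: "0 < sqrt (real k)" using k by simp
    have "2 * A / e < sqrt (real k)"
      using n k by (intro real_less_rsqrt) simp
    then have "A < e / 2 * sqrt (real k)" using e by (simp add: field_simps)
    then have "(\<Sum>i=1..k. a i / sqrt (real i)) < e * sqrt (real k)" using bound[of k] by simp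
    moreover have "0 \<le> (\<Sum>i=1..k. a i / sqrt (real i))" using a(2) by (intro sum_nonneg) auto
    ultimately show ?thesis using pos by (simp add: pos_divide_less_eq)
  qed
  then show "\<exists>n. \<forall>k\<ge>n. norm ((\<Sum>i=1..k. a i / sqrt (real i)) / sqrt (real k) - 0) < e" by blast
qed

lemma nn_integral_moment_bound:
  fixes f :: "nat \<Rightarrow> 'a \<Rightarrow> 'e::{banach, second_countable_topology}"
  assumes meas: "\<And>k. k \<ge> 1 \<Longrightarrow> f k \<in> borel_measurable M"
    and sup: "(SUP k\<in>{1..}. (\<integral>\<^sup>+\<omega>. norm (f k \<omega>) \<partial>M) / ennreal (real k powr \<theta>)) < \<infinity>"
  shows "\<exists>B\<ge>0. \<forall>k\<ge>1. integrable M (f k) \<and> (\<integral>\<omega>. norm (f k \<omega>) \<partial>M) \<le> B * real k powr \<theta>"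
proof -
  let ?S = "SUP k\<in>{1..}. (\<integral>\<^sup>+\<omega>. norm (f k \<omega>) \<partial>M) / ennreal (real k powr \<theta>)"
  obtain B where B: "0 \<le> B" "?S = ennreal B"
  proof -
    have "\<exists>B\<ge>0. s = ennreal B" if "s < \<infinity>" for s :: ennreal using that by (cases s) auto
    from this[OF sup] show ?thesis using that by blast
  qed
  show ?thesis
  proof (intro exI[of _ B] conjI allI impI)
    fix k :: nat assume k: "1 \<le> k"
    have p: "0 < real k powr \<theta>" using k by simp
    let ?I = "\<integral>\<^sup>+\<omega>. norm (f k \<omega>) \<partial>M"
    have "?I / ennreal (real k powr \<theta>) \<le> ?S" using k by (intro SUP_upper) auto
    then have "?I / ennreal (real k powr \<theta>) * ennreal (real k powr \<theta>) \<le> ennreal B * ennreal (real k powr \<theta>)"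
      unfolding B(2) by (rule mult_right_mono) simp
    also have "?I / ennreal (real k powr \<theta>) * ennreal (real k powr \<theta>) = ?I"
      using p by (simp add: ennreal_divide_times)
    also have "ennreal B * ennreal (real k powr \<theta>) = ennreal (B * real k powr \<theta>)"
      using B(1) p by (simp add: ennreal_mult)
    finally have le: "?I \<le> ennreal (B * real k powr \<theta>)" .
    show int: "integrable M (f k)"
      by (rule integrableI_bounded[OF meas[OF k]]) (use le in \<open>auto intro: le_less_trans\<close>)
    have "ennreal (\<integral>\<omega>. norm (f k \<omega>) \<partial>M) \<le> ennreal (B * real k powr \<theta>)"
      using le int by (subst nn_integral_eq_integral[symmetric]) auto
    then show "(\<integral>\<omega>. norm (f k \<omega>) \<partial>M) \<le> B * real k powr \<theta>"
      using B(1) p by (simp add: ennreal_le_iff)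
  qed (rule B)
qed

text \<open>
  Independence is given for sigma-algebras; it is transferred to the real-valued variables that are measurable with
  respect to them.
\<close>

lemma (in prob_space) expectation_indicator_times_independent:
  fixes h :: "'a \<Rightarrow> real"
  assumes indep: "indep_set (sets \<A>) (sets \<B>)" and spaces: "space \<A> = space M" "space \<B> = space M"
    and E: "E \<in> sets \<A>" and h: "h \<in> borel_measurable \<B>" and int: "integrable M h"
  shows "integrable M (\<lambda>\<omega>. indicator E \<omega> * h \<omega>)"
    and "expectation (\<lambda>\<omega>. indicator E \<omega> * h \<omega>) = prob E * expectation h"
proof -
  have ev: "sets \<A> \<subseteq> events" "sets \<B> \<subseteq> events" using indep_setD_ev1[OF indep] indep_setD_ev2[OF indep] by auto
  have E': "E \<in> events" using E ev by auto
  have intE: "integrable M (indicat_real E)" using E' by (simp add: emeasure_eq_measure)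
  have generated: "sigma_sets (space M) {X -` A \<inter> space M | A. A \<in> sets borel} \<subseteq> sets \<C>"
    if X: "X \<in> borel_measurable \<C>" and sp: "space \<C> = space M" for X :: "'a \<Rightarrow> real" and \<C>
  proof -
    have "{X -` A \<inter> space \<C> | A. A \<in> sets borel} \<subseteq> sets \<C>" using X by (auto intro: measurable_sets)
    then show ?thesis unfolding sp[symmetric] by (rule sets.sigma_sets_subset)
  qed
  have iv: "indep_var borel (indicat_real E) borel h"
    unfolding indep_var_eq
  proof (intro conjI indep_setI)
    show "random_variable borel (indicat_real E)" "random_variable borel h" using E' int by auto
    have iE: "indicat_real E \<in> borel_measurable \<A>" using E by simp
    show "sigma_sets (space M) {indicat_real E -` A \<inter> space M | A. A \<in> sets borel} \<subseteq> events"
      "sigma_sets (space M) {h -` A \<inter> space M | A. A \<in> sets borel} \<subseteq> events"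
      using generated[OF iE spaces(1)] generated[OF h spaces(2)] ev by auto
    fix a b assume "a \<in> sigma_sets (space M) {indicat_real E -` A \<inter> space M | A. A \<in> sets borel}"
      "b \<in> sigma_sets (space M) {h -` A \<inter> space M | A. A \<in> sets borel}"
    then have "a \<in> sets \<A>" "b \<in> sets \<B>"
      using generated[OF iE spaces(1)] generated[OF h spaces(2)] by auto
    then show "prob (a \<inter> b) = prob a * prob b" by (rule indep_setD[OF indep])
  qed
  show "integrable M (\<lambda>\<omega>. indicator E \<omega> * h \<omega>)" by (rule indep_var_integrable[OF iv intE int])
  show "expectation (\<lambda>\<omega>. indicator E \<omega> * h \<omega>) = prob E * expectation h"
    using indep_var_lebesgue_integral[OF iv intE int] E' by simp
qed

context GERW_star
begin

lemma discrete_filtration: "discrete_filtration M F"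
  by unfold_locales (use subalgebra_F sets_F_mono in auto)

lemma steps_measurable [measurable]:
  "i \<ge> 1 \<Longrightarrow> \<xi> i \<in> borel_measurable M" "i \<ge> 1 \<Longrightarrow> \<gamma> i \<in> borel_measurable M" "i \<ge> 1 \<Longrightarrow> U i \<in> borel_measurable M"
  using measurable_from_subalg[OF subalgebra_F adapted_\<xi>] measurable_from_subalg[OF subalgebra_F adapted_\<gamma>]
    U_indep by (auto simp: indep_vars_def)

text \<open>
  The event that step \<open>i\<close> is replaced by \<open>\<gamma> i\<close> if the current site is new. Dropping the condition on the
  site leaves an event that is independent of the step sizes.
\<close>

definition excitation :: "nat \<Rightarrow> 'a set" where
  "excitation i = {\<omega> \<in> space M. U i \<omega> \<le> gerw_prob \<C> \<beta> i}"

definition excitation_error :: "nat \<Rightarrow> 'a \<Rightarrow> real" where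
  "excitation_error k \<omega> = (\<Sum>i=1..k. indicator (excitation i) \<omega> * norm (\<xi> i \<omega>) + indicator (excitation i) \<omega> * norm (\<gamma> i \<omega>))"

text \<open>
  A step of the walk differs from \<open>\<xi> i\<close> only on the excitation event, and there by \<open>\<gamma> i - \<xi> i\<close>.
\<close>

lemma walk_near_martingale:
  assumes \<omega>: "\<omega> \<in> space M"
  shows "norm (X k \<omega> - (\<Sum>i=1..k. \<xi> i \<omega>)) \<le> excitation_error k \<omega>"
proof (cases "k = 0")
  case True
  then show ?thesis using walk_0[OF \<omega>] by (simp add: excitation_error_def)
next
  case False
  then have "X k \<omega> - (\<Sum>i=1..k. \<xi> i \<omega>) = (\<Sum>i=1..k.
        indicat_real (revisit X (i - 1)) \<omega> *\<^sub>R \<xi> i \<omega>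
      + indicat_real (- revisit X (i - 1) \<inter> {\<omega>. U i \<omega> > gerw_prob \<C> \<beta> i}) \<omega> *\<^sub>R \<xi> i \<omega>
      + indicat_real (- revisit X (i - 1) \<inter> {\<omega>. U i \<omega> \<le> gerw_prob \<C> \<beta> i}) \<omega> *\<^sub>R \<gamma> i \<omega> - \<xi> i \<omega>)"
    using walk[of k \<omega>] \<omega> by (simp add: sum_subtractf)
  also have "norm \<dots> \<le> excitation_error k \<omega>"
    unfolding excitation_error_def
  proof (intro order_trans[OF norm_sum] sum_mono)
    fix i
    show "norm (indicat_real (revisit X (i - 1)) \<omega> *\<^sub>R \<xi> i \<omega>
      + indicat_real (- revisit X (i - 1) \<inter> {\<omega>. U i \<omega> > gerw_prob \<C> \<beta> i}) \<omega> *\<^sub>R \<xi> i \<omega>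
      + indicat_real (- revisit X (i - 1) \<inter> {\<omega>. U i \<omega> \<le> gerw_prob \<C> \<beta> i}) \<omega> *\<^sub>R \<gamma> i \<omega> - \<xi> i \<omega>)
      \<le> indicator (excitation i) \<omega> * norm (\<xi> i \<omega>) + indicator (excitation i) \<omega> * norm (\<gamma> i \<omega>)"
      using \<omega> norm_triangle_ineq4[of "\<gamma> i \<omega>" "\<xi> i \<omega>"]
      by (cases "\<omega> \<in> revisit X (i - 1)"; cases "U i \<omega> \<le> gerw_prob \<C> \<beta> i")
         (auto simp: excitation_def indicator_def not_le)
  qed
  finally show ?thesis .
qed

lemma walk_measurable: "X n \<in> borel_measurable M"
proof (induction n rule: less_induct)
  case (less n)
  show ?case
  proof (cases "n = 0")
    case True
    then show ?thesis using walk_0 by (simp cong: measurable_cong)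
  next
    case False
    have X[measurable]: "X k \<in> borel_measurable M" if "k < n" for k using less that by blast
    have revisit: "{\<omega> \<in> space M. \<exists>k<i. X k \<omega> = X i \<omega>} \<in> sets M" if "i < n" for i
    proof -
      have "{\<omega> \<in> space M. X k \<omega> = X i \<omega>} \<in> sets M" if "k < i" for k
      proof -
        have [measurable]: "X k \<in> borel_measurable M" "X i \<in> borel_measurable M"
          using that \<open>i < n\<close> by (auto intro: X)
        show ?thesis by measurable
      qed
      then have "(\<Union>k<i. {\<omega> \<in> space M. X k \<omega> = X i \<omega>}) \<in> sets M" by auto
      also have "(\<Union>k<i. {\<omega> \<in> space M. X k \<omega> = X i \<omega>}) = {\<omega> \<in> space M. \<exists>k<i. X k \<omega> = X i \<omega>}" by auto
      finally show ?thesis .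
    qed
    have revisit_pred: "Measurable.pred M (\<lambda>\<omega>. \<omega> \<in> revisit X (i - 1))" if "i \<in> {1..n}" for i
    proof -
      have "i - 1 < n" using that by auto
      from revisit[OF this] show ?thesis unfolding pred_def revisit_def mem_Collect_eq .
    qed
    have sum: "(\<lambda>\<omega>. \<Sum>i=1..n. (if \<omega> \<in> revisit X (i - 1) then \<xi> i \<omega>
        else if U i \<omega> > gerw_prob \<C> \<beta> i then \<xi> i \<omega> else \<gamma> i \<omega>)) \<in> borel_measurable M"
    proof (rule borel_measurable_sum)
      fix i assume i: "i \<in> {1..n}"
      then have [measurable]: "\<xi> i \<in> borel_measurable M" "\<gamma> i \<in> borel_measurable M" "U i \<in> borel_measurable M"
        by auto
      note [measurable] = revisit_pred[OF i]
      show "(\<lambda>\<omega>. if \<omega> \<in> revisit X (i - 1) then \<xi> i \<omega>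
        else if U i \<omega> > gerw_prob \<C> \<beta> i then \<xi> i \<omega> else \<gamma> i \<omega>) \<in> borel_measurable M"
        by measurable
    qed
    have eq: "X n \<omega> = (\<Sum>i=1..n. (if \<omega> \<in> revisit X (i - 1) then \<xi> i \<omega>
        else if U i \<omega> > gerw_prob \<C> \<beta> i then \<xi> i \<omega> else \<gamma> i \<omega>))" if "\<omega> \<in> space M" for \<omega>
    proof -
      have "n \<ge> 1" using False by simp
      note walk[OF this that]
      also have "(\<Sum>i=1..n.
        indicat_real (revisit X (i - 1)) \<omega> *\<^sub>R \<xi> i \<omega>
        + indicat_real (- revisit X (i - 1) \<inter> {\<omega>. U i \<omega> > gerw_prob \<C> \<beta> i}) \<omega> *\<^sub>R \<xi> i \<omega>
        + indicat_real (- revisit X (i - 1) \<inter> {\<omega>. U i \<omega> \<le> gerw_prob \<C> \<beta> i}) \<omega> *\<^sub>R \<gamma> i \<omega>)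
        = (\<Sum>i=1..n. (if \<omega> \<in> revisit X (i - 1) then \<xi> i \<omega>
          else if U i \<omega> > gerw_prob \<C> \<beta> i then \<xi> i \<omega> else \<gamma> i \<omega>))"
        by (intro sum.cong refl) (simp add: indicator_def not_less)
      finally show ?thesis .
    qed
    show ?thesis by (rule measurable_cong[THEN iffD2, OF eq sum])
  qed
qed

lemma prob_excitation:
  assumes i: "i \<ge> 1" and C: "0 < \<C>"
  shows "prob (excitation i) \<le> \<C> * real i powr (- \<beta>)"
proof -
  let ?p = "gerw_prob \<C> \<beta> i"
  have p: "0 \<le> ?p" "?p \<le> 1" "?p \<le> \<C> * real i powr (- \<beta>)" using C by (auto simp: gerw_prob_def)
  have "prob (excitation i) = measure (distr M borel (U i)) {..?p}"
    using i by (subst measure_distr) (auto simp: excitation_def intro!: arg_cong[where f = prob])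
  also have "\<dots> = measure lborel ({0..1} \<inter> {..?p})"
    unfolding U_uniform[OF i] by (subst measure_uniform_measure) auto
  also have "{0..1} \<inter> {..?p} = {0..?p}" using p by auto
  finally show ?thesis using p by simp
qed

lemma excitation_independent:
  assumes i: "i \<ge> 1" and h: "h = (\<lambda>\<omega>. norm (\<xi> i \<omega>)) \<or> h = (\<lambda>\<omega>. norm (\<gamma> i \<omega>))" and int: "integrable M h"
  shows "integrable M (\<lambda>\<omega>. indicator (excitation i) \<omega> * h \<omega>)"
    and "expectation (\<lambda>\<omega>. indicator (excitation i) \<omega> * h \<omega>) = prob (excitation i) * expectation h"
proof -
  let ?f = "\<lambda>\<omega>. \<lambda>n\<in>{1..}. U n \<omega>" and ?g = "\<lambda>\<omega>. \<lambda>n\<in>{1..}. (\<xi> n \<omega>, \<gamma> n \<omega>)"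
  let ?PU = "Pi\<^sub>M {1..} (\<lambda>_. borel) :: (nat \<Rightarrow> real) measure"
  let ?PS = "Pi\<^sub>M {1..} (\<lambda>_. borel \<Otimes>\<^sub>M borel) :: (nat \<Rightarrow> (real^'d) \<times> (real^'d)) measure"
  let ?\<A> = "vimage_algebra (space M) ?f ?PU" and ?\<B> = "vimage_algebra (space M) ?g ?PS"
  have f: "?f \<in> ?\<A> \<rightarrow>\<^sub>M ?PU" by (rule measurable_vimage_algebra1) (auto simp: space_PiM)
  have g: "?g \<in> ?\<B> \<rightarrow>\<^sub>M ?PS" by (rule measurable_vimage_algebra1) (auto simp: space_PiM space_pair_measure)
  have "(\<lambda>\<omega>. (?f \<omega>) i) \<in> borel_measurable ?\<A>"
    using i by (intro measurable_compose[OF f measurable_component_singleton]) auto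
  then have Ui[measurable]: "U i \<in> borel_measurable ?\<A>" using i by simp
  have E: "excitation i \<in> sets ?\<A>"
  proof -
    have "{\<omega> \<in> space ?\<A>. U i \<omega> \<le> gerw_prob \<C> \<beta> i} \<in> sets ?\<A>" by measurable
    then show ?thesis by (simp add: excitation_def)
  qed
  have "(\<lambda>\<omega>. (?g \<omega>) i) \<in> ?\<B> \<rightarrow>\<^sub>M borel \<Otimes>\<^sub>M borel"
    using i by (intro measurable_compose[OF g measurable_component_singleton]) auto
  then have gi: "(\<lambda>\<omega>. (\<xi> i \<omega>, \<gamma> i \<omega>)) \<in> ?\<B> \<rightarrow>\<^sub>M borel \<Otimes>\<^sub>M borel" using i by simp
  have steps: "\<xi> i \<in> borel_measurable ?\<B>" "\<gamma> i \<in> borel_measurable ?\<B>"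
    using measurable_compose[OF gi measurable_fst] measurable_compose[OF gi measurable_snd] by simp_all
  have hB: "h \<in> borel_measurable ?\<B>"
    using h measurable_compose[OF steps(1) borel_measurable_norm] measurable_compose[OF steps(2) borel_measurable_norm] by (elim disjE) simp_all
  show "integrable M (\<lambda>\<omega>. indicator (excitation i) \<omega> * h \<omega>)"
    "expectation (\<lambda>\<omega>. indicator (excitation i) \<omega> * h \<omega>) = prob (excitation i) * expectation h"
    using expectation_indicator_times_independent[OF U_indep_steps _ _ E hB int] by simp_all
qed

text \<open>
  By independence of excitations and step sizes, the expected sum of the step sizes over the excitations
  among the first \<open>k\<close> steps is at most a constant times \<open>\<Sum>i\<le>k. i powr (\<theta> - \<beta>)\<close>, and \<open>\<theta> - \<beta> < - 1/2\<close>.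
\<close>

lemma excitation_error_small:
  assumes C: "0 < \<C>"
  shows "\<And>i. i \<ge> 1 \<Longrightarrow> integrable M (\<xi> i)"
    and "\<And>k. integrable M (excitation_error k)"
    and "(\<lambda>k. expectation (excitation_error k) / sqrt (real k)) \<longlonglongrightarrow> 0"
proof -
  obtain \<theta> where \<theta>: "\<theta> < \<beta> - 1/2"
    and sup: "(SUP k\<in>{1..}. (\<integral>\<^sup>+\<omega>. norm (\<xi> k \<omega>) \<partial>M) / ennreal (real k powr \<theta>)) < \<infinity>"
      "(SUP k\<in>{1..}. (\<integral>\<^sup>+\<omega>. norm (\<gamma> k \<omega>) \<partial>M) / ennreal (real k powr \<theta>)) < \<infinity>"
    using moments by blast
  obtain B1 where B1: "0 \<le> B1" "\<And>i. i \<ge> 1 \<Longrightarrow> integrable M (\<xi> i)"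
    "\<And>i. i \<ge> 1 \<Longrightarrow> expectation (\<lambda>\<omega>. norm (\<xi> i \<omega>)) \<le> B1 * real i powr \<theta>"
    using nn_integral_moment_bound[OF steps_measurable(1) sup(1)] by blast
  obtain B2 where B2: "0 \<le> B2" "\<And>i. i \<ge> 1 \<Longrightarrow> integrable M (\<gamma> i)"
    "\<And>i. i \<ge> 1 \<Longrightarrow> expectation (\<lambda>\<omega>. norm (\<gamma> i \<omega>)) \<le> B2 * real i powr \<theta>"
    using nn_integral_moment_bound[OF steps_measurable(2) sup(2)] by blast
  show "integrable M (\<xi> i)" if "i \<ge> 1" for i by (rule B1(2)[OF that])
  have ind1: "integrable M (\<lambda>\<omega>. indicator (excitation i) \<omega> * norm (\<xi> i \<omega>))"
    "expectation (\<lambda>\<omega>. indicator (excitation i) \<omega> * norm (\<xi> i \<omega>)) = prob (excitation i) * expectation (\<lambda>\<omega>. norm (\<xi> i \<omega>))"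
    if "i \<ge> 1" for i
    using excitation_independent[OF that, of "\<lambda>\<omega>. norm (\<xi> i \<omega>)"] B1(2)[OF that] by auto
  have ind2: "integrable M (\<lambda>\<omega>. indicator (excitation i) \<omega> * norm (\<gamma> i \<omega>))"
    "expectation (\<lambda>\<omega>. indicator (excitation i) \<omega> * norm (\<gamma> i \<omega>)) = prob (excitation i) * expectation (\<lambda>\<omega>. norm (\<gamma> i \<omega>))"
    if "i \<ge> 1" for i
    using excitation_independent[OF that, of "\<lambda>\<omega>. norm (\<gamma> i \<omega>)"] B2(2)[OF that] by auto
  show int: "integrable M (excitation_error k)" for k
    unfolding excitation_error_def
    by (intro Bochner_Integration.integrable_sum Bochner_Integration.integrable_add ind1 ind2) auto
  define a where "a = (\<lambda>i. \<C> * (B1 + B2) * real i powr (\<theta> - \<beta> + 1/2))"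
  have a0: "0 \<le> a i" for i using C B1 B2 by (simp add: a_def)
  have "(\<lambda>i. real i powr (\<theta> - \<beta> + 1/2)) \<longlonglongrightarrow> 0"
    using \<theta> by (intro tendsto_neg_powr filterlim_real_sequentially) auto
  then have a: "a \<longlonglongrightarrow> 0" unfolding a_def by (rule tendsto_mult_right_zero)
  have le: "expectation (excitation_error k) \<le> (\<Sum>i=1..k. a i / sqrt (real i))" for k
  proof -
    have "expectation (excitation_error k) = (\<Sum>i=1..k. prob (excitation i) * expectation (\<lambda>\<omega>. norm (\<xi> i \<omega>))
        + prob (excitation i) * expectation (\<lambda>\<omega>. norm (\<gamma> i \<omega>)))"
      unfolding excitation_error_def
      by (subst Bochner_Integration.integral_sum) (auto simp: ind1 ind2 intro!: sum.cong)
    also have "\<dots> \<le> (\<Sum>i=1..k. a i / sqrt (real i))"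
    proof (rule sum_mono)
      fix i assume "i \<in> {1..k}"
      then have i: "i \<ge> 1" by simp
      have "prob (excitation i) * expectation (\<lambda>\<omega>. norm (\<xi> i \<omega>)) + prob (excitation i) * expectation (\<lambda>\<omega>. norm (\<gamma> i \<omega>))
          \<le> (\<C> * real i powr (- \<beta>)) * (B1 * real i powr \<theta>) + (\<C> * real i powr (- \<beta>)) * (B2 * real i powr \<theta>)"
        using C B1(1) B2(1) by (intro add_mono mult_mono prob_excitation[OF i C] B1(3)[OF i] B2(3)[OF i]) auto
      also have "\<dots> = \<C> * (B1 + B2) * (real i powr (- \<beta>) * real i powr \<theta>)" by (simp add: algebra_simps)
      also have "real i powr (- \<beta>) * real i powr \<theta> = real i powr (\<theta> - \<beta> + 1/2) * real i powr (- 1/2)"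
        by (simp flip: powr_add)
      also have "real i powr (- 1/2) = 1 / sqrt (real i)"
        by (simp add: powr_minus_divide powr_half_sqrt)
      finally show "prob (excitation i) * expectation (\<lambda>\<omega>. norm (\<xi> i \<omega>)) + prob (excitation i) * expectation (\<lambda>\<omega>. norm (\<gamma> i \<omega>))
          \<le> a i / sqrt (real i)" by (simp add: a_def)
    qed
    finally show ?thesis .
  qed
  show "(\<lambda>k. expectation (excitation_error k) / sqrt (real k)) \<longlonglongrightarrow> 0"
  proof (rule tendsto_sandwich[OF _ _ tendsto_const weighted_sum_small[OF a a0]])
    show "\<forall>\<^sub>F k in sequentially. 0 \<le> expectation (excitation_error k) / sqrt (real k)"
      by (intro always_eventually allI divide_nonneg_nonneg Bochner_Integration.integral_nonneg)
         (auto simp: excitation_error_def intro!: sum_nonneg)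
    show "\<forall>\<^sub>F k in sequentially. expectation (excitation_error k) / sqrt (real k) \<le> (\<Sum>i=1..k. a i / sqrt (real i)) / sqrt (real k)"
      by (intro always_eventually allI divide_right_mono le) auto
  qed
qed

lemma excitation_error_mono: "k \<le> m \<Longrightarrow> excitation_error k \<omega> \<le> excitation_error m \<omega>"
  unfolding excitation_error_def by (intro sum_mono2) auto

end

theorem proposition2p3:
  fixes M :: "'a measure" and F :: "nat \<Rightarrow> 'a measure"
    and \<xi> \<gamma> X :: "nat \<Rightarrow> 'a \<Rightarrow> real^'d"
    and U :: "nat \<Rightarrow> 'a \<Rightarrow> real"
    and l :: "real^'d"
    and \<C> \<beta> :: real
    and C :: "real \<Rightarrow> real^'d^'d"
  assumes "CARD('d) \<ge> 2" and "\<C> > 0" and "\<beta> > 1/2"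
    and "GERW_star M F \<xi> \<gamma> U l \<C> \<beta> X"
    and "(\<lambda>k. real k powr (- 1/2) * (\<integral>\<omega>. (MAX i\<in>{1..k}. norm (\<xi> i \<omega>)) \<partial>M)) \<longlonglongrightarrow> 0"
    and "continuous_on {0..} C" and "C 0 = 0"
    and "\<And>s t (\<alpha> :: real^'d). 0 \<le> s \<Longrightarrow> s < t \<Longrightarrow>
           (\<Sum>i\<in>UNIV. \<Sum>j\<in>UNIV. (C t $ i $ j - C s $ i $ j) * \<alpha> $ i * \<alpha> $ j) \<ge> 0"
    and "\<And>t. 0 \<le> t \<Longrightarrow> tendsto_in_prob M
           (\<lambda>n \<omega>. (1 / real n) *\<^sub>R
              (\<Sum>i=1..nat \<lfloor>real n * t\<rfloor>. (\<chi> j k. \<xi> i \<omega> $ j * \<xi> i \<omega> $ k) :: real^'d^'d))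
           (C t)"
  shows "\<exists>(N :: (real \<Rightarrow> real^'d) measure) (W :: (real \<Rightarrow> real^'d) \<Rightarrow> real \<Rightarrow> real^'d).
           prob_space N \<and>
           (\<forall>\<omega>\<in>space N. W \<omega> \<in> cpaths) \<and>
           indep_gaussian_increments N W \<and>
           tendsto_in_distribution cpath_topology
             M (\<lambda>n \<omega>. \<lambda>t\<in>{0..}. scaled_walk X (Suc n) t \<omega>) N W"
proof -
  interpret G: GERW_star M F \<xi> \<gamma> U l \<C> \<beta> X by fact
  interpret D: discrete_filtration M F by (rule G.discrete_filtration)
  note error = G.excitation_error_small[OF assms(2)]
  interpret near_martingale M F \<xi> X G.excitation_error C
  proof unfold_locales
    show "\<xi> j \<in> borel_measurable (F j)" if "j \<ge> 1" for j by (rule G.adapted_\<xi>[OF that])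
    show "integrable M (\<xi> j)" if "j \<ge> 1" for j by (rule error(1)[OF that])
    show "AE \<omega> in M. real_cond_exp M (F (j - 1)) (\<lambda>\<omega>. \<xi> j \<omega> $ k) \<omega> = 0" if "j \<ge> 1" for j k
      by (rule G.centered[OF that])
    show "X k \<in> borel_measurable M" for k by (rule G.walk_measurable)
    show "integrable M (G.excitation_error k)" for k by (rule error(2))
    show "G.excitation_error k \<omega> \<le> G.excitation_error m \<omega>" if "k \<le> m" for k m \<omega>
      by (rule G.excitation_error_mono[OF that])
    show "norm (X k \<omega> - (\<Sum>i=1..k. \<xi> i \<omega>)) \<le> G.excitation_error k \<omega>" if "\<omega> \<in> space M" for k \<omega>
      by (rule G.walk_near_martingale[OF that])
    show "(\<lambda>k. G.expectation (G.excitation_error k) / sqrt (real k)) \<longlonglongrightarrow> 0" by (rule error(3))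
  qed (rule assms; assumption)+
  have "path_process = (\<lambda>n \<omega>. \<lambda>t\<in>{0..}. scaled_walk X (Suc n) t \<omega>)"
    by (intro ext) (simp add: path_process_def)
  with functional_limit[OF G.walk_0] show ?thesis by auto
qed

end
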